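(* Let $G$ be a finite soluble group and let $\Gamma=\Gamma(G)$ be its normalising graph. (i) $\Gamma$ is disconnected if and only if $G=KC$ is a Frobenius group with Frobenius kernel $K$ and Frobenius complement $C$ such that for every prime $p$ dividing $|C|$ and every prime $r$ dividing $|K|$, $p$ does not divide $r-1$. Furthermore, in this case every connected component of $\Gamma$ has diameter at most $2$. (ii) If $\Gamma$ is connected, then the diameter of $\Gamma$ is at most $6$. Moreover, there exists a finite soluble group whose normalising graph has diameter exactly $6$.
   Context: For a group $G$, the normalising graph $\Gamma(G)$ has vertex set $G\setminus\{1\}$, and two distinct vertices $x,y$ are adjacent if and only if $\langle x\rangle$ normalises $\langle y\rangle$ or $\langle y\rangle$ normalises $\langle x\rangle$. The distance $\mathrm d(x,y)$ is the length of a shortest path (infinite if none exists), and the diameter is the maximum distance between vertices. *)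

theory Defs
  imports "HOL-Algebra.Algebra" "HOL-Library.Extended_Nat" "HOL-Computational_Algebra.Primes"
begin

definition cyc :: "('a, 'b) monoid_scheme \<Rightarrow> 'a \<Rightarrow> 'a set" where
  "cyc G x = generate G {x}"

definition nvert :: "('a, 'b) monoid_scheme \<Rightarrow> 'a set" where
  "nvert G = carrier G - {\<one>\<^bsub>G\<^esub>}"

definition nadj :: "('a, 'b) monoid_scheme \<Rightarrow> 'a \<Rightarrow> 'a \<Rightarrow> bool" where
  "nadj G x y \<longleftrightarrow> x \<in> nvert G \<and> y \<in> nvert G \<and> x \<noteq> y \<and>
     (cyc G x \<subseteq> normalizer G (cyc G y) \<or> cyc G y \<subseteq> normalizer G (cyc G x))"

definition nwalk :: "('a, 'b) monoid_scheme \<Rightarrow> 'a list \<Rightarrow> bool" where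
  "nwalk G xs \<longleftrightarrow> xs \<noteq> [] \<and> set xs \<subseteq> nvert G \<and>
     (\<forall>i. Suc i < length xs \<longrightarrow> nadj G (xs ! i) (xs ! Suc i))"

(* distance: length of a shortest path, infinity if none *)
definition ndist :: "('a, 'b) monoid_scheme \<Rightarrow> 'a \<Rightarrow> 'a \<Rightarrow> enat" where
  "ndist G x y = Inf {enat (length xs - 1) | xs. nwalk G xs \<and> hd xs = x \<and> last xs = y}"

definition nconnected :: "('a, 'b) monoid_scheme \<Rightarrow> bool" where
  "nconnected G \<longleftrightarrow> (\<forall>x\<in>nvert G. \<forall>y\<in>nvert G. ndist G x y < \<infinity>)"

definition ncomponent :: "('a, 'b) monoid_scheme \<Rightarrow> 'a \<Rightarrow> 'a set" where
  "ncomponent G x = {y \<in> nvert G. ndist G x y < \<infinity>}"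

definition ndiam_on :: "('a, 'b) monoid_scheme \<Rightarrow> 'a set \<Rightarrow> enat" where
  "ndiam_on G S = Sup {ndist G x y | x y. x \<in> S \<and> y \<in> S}"

definition ndiam :: "('a, 'b) monoid_scheme \<Rightarrow> enat" where
  "ndiam G = ndiam_on G (nvert G)"

definition frobenius_complement :: "('a, 'b) monoid_scheme \<Rightarrow> 'a set \<Rightarrow> bool" where
  "frobenius_complement G C \<longleftrightarrow> subgroup C G \<and> C \<noteq> {\<one>\<^bsub>G\<^esub>} \<and> C \<noteq> carrier G \<and>
     (\<forall>g \<in> carrier G - C. C \<inter> (g <#\<^bsub>G\<^esub> C #>\<^bsub>G\<^esub> inv\<^bsub>G\<^esub> g) = {\<one>\<^bsub>G\<^esub>})"

definition frobenius_kernel :: "('a, 'b) monoid_scheme \<Rightarrow> 'a set \<Rightarrow> 'a set" where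
  "frobenius_kernel G C =
     (carrier G - (\<Union>g\<in>carrier G. g <#\<^bsub>G\<^esub> C #>\<^bsub>G\<^esub> inv\<^bsub>G\<^esub> g)) \<union> {\<one>\<^bsub>G\<^esub>}"

definition frob_condition :: "('a, 'b) monoid_scheme \<Rightarrow> bool" where
  "frob_condition G \<longleftrightarrow> (\<exists>K C. frobenius_complement G C \<and> K = frobenius_kernel G C \<and>
     K <#>\<^bsub>G\<^esub> C = carrier G \<and>
     (\<forall>p r :: nat. Factorial_Ring.prime p \<longrightarrow> p dvd card C \<longrightarrow> Factorial_Ring.prime r \<longrightarrow> r dvd card K \<longrightarrow> \<not> p dvd (r - 1)))"

end

theory Submission
  imports Defs "HOL-Number_Theory.Residue_Primitive_Roots" "HOL-Library.Numeral_Type" "HOL-Library.Code_Cardinality"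
    "HOL-Library.Product_Plus"
begin

text \<open>
  Let \<open>N\<close> be a minimal normal subgroup of \<open>G\<close>, \<open>D\<close> its centraliser and \<open>M\<close> a normal subgroup minimal
  subject to \<open>\<not> M \<subseteq> D\<close>; then \<open>M\<close> acts on \<open>N\<close> as an elementary abelian \<open>q\<close>-group with \<open>q\<close> different from
  the characteristic of \<open>N\<close>. Averaging arguments show that two commuting elements of order \<open>q\<close> generating
  a group of rank two cannot act freely on \<open>N\<close>, and that a Frobenius group acting on \<open>N\<close> with a freely
  acting complement has a trivially acting kernel. Hence a vertex is within distance \<open>3\<close> of all of \<open>N\<close>,
  or it commutes with a rank two subgroup of \<open>M\<close> and is within distance \<open>3\<close> of enough of \<open>N\<close> for any two
  such vertices to share a point, or it normalises some \<open>\<langle>m\<rangle>\<close> with \<open>M = (M \<inter> D)\<langle>m\<rangle>\<close>. In the last case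
  \<open>G = D H\<close> with \<open>H\<close> the normaliser of \<open>\<langle>m\<rangle>\<close>. If an element of \<open>H\<close> normalises a cyclic subgroup of \<open>N\<close>,
  then all vertices are within distance \<open>3\<close> of one point of \<open>N\<close>. Otherwise \<open>H\<close> has odd order and all its
  subgroups of prime order are normal, so that a single edge between \<open>H\<close> and \<open>D\<close> has the same effect; if
  there is no such edge, \<open>G\<close> is a Frobenius group with kernel \<open>D\<close> and complement \<open>H\<close>.

  Diameter \<open>6\<close> is attained by \<open>V \<rtimes> (C\<^sub>2\<^sup>2 \<rtimes> C\<^sub>9)\<close>, where \<open>V\<close> is the cube of the field of \<open>25\<close> elements, \<open>C\<^sub>2\<^sup>2\<close>
  consists of the diagonal sign matrices of determinant \<open>1\<close>, and a generator of \<open>C\<^sub>9\<close> is a monomial matrix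
  whose cube is a primitive cube root of unity.
\<close>


section \<open>Normalising relation and distances\<close>

text \<open>The bound 6 is 3 + 3: two vertices are made to meet in a nontrivial element of
  \<open>N\<close>. Every nontrivial \<open>d \<in> D\<close> is adjacent to all nontrivial elements
  of \<open>N\<close>, so a path \<open>x - y - d\<close> already puts \<open>x\<close> within
  distance 3 of all of \<open>N\<close>. The obstacle is an element of prime order without fixed
  points on \<open>D\<close>. By counting or by averaging it must fix something in \<open>M\<close>,
  and the size of its centraliser in \<open>M\<close> decides how to continue. Each averaging
  argument compares two arrays in \<open>N\<close> whose rows multiply to 1 and whose columns agree
  except for one; this takes the place of eigenspaces over a larger field.

  In the example 3 does not divide 5 - 1, so a scalar of order 3 normalises no nontrivial cyclic
  group of translations, while each sign change fixes a coordinate axis. An element of order 9 can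
  leave its cyclic group only through elements of order 3 and reaches \<open>V\<close> only in a
  third step, by way of a sign change. Two such elements with different fixed points, suitably
  chosen, meet no earlier than in \<open>V\<close>.\<close>

locale fin_group = group G for G (structure) +
  assumes fin: "finite (carrier G)"
begin

lemma inv_cancel [simp]:
  assumes "x \<in> carrier G" "y \<in> carrier G"
  shows "inv x \<otimes> (x \<otimes> y) = y" "x \<otimes> (inv x \<otimes> y) = y"
  using assms by (simp_all flip: m_assoc)

lemmas word = m_assoc inv_mult_group

section \<open>Conjugation and normalised cyclic subgroups\<close>

definition conj :: "'a \<Rightarrow> 'a \<Rightarrow> 'a" where "conj g x = g \<otimes> x \<otimes> inv g"

text \<open>
  That \<open>\<langle>x\<rangle>\<close> normalises \<open>\<langle>y\<rangle>\<close>: by finiteness it suffices that conjugation by \<open>x\<close> maps \<open>y\<close> into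
  \<open>\<langle>y\<rangle>\<close>, and exponents can be taken in \<open>nat\<close>.
\<close>

definition normalises :: "'a \<Rightarrow> 'a \<Rightarrow> bool" where "normalises x y \<longleftrightarrow> (\<exists>i::nat. conj x y = y [^] i)"

lemma conj_closed [simp]: "g \<in> carrier G \<Longrightarrow> x \<in> carrier G \<Longrightarrow> conj g x \<in> carrier G"
  by (simp add: conj_def)

lemma conj_conj: "\<lbrakk>g \<in> carrier G; h \<in> carrier G; x \<in> carrier G\<rbrakk> \<Longrightarrow> conj g (conj h x) = conj (g \<otimes> h) x"
  by (simp add: conj_def word)

lemma conj_mult: "\<lbrakk>g \<in> carrier G; x \<in> carrier G; y \<in> carrier G\<rbrakk> \<Longrightarrow> conj g (x \<otimes> y) = conj g x \<otimes> conj g y"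
  by (simp add: conj_def word)

lemma conj_one [simp]: "g \<in> carrier G \<Longrightarrow> conj g \<one> = \<one>"
  by (simp add: conj_def)

lemma one_conj [simp]: "x \<in> carrier G \<Longrightarrow> conj \<one> x = x"
  by (simp add: conj_def)

lemma conj_inv: "\<lbrakk>g \<in> carrier G; x \<in> carrier G\<rbrakk> \<Longrightarrow> conj g (inv x) = inv (conj g x)"
  by (simp add: conj_def word)

lemma conj_pow: "\<lbrakk>g \<in> carrier G; x \<in> carrier G\<rbrakk> \<Longrightarrow> conj g (x [^] (n::nat)) = conj g x [^] n"
  by (induction n) (simp_all add: conj_mult)

lemma conj_inv_conj [simp]: "\<lbrakk>g \<in> carrier G; x \<in> carrier G\<rbrakk> \<Longrightarrow> conj (inv g) (conj g x) = x"
  "\<lbrakk>g \<in> carrier G; x \<in> carrier G\<rbrakk> \<Longrightarrow> conj g (conj (inv g) x) = x"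
  by (simp_all add: conj_conj)

lemma conj_conj_conj:
  "\<lbrakk>g \<in> carrier G; x \<in> carrier G; y \<in> carrier G\<rbrakk> \<Longrightarrow> conj (conj g x) (conj g y) = conj g (conj x y)"
  by (simp add: conj_def word)

lemma conj_inj: "\<lbrakk>g \<in> carrier G; x \<in> carrier G; y \<in> carrier G\<rbrakk> \<Longrightarrow> conj g x = conj g y \<longleftrightarrow> x = y"
  by (metis conj_inv_conj(1))

lemma conj_eq_one: "\<lbrakk>g \<in> carrier G; x \<in> carrier G\<rbrakk> \<Longrightarrow> conj g x = \<one> \<longleftrightarrow> x = \<one>"
  by (metis conj_inv_conj(1) conj_one inv_closed)

lemma conj_fix: "\<lbrakk>g \<in> carrier G; x \<in> carrier G\<rbrakk> \<Longrightarrow> conj g x = x \<longleftrightarrow> g \<otimes> x = x \<otimes> g"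
  by (metis conj_def inv_closed inv_solve_right m_closed)

lemma conj_fix_sym: "\<lbrakk>g \<in> carrier G; x \<in> carrier G\<rbrakk> \<Longrightarrow> conj g x = x \<longleftrightarrow> conj x g = g"
  by (auto simp: conj_fix)

lemma conj_funpow: "\<lbrakk>g \<in> carrier G; x \<in> carrier G\<rbrakk> \<Longrightarrow> (conj g ^^ n) x = conj (g [^] n) x"
proof (induction n arbitrary: x)
  case (Suc n)
  have "(conj g ^^ Suc n) x = (conj g ^^ n) (conj g x)" by (simp add: funpow_swap1)
  also have "\<dots> = conj (g [^] Suc n) x" using Suc by (simp add: conj_conj)
  finally show ?case .
qed simp

lemma pow_fix:
  assumes "g \<in> carrier G" "x \<in> carrier G" "conj g x = x"
  shows "conj (g [^] (n::nat)) x = x"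
proof -
  have "(conj g ^^ n) x = x" by (induction n) (use assms in auto)
  then show ?thesis using assms conj_funpow by simp
qed

lemma inv_eq_pow: assumes "x \<in> carrier G" shows "\<exists>n::nat. inv x = x [^] n"
proof -
  have "x [^] (order G - 1) \<otimes> x = \<one>"
    using assms pow_order_eq_1 fin order_gt_0_iff_finite
    by (metis One_nat_def Suc_pred nat_pow_Suc)
  then show ?thesis using assms by (metis inv_equality nat_pow_closed)
qed

lemma mem_generate_single:
  assumes "a \<in> carrier G" shows "generate G {a} = {a [^] n | n::nat. True}"
  using generate_pow_on_finite_carrier[OF fin assms] by auto

lemma normalises_pow_left:
  assumes "x \<in> carrier G" "y \<in> carrier G" "normalises x y" shows "normalises (x [^] (k::nat)) y"
proof -
  obtain i::nat where i: "conj x y = y [^] i" using assms normalises_def by auto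
  have "(conj x ^^ k) y = y [^] (i ^ k)"
  proof (induction k)
    case (Suc k)
    have "(conj x ^^ Suc k) y = conj x (y [^] (i ^ k))" using Suc by simp
    also have "\<dots> = (y [^] i) [^] (i ^ k)" using assms i by (simp add: conj_pow)
    also have "\<dots> = y [^] (i ^ Suc k)" using assms by (simp add: nat_pow_pow)
    finally show ?case .
  qed (use assms in simp)
  then show ?thesis using assms conj_funpow normalises_def by metis
qed

lemma normalises_pow_right:
  assumes "x \<in> carrier G" "y \<in> carrier G" "normalises x y" shows "normalises x (y [^] (k::nat))"
  using assms unfolding normalises_def by (metis conj_pow nat_pow_pow mult.commute)

lemma normalises_comm: assumes "x \<in> carrier G" "y \<in> carrier G" "conj x y = y" shows "normalises x y"
  using assms unfolding normalises_def by (metis nat_pow_eone)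

lemma normalises_self: "x \<in> carrier G \<Longrightarrow> normalises x x"
  by (simp add: normalises_comm conj_fix)

lemma normalises_mult:
  assumes "x \<in> carrier G" "y \<in> carrier G" "z \<in> carrier G" "normalises x z" "normalises y z" shows "normalises (x \<otimes> y) z"
proof -
  obtain i j::nat where "conj x z = z [^] i" "conj y z = z [^] j" using assms normalises_def by auto
  then have "conj (x \<otimes> y) z = z [^] (i * j)"
    using assms by (simp add: conj_pow nat_pow_pow flip: conj_conj)
  then show ?thesis using normalises_def by auto
qed

lemma normalises_inv:
  assumes "x \<in> carrier G" "y \<in> carrier G" "normalises x y" shows "normalises (inv x) y"
  using assms inv_eq_pow normalises_pow_left by metis

lemma normalises_one: "y \<in> carrier G \<Longrightarrow> normalises \<one> y"
  by (simp add: normalises_comm)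

lemma subgroup_normalises: assumes "y \<in> carrier G" shows "subgroup {g \<in> carrier G. normalises g y} G"
  by (rule subgroupI) (use assms normalises_one in \<open>auto intro: normalises_mult normalises_inv\<close>)

lemma normalises_conj:
  assumes "g \<in> carrier G" "x \<in> carrier G" "y \<in> carrier G" "normalises x y" shows "normalises (conj g x) (conj g y)"
proof -
  obtain i::nat where i: "conj x y = y [^] i" using assms normalises_def by auto
  have "conj (conj g x) (conj g y) = conj g (conj x y)"
    using assms by (simp add: conj_def word)
  also have "\<dots> = conj g y [^] i" using assms by (simp add: i conj_pow)
  finally show ?thesis using normalises_def by auto
qed

lemma normalises_iff_normalizer:
  assumes "x \<in> carrier G" "y \<in> carrier G"
  shows "cyc G x \<subseteq> normalizer G (cyc G y) \<longleftrightarrow> normalises x y"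
proof -
  have cy: "cyc G z = {z [^] n | n::nat. True}" if "z \<in> carrier G" for z
    using that by (simp add: cyc_def mem_generate_single)
  have cs: "cyc G y \<subseteq> carrier G" using assms cy by auto
  have eq: "g <# cyc G y #> inv g = conj g ` cyc G y" if "g \<in> carrier G" for g
    unfolding l_coset_def r_coset_def conj_def by auto
  have nm: "normalizer G (cyc G y) = {g \<in> carrier G. conj g ` cyc G y = cyc G y}"
    unfolding normalizer_def stabilizer_def using cs eq by auto
  have sub: "conj g ` cyc G y \<subseteq> cyc G y \<longleftrightarrow> normalises g y" if g: "g \<in> carrier G" for g
  proof
    assume "conj g ` cyc G y \<subseteq> cyc G y"
    moreover have "y \<in> cyc G y" using cy assms by (auto intro: exI[of _ 1])
    ultimately show "normalises g y" using cy assms normalises_def by auto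
  next
    assume "normalises g y"
    then obtain i::nat where "conj g y = y [^] i" using normalises_def by auto
    then show "conj g ` cyc G y \<subseteq> cyc G y"
      using g assms by (auto simp: cy conj_pow nat_pow_pow)
  qed
  have fc: "finite (cyc G y)" using cs fin finite_subset by blast
  \<comment> \<open>Conjugation is injective and \<open>cyc G y\<close> finite, so inclusion of the
    image already gives equality.\<close>
  have full: "conj g ` cyc G y = cyc G y \<longleftrightarrow> normalises g y" if g: "g \<in> carrier G" for g
  proof -
    have "inj_on (conj g) (cyc G y)" using cs g conj_inj by (meson inj_onI subsetD)
    then show ?thesis using sub[OF g] fc
      by (metis card_image card_subset_eq order_refl)
  qed
  show ?thesis
  proof
    assume "cyc G x \<subseteq> normalizer G (cyc G y)"
    moreover have "x \<in> cyc G x" using cy assms by (auto intro: exI[of _ 1])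
    ultimately show "normalises x y" using nm full assms by blast
  next
    assume "normalises x y"
    then have "conj (x [^] (k::nat)) ` cyc G y = cyc G y" for k
      using full assms normalises_pow_left by simp
    then show "cyc G x \<subseteq> normalizer G (cyc G y)"
      unfolding nm cy[OF assms(1)] using assms by auto
  qed
qed

section \<open>Walks and distances\<close>

definition nbr :: "'a \<Rightarrow> 'a \<Rightarrow> bool" where
  "nbr x y \<longleftrightarrow> x \<in> nvert G \<and> y \<in> nvert G \<and> (normalises x y \<or> normalises y x)"

text \<open>Since \<open>nbr\<close> is reflexive on vertices, its \<open>k\<close>-th power says that the distance is at most \<open>k\<close>.\<close>

definition walk_le :: "nat \<Rightarrow> 'a \<Rightarrow> 'a \<Rightarrow> bool" where "walk_le k = (nbr ^^ k)"

lemma nvert_iff: "x \<in> nvert G \<longleftrightarrow> x \<in> carrier G \<and> x \<noteq> \<one>"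
  by (auto simp: nvert_def)

lemma nadj_iff: "nadj G x y \<longleftrightarrow> nbr x y \<and> x \<noteq> y"
  unfolding nadj_def nbr_def using normalises_iff_normalizer by (auto simp: nvert_iff)

lemma nbr_sym: "nbr x y \<Longrightarrow> nbr y x"
  by (auto simp: nbr_def)

lemma nbr_refl: "x \<in> nvert G \<Longrightarrow> nbr x x"
  by (auto simp: nbr_def nvert_iff normalises_self)

lemma walk_le_1: "walk_le 1 x y \<longleftrightarrow> nbr x y" unfolding walk_le_def by auto

lemma walk_le_trans: "walk_le k x y \<Longrightarrow> walk_le l y z \<Longrightarrow> walk_le (k + l) x z"
  unfolding walk_le_def by (metis relpowp_trans)

lemma walk_le_sym: "walk_le k x y \<Longrightarrow> walk_le k y x"
  unfolding walk_le_def
proof (induction k arbitrary: x)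
  case (Suc k)
  then obtain z where "nbr x z" "(nbr ^^ k) z y" by (meson relpowp_Suc_E2)
  then show ?case using Suc.IH nbr_sym by (meson relpowp_Suc_I)
qed auto

lemma walk_le_mono: "walk_le k x y \<Longrightarrow> y \<in> nvert G \<Longrightarrow> k \<le> l \<Longrightarrow> walk_le l x y"
proof (induction l)
  case (Suc l)
  show ?case
  proof (cases "k = Suc l")
    case False
    then have "walk_le l x y" using Suc by simp
    then show ?thesis using Suc(3) walk_le_trans[of l x y 1 y] nbr_refl walk_le_1 by auto
  qed (use Suc in auto)
qed auto

lemma nwalk_imp_walk_le: "nwalk G xs \<Longrightarrow> walk_le (length xs - 1) (hd xs) (last xs)"
proof (induction xs)
  case (Cons a xs)
  show ?case
  proof (cases "xs = []")
    case False
    have adj: "\<forall>i. Suc i < length (a # xs) \<longrightarrow> nadj G ((a # xs) ! i) ((a # xs) ! Suc i)"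
      using Cons.prems by (simp add: nwalk_def)
    have "nwalk G xs"
      unfolding nwalk_def
    proof (intro conjI allI impI)
      show "set xs \<subseteq> nvert G" using Cons.prems by (simp add: nwalk_def)
      fix i assume "Suc i < length xs"
      then show "nadj G (xs ! i) (xs ! Suc i)" using adj[rule_format, of "Suc i"] by simp
    qed (use False in auto)
    then have "walk_le (length xs - 1) (hd xs) (last xs)" using Cons by auto
    moreover have "nadj G a (hd xs)" using adj[rule_format, of 0] False by (simp add: hd_conv_nth)
    ultimately have "walk_le (1 + (length xs - 1)) a (last xs)"
      using walk_le_trans walk_le_1 nadj_iff by blast
    then show ?thesis using False by (cases xs) auto
  qed (auto simp: walk_le_def)
qed (simp add: nwalk_def)

text \<open>\<open>nbr\<close> is reflexive and \<open>nadj\<close> is not, so stationary steps are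
  dropped and the walk may come out shorter than \<open>k\<close>.\<close>

lemma walk_le_imp_nwalk:
  assumes "walk_le k x y" "x \<in> nvert G"
  shows "\<exists>xs. nwalk G xs \<and> hd xs = x \<and> last xs = y \<and> length xs - 1 \<le> k"
  using assms
proof (induction k arbitrary: x)
  case 0
  then show ?case by (intro exI[of _ "[x]"]) (auto simp: nwalk_def walk_le_def)
next
  case (Suc k)
  then obtain z where z: "nbr x z" "walk_le k z y" unfolding walk_le_def by (meson relpowp_Suc_E2)
  then have zv: "z \<in> nvert G" using nbr_def by auto
  then obtain xs where xs: "nwalk G xs" "hd xs = z" "last xs = y" "length xs - 1 \<le> k"
    using Suc.IH z by blast
  show ?case
  proof (cases "x = z")
    case True then show ?thesis using xs by (intro exI[of _ xs]) auto
  next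
    case False
    have xn: "xs \<noteq> []" using xs nwalk_def by auto
    have "nwalk G (x # xs)"
      unfolding nwalk_def
    proof (intro conjI allI impI)
      fix i assume i: "Suc i < length (x # xs)"
      show "nadj G ((x # xs) ! i) ((x # xs) ! Suc i)"
      proof (cases i)
        case 0
        then show ?thesis using xn xs z False nadj_iff by (auto simp: hd_conv_nth)
      next
        case (Suc j)
        then show ?thesis using xs(1) i unfolding nwalk_def by auto
      qed
    qed (use xs Suc.prems in \<open>auto simp: nwalk_def\<close>)
    then show ?thesis using xs xn by (intro exI[of _ "x # xs"]) (cases xs; auto)
  qed
qed

lemma ndist_le_iff:
  assumes "x \<in> nvert G" "y \<in> nvert G"
  shows "ndist G x y \<le> enat k \<longleftrightarrow> walk_le k x y"
proof
  let ?A = "{enat (length xs - 1) | xs. nwalk G xs \<and> hd xs = x \<and> last xs = y}"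
  assume le: "ndist G x y \<le> enat k"
  \<comment> \<open>The infimum of the empty set is \<open>\<infinity>\<close>; a nonempty set of
    \<open>enat\<close> attains its infimum, which yields an actual walk.\<close>
  have ne: "?A \<noteq> {}"
  proof
    assume "?A = {}"
    then have "ndist G x y = \<infinity>" unfolding ndist_def by (simp add: Inf_enat_def)
    then show False using le by simp
  qed
  then have "ndist G x y \<in> ?A" unfolding ndist_def
    by (metis (lifting) Inf_enat_def LeastI ex_in_conv)
  then obtain xs where "nwalk G xs" "hd xs = x" "last xs = y" "enat (length xs - 1) \<le> enat k"
    using le by auto
  then show "walk_le k x y" using nwalk_imp_walk_le walk_le_mono assms by (metis enat_ord_simps(1))
next
  assume "walk_le k x y"
  then obtain xs where xs: "nwalk G xs" "hd xs = x" "last xs = y" "length xs - 1 \<le> k"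
    using walk_le_imp_nwalk assms by blast
  have "ndist G x y \<le> enat (length xs - 1)"
    unfolding ndist_def by (rule Inf_lower) (use xs in auto)
  also have "\<dots> \<le> enat k" using xs by simp
  finally show "ndist G x y \<le> enat k" .
qed

lemma ndist_finite_iff:
  assumes "x \<in> nvert G" "y \<in> nvert G"
  shows "ndist G x y < \<infinity> \<longleftrightarrow> (\<exists>k. walk_le k x y)"
proof
  assume "ndist G x y < \<infinity>"
  then obtain k where "ndist G x y = enat k" by auto
  then show "\<exists>k. walk_le k x y" using ndist_le_iff assms by (metis order_refl)
next
  assume "\<exists>k. walk_le k x y"
  then show "ndist G x y < \<infinity>" using ndist_le_iff assms by (metis enat_ord_simps(4) infinity_ileE)
qed

end

section \<open>Products over orbits in abelian groups\<close>

lemma funpow_fix: "f t = t \<Longrightarrow> (f ^^ n) t = t"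
  by (induction n) auto

text \<open>Bezout in the form \<open>d * a = p * b + 1\<close>: after both periods are used up, one
  application of \<open>f\<close> is left.\<close>

lemma funpow_coprime_fix:
  assumes "(f ^^ d) t = t" "(f ^^ p) t = t" "coprime d (p::nat)" "d \<noteq> 0"
  shows "f t = t"
proof -
  obtain a b where ab: "d * a = p * b + 1"
    using bezout_nat[OF assms(4), of p] assms(3) by auto
  have "(f ^^ (d * a)) t = t" using assms(1) funpow_fix[of "f ^^ d" t a] by (simp add: funpow_mult)
  moreover have "(f ^^ (p * b)) t = t" using assms(2) funpow_fix[of "f ^^ p" t b] by (simp add: funpow_mult)
  ultimately show ?thesis using ab by (simp)
qed

text \<open>One orbit is removed at a time. It has exactly \<open>p\<close> elements, because a
  shorter period would be coprime to \<open>p\<close> and produce a fixed point.\<close>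

lemma prime_period_dvd:
  assumes "finite S" "Factorial_Ring.prime (p::nat)" "\<And>s. s \<in> S \<Longrightarrow> f s \<in> S" "\<And>s. s \<in> S \<Longrightarrow> (f ^^ p) s = s"
    "\<And>s. s \<in> S \<Longrightarrow> f s \<noteq> s"
  shows "p dvd card S"
  using assms(1,3-)
proof (induction "card S" arbitrary: S rule: less_induct)
  case less
  show ?case
  proof (cases "S = {}")
    case False
    then obtain s where s: "s \<in> S" by auto
    define Ob where "Ob = (\<lambda>i. (f ^^ i) s) ` {..<p}"
    have p0: "p > 0" using assms(2) prime_gt_0_nat by auto
    have iS: "(f ^^ i) u \<in> S" if "u \<in> S" for i u by (induction i) (use less that in auto)
    have inj: "inj_on (\<lambda>i. (f ^^ i) s) {..<p}"
    proof (rule linorder_inj_onI)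
      fix i j assume ij: "i < j" "i \<in> {..<p}" "j \<in> {..<p}"
      let ?t = "(f ^^ i) s"
      show "?t \<noteq> (f ^^ j) s"
      proof
        assume eq: "?t = (f ^^ j) s"
        have "(f ^^ (j - i)) ?t = ?t"
          using ij eq funpow_add[of "j - i" i f] by (metis comp_apply less_imp_le le_add_diff_inverse2)
        moreover have "(f ^^ p) ?t = ?t" using less iS s by auto
        moreover have "coprime (j - i) p" using assms(2) ij
          by (meson coprime_commute diff_less dual_order.strict_trans lessThan_iff less_imp_diff_less nat_dvd_not_less prime_imp_coprime zero_less_diff)
        ultimately have "f ?t = ?t" using ij funpow_coprime_fix by (metis zero_less_diff less_irrefl)
        then show False using less iS s by auto
      qed
    qed auto
    then have cO: "card Ob = p" unfolding Ob_def by (simp add: card_image)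
    have OS: "Ob \<subseteq> S" unfolding Ob_def using iS s by auto
    have fO: "f u \<in> Ob" if u: "u \<in> Ob" for u
    proof -
      obtain i where i: "i < p" "u = (f ^^ i) s" using u unfolding Ob_def by auto
      show ?thesis
      proof (cases "Suc i < p")
        case True
        then show ?thesis unfolding Ob_def using i by (intro image_eqI[of _ _ "Suc i"]) auto
      next
        case False
        then have "Suc i = p" using i by simp
        then have "f u = (f ^^ p) s" using i by auto
        then have "f u = s" using less s by auto
        then show ?thesis unfolding Ob_def using p0 by (intro image_eqI[of _ _ 0]) auto
      qed
    qed
    have fOi: "(f ^^ i) u \<in> Ob" if "u \<in> Ob" for i u by (induction i) (use fO that in auto)
    \<comment> \<open>\<open>Ob\<close> is a full orbit: from \<open>f u \<in> Ob\<close>, another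
      \<open>p - 1\<close> steps lead back to \<open>u\<close>.\<close>
    have cl: "f u \<in> S - Ob" if "u \<in> S - Ob" for u
    proof -
      have "f u \<notin> Ob"
      proof
        assume "f u \<in> Ob"
        then have "(f ^^ (p - 1)) (f u) \<in> Ob" using fOi by auto
        moreover have "(f ^^ (p - 1)) (f u) = (f ^^ p) u"
          using p0 by (metis Suc_diff_1 comp_apply funpow_Suc_right)
        ultimately show False using less that by auto
      qed
      then show ?thesis using less that by auto
    qed
    have cd: "card (S - Ob) = card S - p" using cO OS less.prems(1) by (simp add: card_Diff_subset finite_subset)
    moreover have cge: "card S \<ge> p" using cO OS less.prems(1) card_mono by metis
    ultimately have lt: "card (S - Ob) < card S" using p0 by linarith
    have "p dvd card (S - Ob)"
    proof (rule less.hyps[OF lt])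
      fix u assume "u \<in> S - Ob"
      then show "f u \<in> S - Ob" "(f ^^ p) u = u" "f u \<noteq> u" using cl less.prems by blast+
    qed (use less.prems in simp)
    then show ?thesis using cd cge by (simp add: dvd_minus_self)
  qed simp
qed

text \<open>The moved points are closed under \<open>f\<close>, since
  \<open>(f ^^ (p - 1)) (f s) = s\<close>, and contribute a multiple of \<open>p\<close>.\<close>

lemma prime_period_card:
  assumes "finite S" "Factorial_Ring.prime (p::nat)" "\<And>s. s \<in> S \<Longrightarrow> f s \<in> S" "\<And>s. s \<in> S \<Longrightarrow> (f ^^ p) s = s"
  shows "p dvd card S \<longleftrightarrow> p dvd card {s \<in> S. f s = s}"
proof -
  let ?F = "{s \<in> S. f s = s}"
  have d: "p dvd card (S - ?F)"
  proof (rule prime_period_dvd[where f = f])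
    fix s assume s: "s \<in> S - ?F"
    have "f s \<noteq> s" using s by auto
    moreover have "s = f s" if "f (f s) = f s"
    proof -
      have "(f ^^ (p - 1)) (f s) = f s" using funpow_fix that by metis
      moreover have "(f ^^ (p - 1)) (f s) = (f ^^ p) s"
        using assms(2) prime_gt_0_nat by (metis Suc_diff_1 comp_apply funpow_Suc_right)
      ultimately show ?thesis using assms s by auto
    qed
    ultimately show "f s \<in> S - ?F" using assms s by auto
  qed (use assms in auto)
  have c: "card S = card (S - ?F) + card ?F"
    using assms(1) card_Diff_subset[of ?F S] card_mono[of S ?F] by simp
  show ?thesis unfolding c by (rule dvd_add_right_iff[OF d])
qed

lemma card_image_fibres:
  assumes "finite A" "\<And>a. a \<in> A \<Longrightarrow> card {b \<in> A. f b = f a} = n"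
  shows "card A = card (f ` A) * n"
proof -
  have "card A = (\<Sum>y\<in>f ` A. card {b \<in> A. f b = y})"
    using sum.image_gen[OF assms(1), of "\<lambda>_. 1 :: nat" f] by (simp only: card_eq_sum)
  also have "\<dots> = (\<Sum>y\<in>f ` A. n)" using assms(2) by (intro sum.cong) auto
  finally show ?thesis by simp
qed

section \<open>Orbit products of endomorphisms\<close>

context comm_group
begin

lemma finprod_swap:
  assumes "finite I" "finite J" "\<And>i j. i \<in> I \<Longrightarrow> j \<in> J \<Longrightarrow> F i j \<in> carrier G"
  shows "(\<Otimes>i\<in>I. \<Otimes>j\<in>J. F i j) = (\<Otimes>j\<in>J. \<Otimes>i\<in>I. F i j)"
  using assms(1,3)
proof (induction I rule: finite_induct)
  case (insert a I)
  then have "(\<Otimes>i\<in>insert a I. \<Otimes>j\<in>J. F i j) = (\<Otimes>j\<in>J. F a j) \<otimes> (\<Otimes>j\<in>J. \<Otimes>i\<in>I. F i j)"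
    by (subst finprod_insert) auto
  also have "\<dots> = (\<Otimes>j\<in>J. F a j \<otimes> (\<Otimes>i\<in>I. F i j))"
    using insert by (subst finprod_multf) auto
  also have "\<dots> = (\<Otimes>j\<in>J. \<Otimes>i\<in>insert a I. F i j)"
    using insert by (intro finprod_cong') auto
  finally show ?case .
qed simp

text \<open>The common core of both averaging arguments. All rows of \<open>F\<close> and
  \<open>F'\<close> multiply to one, so both total products are one; cancelling the equal columns
  leaves column \<open>0\<close>.\<close>

lemma double_product:
  assumes "finite I" "p > (0::nat)"
    and c: "\<And>i j. i \<in> I \<Longrightarrow> j < p \<Longrightarrow> F i j \<in> carrier G" "\<And>i j. i \<in> I \<Longrightarrow> j < p \<Longrightarrow> F' i j \<in> carrier G"
    and one: "\<And>i. i \<in> I \<Longrightarrow> (\<Otimes>j\<in>{..<p}. F i j) = \<one>" "\<And>i. i \<in> I \<Longrightarrow> (\<Otimes>j\<in>{..<p}. F' i j) = \<one>"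
    and eq: "\<And>j. 0 < j \<Longrightarrow> j < p \<Longrightarrow> (\<Otimes>i\<in>I. F i j) = (\<Otimes>i\<in>I. F' i j)"
  shows "(\<Otimes>i\<in>I. F i 0) = (\<Otimes>i\<in>I. F' i 0)"
proof -
  have *: "(\<Otimes>i\<in>I. E i 0) \<otimes> (\<Otimes>j\<in>{1..<p}. \<Otimes>i\<in>I. E i j) = \<one>"
    if "\<And>i j. i \<in> I \<Longrightarrow> j < p \<Longrightarrow> E i j \<in> carrier G" "\<And>i. i \<in> I \<Longrightarrow> (\<Otimes>j\<in>{..<p}. E i j) = \<one>" for E
  proof -
    have "{..<p} = insert 0 {1..<p}" using assms(2) by auto
    then have "(\<Otimes>i\<in>I. E i 0) \<otimes> (\<Otimes>j\<in>{1..<p}. \<Otimes>i\<in>I. E i j) = (\<Otimes>j\<in>{..<p}. \<Otimes>i\<in>I. E i j)"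
      using that(1) by (simp only:) (subst finprod_insert, auto intro!: finprod_closed)
    also have "\<dots> = (\<Otimes>i\<in>I. \<Otimes>j\<in>{..<p}. E i j)"
      by (rule finprod_swap) (use assms(1) that in auto)
    also have "\<dots> = \<one>" using that(2) by (rule finprod_one_eqI)
    finally show ?thesis .
  qed
  have e: "(\<Otimes>j\<in>{1..<p}. \<Otimes>i\<in>I. F i j) = (\<Otimes>j\<in>{1..<p}. \<Otimes>i\<in>I. F' i j)"
    by (rule finprod_cong') (use eq c in \<open>auto intro!: finprod_closed\<close>)
  have "(\<Otimes>i\<in>I. F i 0) \<otimes> (\<Otimes>j\<in>{1..<p}. \<Otimes>i\<in>I. F i j) = (\<Otimes>i\<in>I. F' i 0) \<otimes> (\<Otimes>j\<in>{1..<p}. \<Otimes>i\<in>I. F i j)"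
    using *[of F] *[of F'] c one unfolding e by simp
  then show ?thesis
    by (subst (asm) r_cancel) (use c assms(2) in \<open>auto intro!: finprod_closed\<close>)
qed

lemma hom_finprod:
  assumes "f \<in> hom G G" "\<And>i. i \<in> I \<Longrightarrow> g i \<in> carrier G"
  shows "f (\<Otimes>i\<in>I. g i) = (\<Otimes>i\<in>I. f (g i))"
proof -
  interpret f: group_hom G G f using assms(1) by (simp add: group_hom_def group_hom_axioms_def is_group)
  show ?thesis using assms(2)
  proof (induction I rule: infinite_finite_induct)
    case (insert x F)
    then have "f (g x \<otimes> finprod G g F) = f (g x) \<otimes> finprod G (\<lambda>i. f (g i)) F"
      by (subst f.hom_mult) auto
    then show ?case using insert by simp
  qed auto
qed

text \<open>The product over an orbit is a fixed point of \<open>f\<close>.\<close>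

lemma norm_eq_one:
  assumes "f \<in> hom G G" "v \<in> carrier G" "p > (0::nat)" "(f ^^ p) v = v"
    "\<And>u. u \<in> carrier G \<Longrightarrow> f u = u \<Longrightarrow> u = \<one>"
  shows "(\<Otimes>j\<in>{..<p}. (f ^^ j) v) = \<one>"
proof -
  have cl: "(f ^^ j) v \<in> carrier G" for j
    by (induction j) (use assms(1,2) in \<open>auto simp: hom_def\<close>)
  have "f (\<Otimes>j\<in>{..<p}. (f ^^ j) v) = (\<Otimes>j\<in>{..<p}. (f ^^ Suc j) v)"
    using hom_finprod[OF assms(1), of "{..<p}" "\<lambda>j. (f ^^ j) v"] cl by simp
  also have "\<dots> = (\<Otimes>j\<in>Suc ` {..<p}. (f ^^ j) v)"
    by (rule finprod_reindex[symmetric]) (use cl in auto)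
  also have "Suc ` {..<p} = insert p {1..<p}"
    using assms(3) by (simp only: image_Suc_lessThan) auto
  also have "(\<Otimes>j\<in>insert p {1..<p}. (f ^^ j) v) = v \<otimes> (\<Otimes>j\<in>{1..<p}. (f ^^ j) v)"
    using cl assms(2,4) by (subst finprod_insert) auto
  also have "\<dots> = (\<Otimes>j\<in>insert 0 {1..<p}. (f ^^ j) v)"
    using cl assms(2) by (subst finprod_insert) auto
  also have "insert 0 {1..<p} = {..<p}" using assms(3) by auto
  finally show ?thesis using assms(5) cl by (auto intro!: finprod_closed)
qed

text \<open>
  Multiply the orbit products of \<open>v\<close> under the operators \<open>U T\<^sup>a\<close> for \<open>a < p\<close>. For fixed \<open>0 < j < p\<close> the
  exponents \<open>a j\<close> run through all residues modulo \<open>p\<close>, so everything but the terms with \<open>j = 0\<close> cancels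
  and \<open>v\<^sup>p\<close> is the orbit product of \<open>v\<close> under \<open>T\<close>.
\<close>

lemma commuting_periodic_homs:
  assumes T: "T \<in> hom G G" and U: "U \<in> hom G G"
    and comm: "\<And>v. v \<in> carrier G \<Longrightarrow> U (T v) = T (U v)"
    and per: "\<And>v. v \<in> carrier G \<Longrightarrow> (T ^^ p) v = v" "\<And>v. v \<in> carrier G \<Longrightarrow> (U ^^ p) v = v"
    and p: "Factorial_Ring.prime (p::nat)"
    and fp: "\<And>a v. v \<in> carrier G \<Longrightarrow> U ((T ^^ a) v) = v \<Longrightarrow> v = \<one>"
    and v: "v \<in> carrier G"
  shows "T (v [^] p) = v [^] p"
proof -
  have p0: "p > 0" using p prime_gt_0_nat by auto
  have Xc: "(T ^^ a) w \<in> carrier G" if "w \<in> carrier G" for a w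
    by (induction a) (use T that in \<open>auto simp: hom_def\<close>)
  have Uc: "(U ^^ a) w \<in> carrier G" if "w \<in> carrier G" for a w
    by (induction a) (use U that in \<open>auto simp: hom_def\<close>)
  have Xh: "(T ^^ a) \<in> hom G G" for a
  proof (induction a)
    case (Suc a)
    then show ?case using T by (auto simp: hom_def Pi_iff)
  qed (auto simp: hom_def)
  have UX: "U ((T ^^ a) w) = (T ^^ a) (U w)" if "w \<in> carrier G" for a w
    by (induction a) (use comm Xc that in auto)
  let ?W = "\<lambda>a v. U ((T ^^ a) v)"
  have Wh: "?W a \<in> hom G G" for a
    using U Xh[of a] by (auto simp: hom_def Pi_iff)
  have Wpow: "(?W a ^^ j) w = (U ^^ j) ((T ^^ (a * j)) w)" if "w \<in> carrier G" for a j w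
  proof (induction j)
    case (Suc j)
    have "(?W a ^^ Suc j) w = U ((T ^^ a) ((U ^^ j) ((T ^^ (a * j)) w)))" using Suc by simp
    also have "(T ^^ a) ((U ^^ j) ((T ^^ (a * j)) w)) = (U ^^ j) ((T ^^ a) ((T ^^ (a * j)) w))"
    proof -
      have "(T ^^ a) ((U ^^ j) z) = (U ^^ j) ((T ^^ a) z)" if "z \<in> carrier G" for z
      proof (induction j)
        case (Suc j)
        have "(T ^^ a) ((U ^^ Suc j) z) = U ((T ^^ a) ((U ^^ j) z))" using UX[of "(U ^^ j) z" a] Uc that by simp
        then show ?case using Suc by simp
      qed simp
      then show ?thesis using Xc that by auto
    qed
    also have "\<dots> = (U ^^ j) ((T ^^ (a * Suc j)) w)" by (simp add: funpow_add)
    finally show ?case by simp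
  qed simp
  have Xmod: "(T ^^ a) w = (T ^^ (a mod p)) w" if "w \<in> carrier G" for a w
  proof -
    have "(T ^^ (a mod p + p * (a div p))) w = (T ^^ (a mod p)) ((T ^^ (p * (a div p))) w)"
      by (simp only: funpow_add comp_apply)
    also have "(T ^^ (p * (a div p))) w = w"
      using funpow_fix[of "T ^^ p" w "a div p"] per(1)[OF that] by (simp add: funpow_mult)
    finally show ?thesis by (simp only: mod_mult_div_eq)
  qed
  \<comment> \<open>Row \<open>a\<close> of \<open>?F\<close> is the orbit of \<open>v\<close> under
    \<open>U\<close> after \<open>T ^^ a\<close>, row \<open>a\<close> of \<open>?F'\<close> is the
    image under \<open>T ^^ a\<close> of its orbit under \<open>U\<close>. Columns with
    \<open>j > 0\<close> are permutations of each other; column \<open>0\<close> gives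
    \<open>v [^] p\<close> for \<open>?F\<close> and the orbit product under \<open>T\<close> for
    \<open>?F'\<close>.\<close>
  let ?F = "\<lambda>a j. (?W a ^^ j) v" and ?F' = "\<lambda>a j. (T ^^ a) ((U ^^ j) v)"
  have F'eq: "?F' a j = (U ^^ j) ((T ^^ a) v)" for a j
  proof (induction j)
    case (Suc j)
    have "?F' a (Suc j) = U ((T ^^ a) ((U ^^ j) v))" using UX[of "(U ^^ j) v" a] Uc v by simp
    then show ?case using Suc by simp
  qed simp
  have "(\<Otimes>a\<in>{..<p}. ?F a 0) = (\<Otimes>a\<in>{..<p}. ?F' a 0)"
  proof (rule double_product[OF _ p0])
    fix a assume "a \<in> {..<p}"
    show "(\<Otimes>j\<in>{..<p}. ?F a j) = \<one>"
    proof (rule norm_eq_one[OF Wh v p0])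
      show "(?W a ^^ p) v = v"
        unfolding Wpow[OF v] Xmod[OF v, of "a * p"] using per v by simp
    qed (use fp in auto)
    have "(\<Otimes>j\<in>{..<p}. ?F' a j) = (T ^^ a) (\<Otimes>j\<in>{..<p}. (U ^^ j) v)"
      by (rule hom_finprod[symmetric]) (use Xh Uc v in auto)
    also have "(\<Otimes>j\<in>{..<p}. (U ^^ j) v) = \<one>"
      by (rule norm_eq_one) (use U v p0 per fp[of _ 0] in auto)
    also have "(T ^^ a) \<one> = \<one>" using hom_one[OF Xh is_group is_group] by simp
    finally show "(\<Otimes>j\<in>{..<p}. ?F' a j) = \<one>" .
  next
    fix j assume j: "0 < j" "j < p"
    have cop: "coprime j p" using j p by (meson coprime_commute nat_dvd_not_less prime_imp_coprime)
    let ?h = "\<lambda>a. a * j mod p"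
    have inj: "inj_on ?h {..<p}"
    proof (rule inj_onI)
      fix a b assume ab: "a \<in> {..<p}" "b \<in> {..<p}" "a * j mod p = b * j mod p"
      then have "[a * j = b * j] (mod p)" by (simp add: cong_def)
      then have "[a = b] (mod p)" using cop cong_mult_rcancel_nat by blast
      then show "a = b" using ab by (simp add: cong_def)
    qed
    have im: "?h ` {..<p} = {..<p}"
      by (rule endo_inj_surj[OF _ _ inj]) (use p0 in auto)
    have "(\<Otimes>a\<in>{..<p}. ?F a j) = (\<Otimes>a\<in>{..<p}. ?F' (?h a) j)"
    proof (rule finprod_cong')
      fix a
      show "?F a j = ?F' (?h a) j"
        unfolding F'eq Wpow[OF v] using Xmod[OF v, of "a * j"] by (rule arg_cong)
    qed (use Xc Uc v in auto)
    also have "\<dots> = (\<Otimes>a\<in>?h ` {..<p}. ?F' a j)"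
      by (rule finprod_reindex[symmetric]) (use inj Xc Uc v in auto)
    finally show "(\<Otimes>a\<in>{..<p}. ?F a j) = (\<Otimes>a\<in>{..<p}. ?F' a j)" unfolding im .
  qed (use Wpow Xc Uc v in auto)
  then have eq: "v [^] p = (\<Otimes>a\<in>{..<p}. (T ^^ a) v)"
    using finprod_const[OF v, of "{..<p}"] by simp
  have "T (\<Otimes>a\<in>{..<p}. (T ^^ a) v) = (\<Otimes>a\<in>{..<p}. (T ^^ Suc a) v)"
    using hom_finprod[OF T, of "{..<p}" "\<lambda>a. (T ^^ a) v"] Xc v by simp
  also have "\<dots> = (\<Otimes>a\<in>{..<p}. (T ^^ (Suc a mod p)) v)"
    by (rule finprod_cong'[OF refl _ Xmod[OF v]]) (use Xc v in auto)
  also have "\<dots> = (\<Otimes>a\<in>(\<lambda>a. Suc a mod p) ` {..<p}. (T ^^ a) v)"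
  proof (rule finprod_reindex[symmetric])
    show "inj_on (\<lambda>a. Suc a mod p) {..<p}" by (auto simp: inj_on_def mod_Suc split: if_splits)
  qed (use Xc v in auto)
  also have "(\<lambda>a. Suc a mod p) ` {..<p} = {..<p}"
    by (rule endo_inj_surj) (use p0 in \<open>auto simp: inj_on_def mod_Suc split: if_splits\<close>)
  finally show ?thesis unfolding eq .
qed

end

section \<open>Sylow subgroups and coprime actions\<close>

lemma exists_root_of_unity_mod_prime:
  fixes p r :: nat
  assumes "Factorial_Ring.prime p" "Factorial_Ring.prime r" "p dvd r - 1"
  shows "\<exists>l. [l ^ p = 1] (mod r) \<and> \<not> [l = 1] (mod r)"
proof -
  obtain g where g: "residue_primroot r g"
    using prime_primitive_root_exists[of r] assms(2) prime_gt_1_nat by auto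
  then have og: "ord r g = r - 1"
    using assms(2) by (auto simp: residue_primroot_def totient_prime)
  obtain k where k: "r - 1 = p * k" using assms(3) by auto
  have r1: "r - 1 > 0" using assms(2) prime_gt_1_nat by simp
  have kp: "k > 0" "p > 1" using k r1 assms(1) prime_gt_1_nat by (auto intro: gr0I)
  have "[(g ^ k) ^ p = 1] (mod r)"
    using ord_divides[of g "k * p" r] og k by (simp add: mult.commute flip: power_mult)
  moreover have "\<not> [g ^ k = 1] (mod r)"
  proof
    assume "[g ^ k = 1] (mod r)"
    then have "p * k dvd k" using ord_divides[of g k r] og k by simp
    then show False using kp by (simp add: dvd_imp_le nat_dvd_not_less)
  qed
  ultimately show ?thesis by blast
qed

context fin_group
begin

section \<open>Orders and powers of elements\<close>

lemma pow_eq_one_iff: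
  assumes "x \<in> carrier G" "x \<noteq> \<one>" "Factorial_Ring.prime (p::nat)" "x [^] p = \<one>"
  shows "x [^] (n::nat) = \<one> \<longleftrightarrow> p dvd n"
proof -
  have "ord x = p" using assms pow_eq_id by (metis ord_eq_1 prime_nat_iff)
  then show ?thesis using assms pow_eq_id by metis
qed

lemma coprime_pow_one:
  assumes "x \<in> carrier G" "x [^] (m::nat) = \<one>" "x [^] (n::nat) = \<one>" "coprime m n"
  shows "x = \<one>"
  using assms by (metis coprime_common_divisor_nat nat_dvd_1_iff_1 ord_eq_1 pow_eq_id)

lemma pow_mod:
  assumes "x \<in> carrier G" "x [^] (p::nat) = \<one>" shows "x [^] (n::nat) = x [^] (n mod p)"
proof -
  have "x [^] n = x [^] (p * (n div p)) \<otimes> x [^] (n mod p)"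
    using assms by (simp add: nat_pow_mult)
  then show ?thesis using assms by (simp flip: nat_pow_pow)
qed

lemma pow_cong:
  assumes "x \<in> carrier G" "x [^] (p::nat) = \<one>" "[m = n] (mod p)" shows "x [^] m = x [^] n"
  using assms pow_mod cong_def by metis

lemma pow_root:
  assumes "x \<in> carrier G" "x [^] (p::nat) = \<one>" "coprime j p" shows "\<exists>k::nat. (x [^] j) [^] k = x"
proof -
  obtain k where "[j * k = 1] (mod p)" using cong_solve_coprime_nat[OF assms(3)] by auto
  then have "x [^] (j * k) = x [^] (1::nat)" using assms pow_cong by blast
  then show ?thesis using assms by (auto simp: nat_pow_pow)
qed

lemma prime_pow_exists:
  assumes "x \<in> carrier G" "x \<noteq> \<one>"
  shows "\<exists>(k::nat) p. Factorial_Ring.prime (p::nat) \<and> x [^] k \<noteq> \<one> \<and> (x [^] k) [^] p = \<one>"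
proof -
  have o: "ord x \<noteq> 1" "ord x \<noteq> 0" using assms ord_eq_1 ord_ge_1[OF fin] by fastforce+
  then obtain p where p: "Factorial_Ring.prime p" "p dvd ord x" using prime_factor_nat by blast
  then obtain k where k: "ord x = p * k" by auto
  have "x [^] k \<noteq> \<one>"
  proof
    assume "x [^] k = \<one>"
    then have "p * k dvd k" using assms pow_eq_id k by simp
    then show False using o k prime_gt_1_nat[OF p(1)] by (simp add: dvd_imp_le nat_dvd_not_less)
  qed
  moreover have "(x [^] k) [^] p = \<one>" 
    using pow_eq_id[OF assms(1), of "k * p"] k assms(1) by (simp add: nat_pow_pow mult.commute)
  ultimately show ?thesis using p by blast
qed

lemma subgroup_pow_closed: "subgroup H G \<Longrightarrow> x \<in> H \<Longrightarrow> x [^] (n::nat) \<in> H"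
  by (induction n) (auto simp: subgroup.one_closed subgroup.m_closed)

lemma finite_subgroup: "subgroup H G \<Longrightarrow> finite H"
  using fin finite_subset subgroup.subset by blast

lemma subgroup_pow_card:
  assumes "subgroup H G" "x \<in> H" shows "x [^] card H = \<one>"
proof -
  interpret H: group "G\<lparr>carrier := H\<rparr>" using assms subgroup_imp_group by blast
  show ?thesis using H.pow_order_eq_1[of x] assms by (simp add: order_def nat_pow_consistent[symmetric])
qed

section \<open>Sylow subgroups\<close>

lemma prime_power_subgroup:
  assumes "subgroup H G" "Factorial_Ring.prime (p::nat)" "p ^ a dvd card H"
  shows "\<exists>S. subgroup S G \<and> S \<subseteq> H \<and> card S = p ^ a"
proof -
  obtain m where "card H = p ^ a * m" using assms(3) by auto
  then have "\<exists>S. subgroup S (G\<lparr>carrier := H\<rparr>) \<and> card S = p ^ a"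
    using assms finite_subgroup by (intro sylow_thm[of p _ a m]) (auto simp: order_def subgroup_imp_group)
  then show ?thesis using assms(1) incl_subgroup subgroup.subset by fastforce
qed

lemma cauchy:
  assumes "subgroup H G" "Factorial_Ring.prime (p::nat)" "p dvd card H"
  shows "\<exists>x\<in>H. x \<noteq> \<one> \<and> x [^] p = \<one>"
proof -
  obtain S where S: "subgroup S G" "S \<subseteq> H" "card S = p ^ 1"
    using prime_power_subgroup[OF assms(1,2), of 1] assms(3) by auto
  have "S \<noteq> {\<one>}" using S(3) prime_gt_1_nat[OF assms(2)] by auto
  then obtain x where "x \<in> S" "x \<noteq> \<one>" using S(1) subgroup.one_closed by blast
  then show ?thesis using S subgroup_pow_card by auto
qed

lemma subgroup_conj_image:
  assumes "subgroup H G" "g \<in> carrier G" shows "subgroup (conj g ` H) G"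
proof (rule subgroupI)
  show "conj g ` H \<subseteq> carrier G" using assms subgroup.subset by (fastforce intro: conj_closed)
  show "conj g ` H \<noteq> {}" using assms subgroup.one_closed by blast
  fix a assume "a \<in> conj g ` H"
  then obtain h where h: "h \<in> H" "a = conj g h" by auto
  then show "inv a \<in> conj g ` H"
    using assms conj_inv[of g h] subgroup.mem_carrier subgroup.m_inv_closed by (metis image_eqI)
next
  fix a b assume "a \<in> conj g ` H" "b \<in> conj g ` H"
  then obtain h k where h: "h \<in> H" "a = conj g h" "k \<in> H" "b = conj g k" by auto
  then show "a \<otimes> b \<in> conj g ` H"
    using assms conj_mult[of g h k] subgroup.mem_carrier subgroup.m_closed by (metis image_eqI)
qed

lemma card_conj_image:
  assumes "H \<subseteq> carrier G" "g \<in> carrier G" shows "card (conj g ` H) = card H"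
  using assms by (intro card_image inj_onI) (metis conj_inj subsetD)

text \<open>An orbit has size dividing \<open>s ^ b\<close>: it is a fixed point, or its size is
  divisible by \<open>s\<close> and it can be removed. The action is axiomatised on \<open>S\<close>
  only, so that it restricts to what remains.\<close>

lemma p_group_fixed_point:
  assumes A: "subgroup A G" "card A = s ^ b" and s: "Factorial_Ring.prime (s::nat)"
    and "finite S" "\<not> s dvd card S"
    and cl: "\<And>a x. a \<in> A \<Longrightarrow> x \<in> S \<Longrightarrow> \<alpha> a x \<in> S"
    and one: "\<And>x. x \<in> S \<Longrightarrow> \<alpha> \<one> x = x"
    and mult: "\<And>a c x. a \<in> A \<Longrightarrow> c \<in> A \<Longrightarrow> x \<in> S \<Longrightarrow> \<alpha> (a \<otimes> c) x = \<alpha> a (\<alpha> c x)"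
  shows "\<exists>x\<in>S. \<forall>a\<in>A. \<alpha> a x = x"
  using assms(4-)
proof (induction "card S" arbitrary: S rule: less_induct)
  case less
  note cl = less.prems(3) and one = less.prems(4) and mult = less.prems(5)
  have fA: "finite A" using A finite_subgroup by auto
  have "S \<noteq> {}" using less.prems by auto
  then obtain x where x: "x \<in> S" by auto
  define B where "B = (\<lambda>a. \<alpha> a x) ` A"
  define n where "n = card {a \<in> A. \<alpha> a x = x}"
  have inv: "inv a \<in> A" "a \<in> carrier G" if "a \<in> A" for a
    using that A subgroup.m_inv_closed subgroup.mem_carrier by metis+
  have eqx: "\<alpha> c x = \<alpha> a x \<longleftrightarrow> \<alpha> (inv a \<otimes> c) x = x" if "a \<in> A" "c \<in> A" for a c
  proof
    assume "\<alpha> c x = \<alpha> a x"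
    then have "\<alpha> (inv a \<otimes> c) x = \<alpha> (inv a \<otimes> a) x" using that mult inv x by metis
    then show "\<alpha> (inv a \<otimes> c) x = x" using that inv one x by simp
  next
    assume "\<alpha> (inv a \<otimes> c) x = x"
    then have "\<alpha> (a \<otimes> (inv a \<otimes> c)) x = \<alpha> a x" using that mult inv x A subgroup.m_closed by metis
    then show "\<alpha> c x = \<alpha> a x" using that inv by simp
  qed
  have "card A = card B * n"
    unfolding B_def
  proof (rule card_image_fibres[OF fA])
    fix a assume a: "a \<in> A"
    have "bij_betw (\<lambda>c. inv a \<otimes> c) {c \<in> A. \<alpha> c x = \<alpha> a x} {c \<in> A. \<alpha> c x = x}"
    proof (rule bij_betw_byWitness[of _ "\<lambda>c. a \<otimes> c"])
      have "a \<otimes> c \<in> A" "\<alpha> (a \<otimes> c) x = \<alpha> a x" if "c \<in> A" "\<alpha> c x = x" for c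
        using that a mult x A subgroup.m_closed by metis+
      then show "(\<lambda>c. a \<otimes> c) ` {c \<in> A. \<alpha> c x = x} \<subseteq> {c \<in> A. \<alpha> c x = \<alpha> a x}" by auto
    qed (use a inv eqx A in \<open>auto simp: subgroup.m_closed\<close>)
    then show "card {c \<in> A. \<alpha> c x = \<alpha> a x} = n"
      unfolding n_def by (rule bij_betw_same_card)
  qed
  then have dv: "card B dvd s ^ b" using A(2) by simp
  have BS: "B \<subseteq> S" unfolding B_def using cl x by auto
  have xB: "x \<in> B" unfolding B_def using one[OF x] A(1) subgroup.one_closed by (metis image_eqI)
  show ?case
  proof (cases "card B = 1")
    case True
    then have "B = {x}" using xB card_1_singletonE by blast
    then show ?thesis using x B_def by auto
  next
    case False
    then have sB: "s dvd card B" using dv s by (metis divides_primepow_nat dvd_power gr0I power_0)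
    have fB: "finite B" unfolding B_def using fA by simp
    have pos: "card B > 0" using fB xB card_gt_0_iff by blast
    have cS: "card S = card (S - B) + card B"
      using BS less.prems(1) fB card_Diff_subset card_mono by (metis le_add_diff_inverse2)
    have cl': "\<alpha> a y \<in> S - B" if "a \<in> A" "y \<in> S - B" for a y
    proof -
      have "\<alpha> a y \<notin> B"
      proof
        assume "\<alpha> a y \<in> B"
        then obtain c where c: "c \<in> A" "\<alpha> a y = \<alpha> c x" unfolding B_def by auto
        have "y = \<alpha> (inv a \<otimes> a) y" using that one inv by simp
        also have "\<dots> = \<alpha> (inv a) (\<alpha> a y)" using that inv by (intro mult) auto
        also have "\<dots> = \<alpha> (inv a \<otimes> c) x" unfolding c(2) using that c(1) inv x by (intro mult[symmetric]) auto
        also have "\<dots> \<in> B" unfolding B_def using that c inv A(1) subgroup.m_closed by (metis image_eqI)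
        finally show False using that by auto
      qed
      then show ?thesis using that cl by auto
    qed
    have "\<exists>x\<in>S - B. \<forall>a\<in>A. \<alpha> a x = x"
    proof (rule less.hyps)
      show "card (S - B) < card S" using cS pos by simp
      show "\<not> s dvd card (S - B)" using cS sB less.prems(2) by (metis dvd_add)
    qed (use less.prems cl' in auto)
    then show ?thesis by auto
  qed
qed

text \<open>\<open>A\<close> acts by left multiplication on the \<open>m\<close> cosets of
  \<open>S\<close> in \<open>D\<close>. As \<open>s\<close> does not divide \<open>m\<close>, some
  coset \<open>d S\<close> is fixed, which means that \<open>A\<close> lies in the conjugate of
  \<open>S\<close> by \<open>d\<close>.\<close>

lemma sylow_conjugate:
  assumes D: "subgroup D G" and S: "subgroup S G" "S \<subseteq> D" "card S = s ^ a" "card D = s ^ a * m"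
    and s: "Factorial_Ring.prime (s::nat)" "\<not> s dvd m" and A: "subgroup A G" "A \<subseteq> D" "card A = s ^ b"
  shows "\<exists>d\<in>D. A \<subseteq> conj d ` S"
proof -
  let ?c = "\<lambda>d. (\<lambda>x. d \<otimes> x) ` S"
  have fD: "finite D" using D finite_subgroup by auto
  have Dc: "x \<in> carrier G" if "x \<in> D" for x using D that subgroup.mem_carrier by metis
  have Sc: "x \<in> carrier G" if "x \<in> S" for x using S(2) that Dc by auto
  have Dcl: "x \<otimes> y \<in> D" "inv x \<in> D" if "x \<in> D" "y \<in> D" for x y
    using D that subgroup.m_closed subgroup.m_inv_closed by metis+
  have Scl: "x \<otimes> y \<in> S" "inv x \<in> S" if "x \<in> S" "y \<in> S" for x y
    using S(1) that subgroup.m_closed subgroup.m_inv_closed by metis+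
  have ceq: "?c b = ?c d \<longleftrightarrow> b \<in> ?c d" if "b \<in> D" "d \<in> D" for b d
  proof
    assume "?c b = ?c d"
    moreover have "b \<in> ?c b" using S(1) that Dc subgroup.one_closed by (intro image_eqI[of _ _ \<one>]) auto
    ultimately show "b \<in> ?c d" by simp
  next
    assume "b \<in> ?c d"
    then obtain y where y: "y \<in> S" "b = d \<otimes> y" by auto
    show "?c b = ?c d"
    proof (intro equalityI subsetI)
      fix z assume "z \<in> ?c b"
      then obtain u where u: "u \<in> S" "z = b \<otimes> u" by auto
      then have "z = d \<otimes> (y \<otimes> u)" using y that Dc Sc by (simp add: m_assoc)
      then show "z \<in> ?c d" using y u Scl by blast
    next
      fix z assume "z \<in> ?c d"
      then obtain u where u: "u \<in> S" "z = d \<otimes> u" by auto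
      then have "z = b \<otimes> (inv y \<otimes> u)" using y that Dc Sc by (simp add: word)
      then show "z \<in> ?c b" using y u Scl by blast
    qed
  qed
  have "card D = card (?c ` D) * s ^ a"
  proof (rule card_image_fibres[OF fD])
    fix d assume d: "d \<in> D"
    have "?c d \<subseteq> D" using d S(2) Dcl by auto
    then have "{b \<in> D. ?c b = ?c d} = ?c d" using ceq[OF _ d] by blast
    moreover have "card (?c d) = card S"
      by (rule card_image) (use d Dc Sc in \<open>auto simp: inj_on_def\<close>)
    ultimately show "card {b \<in> D. ?c b = ?c d} = s ^ a" using S(3) by simp
  qed
  then have cm: "card (?c ` D) = m" using S(4) s(1) by (simp add: mult.commute prime_gt_0_nat)
  have act: "(\<lambda>x. g \<otimes> x) ` (?c d) = ?c (g \<otimes> d)" if "g \<in> D" "d \<in> D" for g d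
    using that Dc Sc by (auto simp: image_image m_assoc)
  have "\<exists>C\<in>?c ` D. \<forall>a\<in>A. (\<lambda>x. a \<otimes> x) ` C = C"
  proof (rule p_group_fixed_point[OF A(1,3) s(1)])
    show "\<not> s dvd card (?c ` D)" using cm s(2) by simp
    fix C assume "C \<in> ?c ` D"
    then obtain d where d: "d \<in> D" "C = ?c d" by auto
    show "(\<lambda>x. \<one> \<otimes> x) ` C = C" using act[of \<one> d] d D Dc by (simp add: subgroup.one_closed)
    fix g assume g: "g \<in> A"
    show "(\<lambda>x. g \<otimes> x) ` C \<in> ?c ` D" using act[of g d] d g A(2) Dcl by auto
    fix h assume h: "h \<in> A"
    show "(\<lambda>x. g \<otimes> h \<otimes> x) ` C = (\<lambda>x. g \<otimes> x) ` ((\<lambda>x. h \<otimes> x) ` C)"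
      using act[of "g \<otimes> h" d] act[of h d] act[of g "h \<otimes> d"] d g h A(2) Dcl Dc
      by (simp add: m_assoc subsetD)
  qed (use fD in simp)
  then obtain d where d: "d \<in> D" "\<And>a. a \<in> A \<Longrightarrow> (\<lambda>x. a \<otimes> x) ` (?c d) = ?c d" by auto
  have "A \<subseteq> conj d ` S"
  proof
    fix a assume a: "a \<in> A"
    then have aD: "a \<in> D" using A(2) by auto
    have "?c (a \<otimes> d) = ?c d" using act[OF aD d(1)] d(2)[OF a] by simp
    then have "a \<otimes> d \<in> ?c d" using ceq aD d(1) Dcl by blast
    then obtain y where y: "y \<in> S" "a \<otimes> d = d \<otimes> y" by auto
    then have "a = conj d y" unfolding conj_def using aD d(1) Dc Sc by (metis inv_solve_right m_closed)
    then show "a \<in> conj d ` S" using y by auto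
  qed
  then show ?thesis using d(1) by auto
qed

text \<open>Conjugation by \<open>x\<close> permutes the conjugates of a Sylow subgroup
  \<open>S\<close> of \<open>D\<close>. Their number divides \<open>card D\<close>, hence is prime
  to \<open>p\<close>, and a permutation of period \<open>p\<close> fixes one of them.\<close>

lemma invariant_sylow:
  assumes D: "subgroup D G" and x: "x \<in> carrier G" "x [^] p = \<one>" "Factorial_Ring.prime (p::nat)"
    "conj x ` D \<subseteq> D" "\<not> p dvd card D" and s: "Factorial_Ring.prime (s::nat)"
  shows "\<exists>S a m. subgroup S G \<and> S \<subseteq> D \<and> card S = s ^ a \<and> card D = s ^ a * m \<and> \<not> s dvd m \<and> conj x ` S \<subseteq> S"
proof -
  have fD: "finite D" using D finite_subgroup by auto
  have Dc: "x \<in> carrier G" if "x \<in> D" for x using D that subgroup.mem_carrier by metis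
  have Dcl: "x \<otimes> y \<in> D" "inv x \<in> D" if "x \<in> D" "y \<in> D" for x y
    using D that subgroup.m_closed subgroup.m_inv_closed by metis+
  have cD: "card D \<noteq> 0" using fD subgroup.one_closed[OF D] by auto
  obtain a m where am: "card D = s ^ a * m" "\<not> s dvd m"
    using multiplicity_decompose'[of "card D" s] s cD by (metis not_prime_unit)
  obtain S where S: "subgroup S G" "S \<subseteq> D" "card S = s ^ a"
    using prime_power_subgroup[OF D s, of a] am by auto
  have Sc: "S \<subseteq> carrier G" using S(1) subgroup.subset by auto
  let ?c = "\<lambda>d. conj d ` S"
  have cc: "conj g ` (?c d) = ?c (g \<otimes> d)" if "g \<in> carrier G" "d \<in> carrier G" for g d
    using that Sc by (auto simp: image_image conj_conj subset_iff)
  define n where "n = card {b \<in> D. ?c b = S}"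
  have "card D = card (?c ` D) * n"
  proof (rule card_image_fibres[OF fD])
    fix d assume d: "d \<in> D"
    have "bij_betw (\<lambda>c. inv d \<otimes> c) {c \<in> D. ?c c = ?c d} {c \<in> D. ?c c = S}"
    proof (rule bij_betw_byWitness[of _ "\<lambda>c. d \<otimes> c"])
      show "(\<lambda>c. d \<otimes> c) ` {c \<in> D. ?c c = S} \<subseteq> {c \<in> D. ?c c = ?c d}"
        using d Dc Dcl cc[of d] by (auto simp del: image_eqI) (metis image_eqI)+
      have "?c (inv d \<otimes> c) = S" if "c \<in> D" "?c c = ?c d" for c
      proof -
        have "?c (inv d \<otimes> c) = conj (inv d) ` (?c d)" using that d Dc Dcl cc[of "inv d" c] by simp
        also have "\<dots> = ?c (inv d \<otimes> d)" using d Dc Dcl cc[of "inv d" d] by simp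
        also have "\<dots> = S" using d Dc Sc by (simp add: subset_iff)
        finally show ?thesis .
      qed
      then show "(\<lambda>c. inv d \<otimes> c) ` {c \<in> D. ?c c = ?c d} \<subseteq> {c \<in> D. ?c c = S}"
        using d Dcl by auto
    qed (use d Dc in auto)
    then show "card {c \<in> D. ?c c = ?c d} = n" unfolding n_def by (rule bij_betw_same_card)
  qed
  then have np: "\<not> p dvd card (?c ` D)" using x(5) by auto
  let ?f = "\<lambda>C. conj x ` C"
  \<comment> \<open>The image of a conjugate of \<open>S\<close> has the same order and lies in
    \<open>D\<close>, so by \<open>sylow_conjugate\<close> it is again a conjugate of
    \<open>S\<close>.\<close>
  have fcl: "?f C \<in> ?c ` D" if C: "C \<in> ?c ` D" for C
  proof -
    obtain d where d: "d \<in> D" "C = ?c d" using C by auto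
    have eq: "?f C = ?c (x \<otimes> d)" using cc d x Dc by simp
    have sub: "subgroup (?c (x \<otimes> d)) G" using subgroup_conj_image S(1) x d Dc by simp
    have "?c d \<subseteq> D" using d S(2) Dcl by (auto simp: conj_def subset_iff)
    then have "?f C \<subseteq> D" using x(4) d by auto
    then obtain e where e: "e \<in> D" "?c (x \<otimes> d) \<subseteq> ?c e"
      using sylow_conjugate[OF D S am(1) s am(2) sub, of a] eq card_conj_image[OF Sc] S(3) x d Dc by auto
    moreover have "card (?c (x \<otimes> d)) = card (?c e)" using card_conj_image[OF Sc] x d e Dc by simp
    ultimately have "?c (x \<otimes> d) = ?c e" using finite_subgroup S(1) by (intro card_subset_eq) auto
    then show ?thesis using eq e by auto
  qed
  have fp: "(?f ^^ p) C = C" if "C \<in> ?c ` D" for C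
  proof -
    have CG: "C \<subseteq> carrier G" using that Sc Dc by auto
    have "(?f ^^ k) C = conj (x [^] k) ` C" for k
    proof (induction k)
      case 0 then show ?case using CG by (auto simp: subset_iff)
    next
      case (Suc k)
      have "(?f ^^ Suc k) C = (\<lambda>y. conj x (conj (x [^] k) y)) ` C" using Suc by (simp add: image_image)
      also have "\<dots> = (\<lambda>y. conj (x [^] Suc k) y) ` C"
        using CG x by (intro image_cong) (auto simp: conj_conj subset_iff nat_pow_comm[of x k 1, simplified])
      finally show ?case .
    qed
    then show ?thesis using x CG by (auto simp: subset_iff)
  qed
  have "\<not> p dvd card {C \<in> ?c ` D. ?f C = C}"
    using prime_period_card[of "?c ` D" p ?f] fD x(3) fcl fp np by blast
  then have "{C \<in> ?c ` D. ?f C = C} \<noteq> {}" by (metis card.empty dvd_0_right)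
  then obtain d where d: "d \<in> D" "?f (?c d) = ?c d" by auto
  show ?thesis
  proof (intro exI conjI)
    show "subgroup (?c d) G" using subgroup_conj_image S(1) d Dc by auto
    show "?c d \<subseteq> D" using d S(2) Dcl by (auto simp: conj_def subset_iff)
    show "card (?c d) = s ^ a" using card_conj_image[OF Sc] d Dc S(3) by auto
  qed (use am d in auto)
qed

text \<open>The period is imposed on \<open>conj (x [^] p)\<close> and not on
  \<open>x [^] p\<close>, so that \<open>x\<close> may have a \<open>p\<close>-th power that merely
  centralises \<open>S\<close>, as elements of \<open>M\<close> do on \<open>N\<close>.\<close>

lemma fixed_point_dvd:
  assumes "finite S" "S \<subseteq> carrier G" "x \<in> carrier G" "\<And>y. y \<in> S \<Longrightarrow> conj (x [^] p) y = y"
    "Factorial_Ring.prime (p::nat)" "conj x ` S \<subseteq> S"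
  shows "p dvd card S \<longleftrightarrow> p dvd card {y \<in> S. conj x y = y}"
proof (rule prime_period_card)
  fix y assume "y \<in> S"
  then show "(conj x ^^ p) y = y" using assms by (simp add: conj_funpow subset_iff)
qed (use assms in auto)

text \<open>The trivial element is a fixed point, so a second one appears when \<open>p\<close> divides the order.\<close>

lemma exists_fixed_point:
  assumes "subgroup H G" "x \<in> carrier G" "\<And>y. y \<in> H \<Longrightarrow> conj (x [^] p) y = y"
    "Factorial_Ring.prime (p::nat)" "conj x ` H \<subseteq> H" "p dvd card H"
  shows "\<exists>y\<in>H. y \<noteq> \<one> \<and> conj x y = y"
proof (rule ccontr)
  assume no: "\<not> ?thesis"
  have "\<one> \<in> H" "conj x \<one> = \<one>" using assms subgroup.one_closed by auto
  then have "{y \<in> H. conj x y = y} = {\<one>}" using no by blast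
  moreover have "p dvd card {y \<in> H. conj x y = y}"
    using fixed_point_dvd[of H x p] assms finite_subgroup subgroup.subset by blast
  ultimately show False using assms(4) by (simp add: prime_nat_iff)
qed

section \<open>Actions on abelian subgroups\<close>

lemma comm_group_subgroup:
  assumes "subgroup V G" "\<And>u v. u \<in> V \<Longrightarrow> v \<in> V \<Longrightarrow> conj u v = v"
  shows "comm_group (G\<lparr>carrier := V\<rparr>)"
proof (rule group.group_comm_groupI)
  show "group (G\<lparr>carrier := V\<rparr>)" using assms subgroup_imp_group by blast
  fix x y assume "x \<in> carrier (G\<lparr>carrier := V\<rparr>)" "y \<in> carrier (G\<lparr>carrier := V\<rparr>)"
  then show "x \<otimes>\<^bsub>G\<lparr>carrier := V\<rparr>\<^esub> y = y \<otimes>\<^bsub>G\<lparr>carrier := V\<rparr>\<^esub> x"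
    using assms(2)[of x y] conj_fix[of x y] subgroup.mem_carrier[OF assms(1)] by simp
qed

lemma conj_hom:
  assumes "subgroup V G" "conj g ` V \<subseteq> V" "g \<in> carrier G"
  shows "conj g \<in> hom (G\<lparr>carrier := V\<rparr>) (G\<lparr>carrier := V\<rparr>)"
  using assms by (auto simp: hom_def conj_mult subgroup.mem_carrier)

text \<open>If \<open>a\<close> and \<open>b\<close> generate a group of rank two, the elements
  \<open>a\<close> and \<open>b \<otimes> a [^] i\<close> generate all its subgroups of order
  \<open>q\<close>. If none of the latter kind had a fixed point,
  \<open>commuting_periodic_homs\<close> would make \<open>v [^] q\<close> fixed by
  \<open>a\<close>, and \<open>v [^] q\<close> is nontrivial as \<open>r\<close> and
  \<open>q\<close> are coprime.\<close>

lemma rank_two_fixed_point: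
  assumes V: "subgroup V G" "\<And>u v. u \<in> V \<Longrightarrow> v \<in> V \<Longrightarrow> conj u v = v" "V \<noteq> {\<one>}"
    "\<And>v. v \<in> V \<Longrightarrow> v [^] r = \<one>" "coprime r q" and q: "Factorial_Ring.prime (q::nat)"
    and a: "a \<in> carrier G" "a [^] q = \<one>" "conj a ` V \<subseteq> V"
    and b: "b \<in> carrier G" "b [^] q = \<one>" "conj b ` V \<subseteq> V" and ab: "conj a b = b"
  shows "\<exists>w \<in> insert a {b \<otimes> a [^] i | i::nat. True}. \<exists>v\<in>V. v \<noteq> \<one> \<and> conj w v = v"
proof (rule ccontr)
  assume no: "\<not> ?thesis"
  let ?V = "G\<lparr>carrier := V\<rparr>"
  interpret V: comm_group ?V using comm_group_subgroup V by blast
  have Vc: "v \<in> carrier G" if "v \<in> V" for v using V(1) that subgroup.mem_carrier by metis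
  have a_pow: "conj (a [^] (i::nat)) v \<in> V" if "v \<in> V" for i v
  proof -
    have "(conj a ^^ i) v \<in> V" by (induction i) (use a(3) that in auto)
    then show ?thesis using conj_funpow a Vc that by simp
  qed
  have abc: "a \<otimes> b = b \<otimes> a" using ab a b conj_fix by auto
  obtain v where v: "v \<in> V" "v \<noteq> \<one>" using V(1,3) subgroup.one_closed by blast
  have "conj a (v [^]\<^bsub>?V\<^esub> q) = v [^]\<^bsub>?V\<^esub> q"
  proof (rule V.commuting_periodic_homs[where U = "conj b"])
    show "conj a \<in> hom ?V ?V" "conj b \<in> hom ?V ?V" using conj_hom V(1) a b by auto
    fix u assume "u \<in> carrier ?V"
    then have u: "u \<in> V" by simp
    show "conj b (conj a u) = conj a (conj b u)" using u a b abc Vc by (simp add: conj_conj)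
    show "(conj a ^^ q) u = u" "(conj b ^^ q) u = u" using u a b Vc by (auto simp: conj_funpow)
    fix i assume "conj b ((conj a ^^ i) u) = u"
    then have "conj (b \<otimes> a [^] i) u = u" using u a b Vc by (simp add: conj_conj conj_funpow)
    then show "u = \<one>\<^bsub>?V\<^esub>" using no u by auto
  qed (use q v in auto)
  then have "conj a (v [^] q) = v [^] q" by (simp add: nat_pow_consistent[symmetric])
  moreover have "v [^] q \<in> V" using v V(1) subgroup_pow_closed by auto
  ultimately have "v [^] q = \<one>" using no by blast
  then show False using coprime_pow_one[of v r q] v V(4,5) Vc by auto
qed

text \<open>Apply the lemma on commuting operators to conjugation by \<open>x\<close> and a power map of order \<open>p\<close>.\<close>

lemma exists_eigenvector:
  assumes V: "subgroup V G" "\<And>u v. u \<in> V \<Longrightarrow> v \<in> V \<Longrightarrow> conj u v = v" "V \<noteq> {\<one>}"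
    "\<And>v. v \<in> V \<Longrightarrow> v [^] r = \<one>" and pr: "Factorial_Ring.prime (r::nat)" "Factorial_Ring.prime (p::nat)" "p dvd r - 1"
    and x: "x \<in> carrier G" "x [^] p = \<one>" "conj x ` V \<subseteq> V"
  shows "\<exists>v\<in>V. v \<noteq> \<one> \<and> normalises x v"
proof (rule ccontr)
  assume no: "\<not> ?thesis"
  let ?V = "G\<lparr>carrier := V\<rparr>"
  interpret V: comm_group ?V using comm_group_subgroup V by blast
  have Vc: "v \<in> carrier G" if "v \<in> V" for v using V(1) that subgroup.mem_carrier by metis
  have Vp: "v [^] (k::nat) \<in> V" if "v \<in> V" for v k using subgroup_pow_closed V(1) that by auto
  obtain l where l: "[l ^ p = 1] (mod r)" "\<not> [l = 1] (mod r)"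
    using exists_root_of_unity_mod_prime pr by blast
  obtain v where v: "v \<in> V" "v \<noteq> \<one>" using V(1,3) subgroup.one_closed by blast
  let ?T = "\<lambda>v. v [^] l"
  have Tpow: "(?T ^^ k) u = u [^] (l ^ k)" if "u \<in> V" for u k
    by (induction k) (use that Vc in \<open>auto simp: nat_pow_pow mult.commute\<close>)
  have Vcomm: "u \<otimes> w = w \<otimes> u" if "u \<in> V" "w \<in> V" for u w using that V(2) Vc conj_fix by metis
  have "?T (v [^]\<^bsub>?V\<^esub> p) = v [^]\<^bsub>?V\<^esub> p"
  proof (rule V.commuting_periodic_homs[where U = "conj x"])
    show "?T \<in> hom ?V ?V" using Vp Vc Vcomm by (auto simp: hom_def pow_mult_distrib)
    show "conj x \<in> hom ?V ?V" using conj_hom V(1) x by auto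
    fix u assume "u \<in> carrier ?V"
    then have u: "u \<in> V" by simp
    show "conj x (?T u) = ?T (conj x u)" using u x Vc by (simp add: conj_pow)
    show "(?T ^^ p) u = u" using Tpow[OF u] pow_cong[of u r "l ^ p" 1] l u Vc V(4) by simp
    show "(conj x ^^ p) u = u" using u x Vc by (auto simp: conj_funpow)
    fix i assume eq: "conj x ((?T ^^ i) u) = u"
    \<comment> \<open>\<open>l ^ i\<close> is invertible modulo \<open>r\<close>, with inverse
      \<open>l ^ (i * (p - 1))\<close>; hence \<open>u\<close> is a power of \<open>?w\<close>, and
      the fixed point equation says that \<open>x\<close> sends \<open>?w\<close> to that
      power.\<close>
    let ?w = "u [^] (l ^ i)"
    have w: "?w \<in> V" using u Vp by auto
    have "[l ^ i * l ^ (i * (p - 1)) = 1] (mod r)"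
    proof -
      have "i + i * (p - 1) = p * i" using prime_gt_0_nat[OF pr(2)] by (cases p) auto
      then have "l ^ i * l ^ (i * (p - 1)) = (l ^ p) ^ i" by (metis power_add power_mult)
      then show ?thesis using cong_pow[OF l(1), of i] by simp
    qed
    then have "u = ?w [^] (l ^ (i * (p - 1)))"
      using pow_cong[of u r "l ^ i * l ^ (i * (p - 1))" 1] u Vc V(4) by (simp add: nat_pow_pow)
    then have "normalises x ?w" using eq Tpow[OF u] unfolding normalises_def by metis
    then have "?w = \<one>" using no w by blast
    then show "u = \<one>\<^bsub>?V\<^esub>" using eq Tpow[OF u] x by simp
  qed (use pr v in auto)
  then have ul: "(v [^] p) [^] l = v [^] p" by (simp add: nat_pow_consistent[symmetric])
  have ne: "v [^] p \<noteq> \<one>"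
  proof
    assume "v [^] p = \<one>"
    have "p \<le> r - 1" using pr(3) prime_gt_1_nat[OF pr(1)] by (intro dvd_imp_le) auto
    then have "p \<noteq> r" using prime_gt_1_nat[OF pr(1)] by auto
    then have "coprime p r" using primes_coprime pr by blast
    with \<open>v [^] p = \<one>\<close> show False using coprime_pow_one[of v p r] v V(4) Vc by auto
  qed
  have vp: "v [^] p \<in> carrier G" "(v [^] p) [^] r = \<one>" using v Vc V(4) Vp by auto
  \<comment> \<open>The power map with exponent \<open>l\<close> fixes the element
    \<open>v [^] p\<close> of order \<open>r\<close>, which contradicts the choice of
    \<open>l\<close>.\<close>
  have "[l = 1] (mod r)"
  proof -
    let ?u = "v [^] p"
    show ?thesis
    proof (cases l)
      case 0
      then show ?thesis using ul ne by simp
    next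
      case (Suc m)
      then have "?u [^] m = \<one>" using ul vp by (simp add: r_cancel_one)
      then have "r dvd m" using pow_eq_one_iff[OF vp(1) ne pr(1) vp(2)] by simp
      then obtain c where "l = 1 + r * c" using Suc by (auto elim: dvdE)
      then show ?thesis unfolding cong_def by (simp only: mod_mult_self2)
    qed
  qed
  then show False using l by simp
qed

text \<open>
  For \<open>v \<in> V\<close> compare the orbit products of \<open>v\<close> under the conjugates \<open>a x a\<inverse>\<close>, \<open>a \<in> Q\<close>, with the product
  over \<open>Q \<langle>x\<rangle>\<close>: for \<open>0 < j < p\<close> the elements \<open>a x\<^sup>j a\<inverse>\<close> exhaust the coset \<open>Q x\<^sup>j\<close>, which leaves
  \<open>v ^ card Q\<close> equal to the \<open>Q\<close>-invariant product of all \<open>a v a\<inverse>\<close>.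
\<close>

lemma frobenius_action_trivial:
  assumes V: "subgroup V G" "\<And>u v. u \<in> V \<Longrightarrow> v \<in> V \<Longrightarrow> conj u v = v"
    "\<And>v. v \<in> V \<Longrightarrow> v [^] r = \<one>" "coprime r (card Q)"
    and Q: "subgroup Q G" "\<And>a. a \<in> Q \<Longrightarrow> conj a ` V \<subseteq> V"
    and x: "x \<in> carrier G" "x [^] p = \<one>" "Factorial_Ring.prime (p::nat)" "conj x ` V \<subseteq> V" "conj x ` Q \<subseteq> Q"
    and fpf: "\<And>v. v \<in> V \<Longrightarrow> conj x v = v \<Longrightarrow> v = \<one>" "\<And>a. a \<in> Q \<Longrightarrow> conj x a = a \<Longrightarrow> a = \<one>"
    and v: "v \<in> V" and b: "b \<in> Q"
  shows "conj b v = v"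
proof -
  let ?V = "G\<lparr>carrier := V\<rparr>"
  interpret V: comm_group ?V using comm_group_subgroup V by blast
  have p0: "p > 0" using x prime_gt_0_nat by auto
  have Vc: "v \<in> carrier G" if "v \<in> V" for v using V(1) that subgroup.mem_carrier by metis
  have Qc: "v \<in> carrier G" if "v \<in> Q" for v using Q(1) that subgroup.mem_carrier by metis
  have Qcl: "x \<otimes> y \<in> Q" "inv x \<in> Q" if "x \<in> Q" "y \<in> Q" for x y
    using Q(1) that subgroup.m_closed subgroup.m_inv_closed by metis+
  have QV: "conj a u \<in> V" if "a \<in> Q" "u \<in> V" for a u using Q(2) that by auto
  have xV: "conj (x [^] (j::nat)) u \<in> V" if "u \<in> V" for j u
  proof -
    have "(conj x ^^ j) u \<in> V" by (induction j) (use x(4) that in auto)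
    then show ?thesis using conj_funpow x Vc that by simp
  qed
  have xQ: "conj (x [^] (j::nat)) u \<in> Q" if "u \<in> Q" for j u
  proof -
    have "(conj x ^^ j) u \<in> Q" by (induction j) (use x(5) that in auto)
    then show ?thesis using conj_funpow x Qc that by simp
  qed
  have fQ: "finite Q" using finite_subgroup Q(1) by auto
  have cx: "conj (conj a x) u = conj a (conj x (conj (inv a) u))" if "a \<in> Q" "u \<in> V" for a u
    using that x Qc Vc by (simp add: conj_def word)
  let ?F = "\<lambda>a j. (conj (conj a x) ^^ j) v" and ?F' = "\<lambda>a (j::nat). conj (a \<otimes> x [^] j) v"
  have Feq: "?F a j = conj (conj a (x [^] j)) v" if "a \<in> Q" for a j
    using that x v Qc Vc by (simp add: conj_funpow conj_pow)
  have Fx: "conj (conj a (x [^] (j::nat))) v = conj a (conj (x [^] j) (conj (inv a) v))" if "a \<in> Q" for a j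
    using that x Qc Vc v by (simp add: conj_def word)
  have FV: "?F a j \<in> V" if "a \<in> Q" for a j
    using Feq Fx that QV xV Qcl v by auto
  have F'eq: "conj (a \<otimes> x [^] j) v = conj a (conj (x [^] j) v)" if "a \<in> Q" for a and j :: nat
    by (rule conj_conj[symmetric]) (use that x v Qc Vc in auto)
  have F'V: "?F' a j \<in> V" if "a \<in> Q" for a j using F'eq that QV xV v by auto
  have ah: "conj a \<in> hom ?V ?V" if "a \<in> Q" for a using conj_hom[OF V(1)] Q(2) Qc that by auto
  have "finprod ?V (\<lambda>a. ?F a 0) Q = finprod ?V (\<lambda>a. ?F' a 0) Q"
  proof (rule V.double_product[OF fQ p0])
    fix a assume a: "a \<in> Q"
    have "conj (conj a x) ` V \<subseteq> V" using cx a QV x(4) Qcl by (auto simp: image_subset_iff)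
    then have "conj (conj a x) \<in> hom ?V ?V" using conj_hom[OF V(1)] a Qc x by auto
    moreover have "u = \<one>" if "u \<in> V" "conj (conj a x) u = u" for u
    proof -
      have "conj x (conj (inv a) u) = conj (inv a) u"
        using that cx[OF a] a x Qc Vc by (metis conj_closed conj_inv_conj(1) inv_closed)
      then have "conj (inv a) u = \<one>" using fpf(1) QV Qcl a that by blast
      then show ?thesis using conj_eq_one that Vc Qc a by simp
    qed
    moreover have "?F a p = v" using Feq a x v Qc Vc by simp
    ultimately show "finprod ?V (\<lambda>j. ?F a j) {..<p} = \<one>\<^bsub>?V\<^esub>"
      using v p0 by (intro V.norm_eq_one) auto
    have "finprod ?V (\<lambda>j. (conj x ^^ j) v) {..<p} = \<one>\<^bsub>?V\<^esub>"
    proof (rule V.norm_eq_one)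
      show "conj x \<in> hom ?V ?V" using conj_hom[OF V(1)] x by auto
      show "(conj x ^^ p) v = v" using conj_funpow x v Vc by simp
    qed (use fpf v p0 in auto)
    then have "finprod ?V (\<lambda>j. conj a ((conj x ^^ j) v)) {..<p} = conj a \<one>"
      using V.hom_finprod[OF ah[OF a], of "{..<p}" "\<lambda>j. (conj x ^^ j) v"] xV x v Vc
      by (simp add: conj_funpow)
    then show "finprod ?V (\<lambda>j. ?F' a j) {..<p} = \<one>\<^bsub>?V\<^esub>"
      using F'eq[OF a] conj_funpow x v Vc Qc a by simp
  next
    fix j assume j: "0 < j" "j < p"
    have cop: "coprime j p" using j x(3) by (meson coprime_commute nat_dvd_not_less prime_imp_coprime)
    \<comment> \<open>\<open>conj a (x [^] j)\<close> equals \<open>?h a \<otimes> x [^] j\<close>,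
      and \<open>?h\<close> permutes \<open>Q\<close> because \<open>x [^] j\<close> has no
      nontrivial fixed point there.\<close>
    let ?h = "\<lambda>a. a \<otimes> inv (conj (x [^] j) a)"
    have inj: "inj_on ?h Q"
    proof (rule inj_onI)
      fix a c assume ac: "a \<in> Q" "c \<in> Q" "?h a = ?h c"
      let ?d = "inv c \<otimes> a"
      have d: "?d \<in> Q" using Qcl ac by auto
      have "inv c \<otimes> (?h a) \<otimes> conj (x [^] j) a = inv c \<otimes> (?h c) \<otimes> conj (x [^] j) a" using ac by simp
      then have "?d = inv (conj (x [^] j) c) \<otimes> conj (x [^] j) a"
        using ac(1,2) Qc x by (simp add: m_assoc)
      also have "\<dots> = conj (x [^] j) ?d" using ac Qc x by (simp add: conj_mult conj_inv)
      finally have "(conj x ^^ j) ?d = ?d" using conj_funpow x d Qc by simp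
      moreover have "(conj x ^^ p) ?d = ?d" using conj_funpow x d Qc by simp
      ultimately have "conj x ?d = ?d" using funpow_coprime_fix cop j by (metis less_irrefl)
      then have "?d = \<one>" using fpf(2) d by blast
      then show "a = c" using ac Qc by (metis inv_equality inv_inv inv_closed inv_unique' l_inv r_inv inv_comm)
    qed
    have im: "?h ` Q = Q" by (rule endo_inj_surj[OF fQ _ inj]) (use Qcl xQ in auto)
    have "finprod ?V (\<lambda>a. ?F a j) Q = finprod ?V (\<lambda>a. ?F' (?h a) j) Q"
    proof (rule V.finprod_cong')
      fix a assume a: "a \<in> Q"
      have "conj a (x [^] j) = ?h a \<otimes> x [^] j" using a Qc x by (simp add: conj_def word)
      then show "?F a j = ?F' (?h a) j" using Feq a by simp
    qed (use F'V Qcl xQ in auto)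
    also have "\<dots> = finprod ?V (\<lambda>a. ?F' a j) (?h ` Q)"
      by (rule V.finprod_reindex[symmetric]) (use inj F'V Qcl xQ in auto)
    finally show "finprod ?V (\<lambda>a. ?F a j) Q = finprod ?V (\<lambda>a. ?F' a j) Q" unfolding im .
  qed (use FV F'V in auto)
  then have eq: "v [^] card Q = finprod ?V (\<lambda>a. conj a v) Q"
  proof -
    have "finprod ?V (\<lambda>a. ?F a 0) Q = v [^] card Q"
      using V.finprod_const[of v Q] v by (simp add: nat_pow_consistent[symmetric])
    moreover have "finprod ?V (\<lambda>a. ?F' a 0) Q = finprod ?V (\<lambda>a. conj a v) Q"
      by (rule V.finprod_cong') (use QV v Qc in auto)
    ultimately show ?thesis using \<open>finprod ?V (\<lambda>a. ?F a 0) Q = finprod ?V (\<lambda>a. ?F' a 0) Q\<close> by simp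
  qed
  have "conj b (finprod ?V (\<lambda>a. conj a v) Q) = finprod ?V (\<lambda>a. conj b (conj a v)) Q"
    by (rule V.hom_finprod[OF ah[OF b]]) (use QV v in auto)
  also have "\<dots> = finprod ?V (\<lambda>a. conj (b \<otimes> a) v) Q"
    by (rule V.finprod_cong') (use QV v b Qc Qcl Vc in \<open>auto simp: conj_conj\<close>)
  also have "\<dots> = finprod ?V (\<lambda>a. conj a v) ((\<lambda>a. b \<otimes> a) ` Q)"
    by (rule V.finprod_reindex[symmetric]) (use QV v b Qc Qcl in \<open>auto simp: inj_on_def\<close>)
  also have "(\<lambda>a. b \<otimes> a) ` Q = Q"
    by (rule endo_inj_surj[OF fQ]) (use b Qc Qcl in \<open>auto simp: inj_on_def\<close>)
  finally have "conj b (v [^] card Q) = v [^] card Q" using eq by simp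
  \<comment> \<open>Coprimality makes \<open>v\<close> a power of \<open>v [^] card Q\<close>, so
    invariance passes to \<open>v\<close>.\<close>
  moreover obtain k::nat where "(v [^] card Q) [^] k = v"
    using pow_root[of v r "card Q"] v Vc V(3,4) coprime_commute by blast
  ultimately show ?thesis using b v Qc Vc by (metis conj_pow nat_pow_closed)
qed

end

section \<open>Chief factors and normal subgroups of prime order\<close>

context fin_group
begin

lemma conj_mem: "subgroup M G \<Longrightarrow> a \<in> M \<Longrightarrow> b \<in> M \<Longrightarrow> conj a b \<in> M"
  unfolding conj_def by (simp add: subgroup.m_closed subgroup.m_inv_closed)

text \<open>Powers are multiplicative in the abelian quotient of \<open>M\<close> by
  \<open>E\<close>. \<open>E\<close> is normal in \<open>M\<close> because it contains the
  commutators of \<open>M\<close> with its own elements.\<close>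

lemma pow_mult_mod_commutators:
  assumes M: "subgroup M G" and E: "subgroup E G" "E \<subseteq> M"
    "\<And>a b. a \<in> M \<Longrightarrow> b \<in> M \<Longrightarrow> conj a b \<otimes> inv b \<in> E" and ab: "a \<in> M" "b \<in> M"
  shows "\<exists>e\<in>E. (a \<otimes> b) [^] (n::nat) = e \<otimes> a [^] n \<otimes> b [^] n"
proof (induction n)
  case 0
  show ?case using E by (intro bexI[of _ \<one>]) (auto simp: subgroup.one_closed)
next
  case (Suc n)
  then obtain e where e: "e \<in> E" "(a \<otimes> b) [^] n = e \<otimes> a [^] n \<otimes> b [^] n" by auto
  have Mc: "x \<in> carrier G" if "x \<in> M" for x using M that subgroup.mem_carrier by metis
  have Ec: "x \<in> carrier G" if "x \<in> E" for x using E that subgroup.mem_carrier by metis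
  have pw: "a [^] n \<in> M" "b [^] n \<in> M" using M ab subgroup_pow_closed by auto
  let ?c = "conj (b [^] n) a \<otimes> inv a"
  have c: "?c \<in> E" using E(3) pw ab by auto
  have "conj (a [^] n) ?c \<otimes> inv ?c \<in> E" using E(2,3) pw c by auto
  then have "conj (a [^] n) ?c \<otimes> inv ?c \<otimes> ?c \<in> E" using c E(1) subgroup.m_closed by metis
  moreover have "conj (a [^] n) ?c \<otimes> inv ?c \<otimes> ?c = conj (a [^] n) ?c"
    using Ec[OF c] pw Mc by (simp add: m_assoc)
  ultimately have c': "conj (a [^] n) ?c \<in> E" by simp
  have comm: "b [^] n \<otimes> b = b \<otimes> b [^] n" using ab Mc nat_pow_comm[of b n 1] by simp
  have "(a \<otimes> b) [^] Suc n = e \<otimes> conj (a [^] n) ?c \<otimes> a [^] n \<otimes> a \<otimes> b [^] n \<otimes> b"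
    using ab pw Mc Ec e by (simp add: conj_def word)
  also have "\<dots> = (e \<otimes> conj (a [^] n) ?c) \<otimes> a [^] Suc n \<otimes> b [^] Suc n"
    using ab pw Mc Ec e Ec[OF c'] by (simp add: m_assoc)
  finally show ?case using e c' E(1) subgroup.m_closed by metis
qed

section \<open>Derived subgroups and chief factors\<close>

lemma derived_proper:
  assumes "solvable G" "subgroup M G" "M \<noteq> {\<one>}" shows "derived G M \<noteq> M"
proof
  assume eq: "derived G M = M"
  obtain n where n: "(derived G ^^ n) (carrier G) = {\<one>}"
    using assms(1) solvable_imp_trivial_derived_seq solvable_def by blast
  have "(derived G ^^ n) M = M" by (induction n) (use eq in auto)
  moreover have "(derived G ^^ n) M \<subseteq> (derived G ^^ n) (carrier G)"
    using mono_exp_of_derived assms(2) subgroup.subset by blast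
  ultimately show False using n assms(2,3) subgroup.one_closed by blast
qed

lemma commutator_derived:
  assumes "a \<in> M" "b \<in> M" "M \<subseteq> carrier G" shows "conj a b \<otimes> inv b \<in> derived G M"
  unfolding derived_def conj_def using assms by (intro generate.incl) auto

lemma subgroup_finiteI:
  assumes "K \<subseteq> carrier G" "\<one> \<in> K" "\<And>x y. x \<in> K \<Longrightarrow> y \<in> K \<Longrightarrow> x \<otimes> y \<in> K" shows "subgroup K G"
proof (rule subgroupI)
  fix a assume a: "a \<in> K"
  have "a [^] (n::nat) \<in> K" for n by (induction n) (use assms a in auto)
  then show "inv a \<in> K" using inv_eq_pow a assms(1) by (metis subsetD)
qed (use assms in auto)

text \<open>The commutator appears as the solution \<open>c\<close> of
  \<open>c \<otimes> (y \<otimes> x) = x \<otimes> y\<close>, so that in a concrete group no inverse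
  has to be computed.\<close>

lemma derived_leI:
  assumes K: "subgroup K G" and H: "H \<subseteq> carrier G"
    and "\<And>x y c. \<lbrakk>x \<in> H; y \<in> H; c \<in> carrier G; c \<otimes> (y \<otimes> x) = x \<otimes> y\<rbrakk> \<Longrightarrow> c \<in> K"
  shows "derived G H \<subseteq> K"
  unfolding derived_def
proof (rule generate_subgroup_incl[OF _ K], clarsimp)
  fix x y assume xy: "x \<in> H" "y \<in> H"
  then have c: "x \<in> carrier G" "y \<in> carrier G" using H by auto
  then show "x \<otimes> y \<otimes> inv x \<otimes> inv y \<in> K" using assms(3)[OF xy] by (simp add: word)
qed

lemma derived_invariant:
  assumes M: "subgroup M G" and g: "g \<in> carrier G" "conj g ` M \<subseteq> M"
  shows "conj g ` derived G M \<subseteq> derived G M"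
proof -
  have Mc: "M \<subseteq> carrier G" using M subgroup.subset by auto
  have d: "subgroup (derived G M) G" using derived_is_subgroup[OF Mc] .
  define K where "K = {z \<in> carrier G. conj g z \<in> derived G M}"
  have "subgroup K G"
  proof (rule subgroupI)
    show "K \<noteq> {}" using d g subgroup.one_closed unfolding K_def by (auto intro!: exI[of _ \<one>])
  qed (use g d in \<open>auto simp: K_def conj_inv conj_mult subgroup.m_closed subgroup.m_inv_closed\<close>)
  moreover have "derived_set G M \<subseteq> K"
  proof (clarsimp simp: K_def)
    fix a b assume ab: "a \<in> M" "b \<in> M"
    then have abc: "a \<in> carrier G" "b \<in> carrier G" using Mc by auto
    have "conj g (a \<otimes> b \<otimes> inv a \<otimes> inv b) = conj (conj g a) (conj g b) \<otimes> inv (conj g b)"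
      using abc g by (simp add: conj_def word)
    moreover have "conj (conj g a) (conj g b) \<otimes> inv (conj g b) \<in> derived G M"
      using commutator_derived[OF _ _ Mc] ab g by blast
    ultimately show "a \<otimes> b \<otimes> inv a \<otimes> inv b \<in> carrier G \<and> conj g (a \<otimes> b \<otimes> inv a \<otimes> inv b) \<in> derived G M"
      using abc by simp
  qed
  ultimately have "derived G M \<subseteq> K" using generate_subgroup_incl unfolding derived_def by blast
  then show ?thesis unfolding K_def by auto
qed

text \<open>\<open>M\<close> is taken of least order. Its derived subgroup is proper and invariant,
  hence inside \<open>D\<close>; the elements with \<open>q\<close>-th power in \<open>D\<close>
  form an invariant subgroup not inside \<open>D\<close>, hence all of \<open>M\<close>. The set
  \<open>A\<close> of operators is arbitrary: the whole group yields normal subgroups,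
  \<open>H\<close> a factor inside a subgroup, and a single element an elementary abelian section of
  a Sylow subgroup.\<close>

lemma chief_factor:
  assumes sol: "solvable G" and A: "A \<subseteq> carrier G" and Y: "subgroup Y G" "\<And>g. g \<in> A \<Longrightarrow> conj g ` Y \<subseteq> Y"
    and D: "subgroup D G" "\<And>g. g \<in> A \<Longrightarrow> conj g ` D \<subseteq> D" and YD: "\<not> Y \<subseteq> D"
  shows "\<exists>M q. subgroup M G \<and> M \<subseteq> Y \<and> \<not> M \<subseteq> D \<and> (\<forall>g\<in>A. conj g ` M \<subseteq> M) \<and>
    (\<forall>L. subgroup L G \<longrightarrow> L \<subseteq> M \<longrightarrow> (\<forall>g\<in>A. conj g ` L \<subseteq> L) \<longrightarrow> L \<subseteq> D \<or> L = M) \<and>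
    (\<forall>a\<in>M. \<forall>b\<in>M. conj a b \<otimes> inv b \<in> D) \<and> Factorial_Ring.prime (q::nat) \<and> (\<forall>m\<in>M. m [^] q \<in> D)"
proof -
  let ?P = "\<lambda>M. subgroup M G \<and> M \<subseteq> Y \<and> \<not> M \<subseteq> D \<and> (\<forall>g\<in>A. conj g ` M \<subseteq> M)"
  have "?P Y" using Y YD by auto
  then obtain M where M: "?P M" and min: "\<And>L. ?P L \<Longrightarrow> card M \<le> card L"
    using ex_has_least_nat[of ?P Y card] by blast
  have sM: "subgroup M G" and invM: "\<And>g. g \<in> A \<Longrightarrow> conj g ` M \<subseteq> M" using M by auto
  have Mc: "M \<subseteq> carrier G" using sM subgroup.subset by auto
  have min': "L \<subseteq> D \<or> L = M" if "subgroup L G" "L \<subseteq> M" "\<And>g. g \<in> A \<Longrightarrow> conj g ` L \<subseteq> L" for L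
  proof (cases "L \<subseteq> D")
    case False
    then have "card M \<le> card L" using min[of L] that M by blast
    then have "L = M" using that(2) finite_subgroup[OF sM] by (simp add: card_seteq)
    then show ?thesis by simp
  qed simp
  let ?E = "derived G M"
  have E: "subgroup ?E G" "?E \<subseteq> M"
    using derived_is_subgroup[OF Mc] derived_incl[OF order_refl sM] by auto
  have "M \<noteq> {\<one>}" using M D(1) subgroup.one_closed by blast
  then have ED: "?E \<subseteq> D"
    using min'[OF E] derived_proper[OF sol sM] derived_invariant[OF sM] invM A by blast
  have cE: "conj a b \<otimes> inv b \<in> ?E" if "a \<in> M" "b \<in> M" for a b
    using commutator_derived that Mc by auto
  obtain m where m: "m \<in> M" "m \<notin> D" using M by auto
  then have mc: "m \<in> carrier G" using Mc by auto
  \<comment> \<open>The least such \<open>n\<close> is the order of \<open>m\<close> modulo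
    \<open>D\<close>. For a prime \<open>q\<close> dividing it, the power of \<open>m\<close> with
    exponent \<open>n div q\<close> has order \<open>q\<close> modulo \<open>D\<close>.\<close>
  let ?Q = "\<lambda>n::nat. 0 < n \<and> m [^] n \<in> D"
  have "?Q (order G)" using mc pow_order_eq_1 fin D(1) order_gt_0_iff_finite subgroup.one_closed by auto
  then obtain n where n: "?Q n" and nmin: "\<And>k. ?Q k \<Longrightarrow> n \<le> k" using ex_has_least_nat[of ?Q _ id] by auto
  have "n \<noteq> 1" using n m mc by auto
  then obtain q where q: "Factorial_Ring.prime q" "q dvd n" using prime_factor_nat by blast
  then obtain k where k: "n = k * q" by (auto simp: mult.commute)
  let ?y = "m [^] k"
  have kn: "k < n" using k n prime_gt_1_nat[OF q(1)] by auto
  have y: "?y \<in> M" "?y \<notin> D" "?y [^] q \<in> D"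
    using subgroup_pow_closed[OF sM m(1)] nmin[of k] kn k n mc by (auto simp: nat_pow_pow gr0I)
  define L where "L = {m \<in> M. m [^] q \<in> D}"
  have Lc: "subgroup L G"
  proof (rule subgroupI)
    show "L \<subseteq> carrier G" using Mc L_def by auto
    show "L \<noteq> {}" using y L_def by auto
    fix a assume a: "a \<in> L"
    then have "inv a [^] q = inv (a [^] q)" using Mc L_def by (auto simp: nat_pow_inv)
    then show "inv a \<in> L" using a sM D(1) by (auto simp: L_def subgroup.m_inv_closed)
    fix b assume b: "b \<in> L"
    obtain e where "e \<in> ?E" "(a \<otimes> b) [^] q = e \<otimes> a [^] q \<otimes> b [^] q"
      using pow_mult_mod_commutators[OF sM E cE, of a b q] a b L_def by auto
    then have "(a \<otimes> b) [^] q \<in> D" using ED a b D(1) unfolding L_def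
      by (metis (no_types, lifting) mem_Collect_eq subgroup.m_closed subsetD)
    then show "a \<otimes> b \<in> L" using a b sM by (auto simp: L_def subgroup.m_closed)
  qed
  have "conj g ` L \<subseteq> L" if "g \<in> A" for g
  proof
    fix z assume "z \<in> conj g ` L"
    then obtain l where l: "l \<in> M" "l [^] q \<in> D" "z = conj g l" unfolding L_def by auto
    have "z \<in> M" using invM that l by auto
    moreover have "z [^] q = conj g (l [^] q)" using l that A Mc by (simp add: conj_pow subset_iff)
    ultimately show "z \<in> L" using D(2)[OF that] l unfolding L_def by auto
  qed
  then have "L = M" using min'[OF Lc] y L_def by blast
  then have "m [^] q \<in> D" if "m \<in> M" for m using that L_def by auto
  moreover have "conj a b \<otimes> inv b \<in> D" if "a \<in> M" "b \<in> M" for a b using cE ED that by auto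
  moreover have "\<forall>L. subgroup L G \<longrightarrow> L \<subseteq> M \<longrightarrow> (\<forall>g\<in>A. conj g ` L \<subseteq> L) \<longrightarrow> L \<subseteq> D \<or> L = M"
    using min' by blast
  ultimately show ?thesis using sM M q(1) by (intro exI[of _ M] exI[of _ q]) blast
qed

section \<open>Normal subgroups of prime order in odd order\<close>

lemma class_two_pow:
  assumes b: "b \<in> carrier G" and c: "c \<in> carrier G" and z: "z \<in> carrier G"
    and cb: "c \<otimes> b = z \<otimes> b \<otimes> c" and zb: "z \<otimes> b = b \<otimes> z" and zc: "z \<otimes> c = c \<otimes> z"
  shows "(b \<otimes> c) [^] (n::nat) = z [^] (n * (n - 1) div 2) \<otimes> b [^] n \<otimes> c [^] n"
proof (induction n)
  case (Suc n)
  have zpb: "z [^] k \<otimes> b [^] (j::nat) = b [^] j \<otimes> z [^] k" for k j :: nat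
    using b z zb by (metis pow_mult_distrib nat_pow_closed group_commutes_pow)
  have cnb: "c [^] k \<otimes> b = z [^] k \<otimes> b \<otimes> c [^] k" for k :: nat
  proof (induction k)
    case (Suc k)
    have "c [^] Suc k \<otimes> b = c [^] k \<otimes> (c \<otimes> b)" using b c by (simp add: m_assoc)
    also have "\<dots> = c [^] k \<otimes> (z \<otimes> b \<otimes> c)" using cb by simp
    also have "\<dots> = (c [^] k \<otimes> z) \<otimes> (b \<otimes> c)" using b c z by (simp add: m_assoc)
    also have "c [^] k \<otimes> z = z \<otimes> c [^] k" using group_commutes_pow[of c z k] zc c z by simp
    also have "z \<otimes> c [^] k \<otimes> (b \<otimes> c) = z \<otimes> (c [^] k \<otimes> b) \<otimes> c" using b c z by (simp add: m_assoc)
    also have "\<dots> = (z \<otimes> z [^] k) \<otimes> b \<otimes> (c [^] k \<otimes> c)" using Suc b c z by (simp add: m_assoc)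
    also have "z \<otimes> z [^] k = z [^] Suc k" using z nat_pow_comm[of z 1 k] by simp
    finally show ?case by simp
  qed (use b in simp)
  have ex: "n * (n - 1) div 2 + n = Suc n * (Suc n - 1) div 2"
    by (cases n) (auto simp: algebra_simps)
  let ?k = "n * (n - 1) div 2"
  have "(b \<otimes> c) [^] Suc n = z [^] ?k \<otimes> b [^] n \<otimes> (c [^] n \<otimes> b) \<otimes> c"
    using Suc b c z by (simp add: m_assoc)
  also have "\<dots> = z [^] ?k \<otimes> (b [^] n \<otimes> z [^] n) \<otimes> b \<otimes> c [^] n \<otimes> c"
    using cnb[of n] b c z by (simp add: m_assoc)
  also have "\<dots> = z [^] ?k \<otimes> z [^] n \<otimes> b [^] Suc n \<otimes> c [^] Suc n"
    unfolding zpb[of n n, symmetric] using b c z by (simp add: m_assoc)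
  also have "z [^] ?k \<otimes> z [^] n = z [^] (Suc n * (Suc n - 1) div 2)"
    using z ex by (simp add: nat_pow_mult)
  finally show ?case .
qed simp

text \<open>
  \<open>T\<close> is the largest normal subgroup centralised by \<open>h\<close>, and \<open>C\<close> its centraliser. If \<open>h \<in> T\<close> we are done.
  Otherwise a chief factor of \<open>C\<close> outside \<open>T\<close> gives \<open>B\<close> of class two whose elements \<open>c\<close> with
  \<open>c\<^sup>q = 1\<close> commute with \<open>h\<close>. As \<open>q\<close> is odd, \<open>b\<inverse> h b h\<inverse>\<close> is such an element for \<open>b \<in> B\<close>, and this forces \<open>h\<close>
  to centralise \<open>B\<close>, against the choice of \<open>T\<close>.
\<close>

lemma prime_subgroups_normal:
  assumes sol: "solvable G" and H: "subgroup H G" and odd: "odd (card H)"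
    and cyc: "\<And>l x u. \<lbrakk>Factorial_Ring.prime (l::nat); x \<in> H; x \<noteq> \<one>; x [^] l = \<one>; u \<in> H; u [^] l = \<one>; conj x u = u\<rbrakk>
      \<Longrightarrow> \<exists>k::nat. u = x [^] k"
    and pq: "\<And>l s y z. \<lbrakk>Factorial_Ring.prime (l::nat); Factorial_Ring.prime (s::nat); y \<in> H; y [^] l = \<one>; z \<in> H; z [^] s = \<one>; normalises y z\<rbrakk>
      \<Longrightarrow> conj y z = z"
    and h: "h \<in> H" "h \<noteq> \<one>" "h [^] l = \<one>" and l: "Factorial_Ring.prime (l::nat)" and g: "g \<in> H"
  shows "normalises g h"
proof -
  have Hc: "x \<in> carrier G" if "x \<in> H" for x using H that subgroup.mem_carrier by metis
  have Hcl: "x \<otimes> y \<in> H" "conj x y \<in> H" if "x \<in> H" "y \<in> H" for x y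
    using H that subgroup.m_closed conj_mem by metis+
  have Hi: "inv x \<in> H" if "x \<in> H" for x using H that subgroup.m_inv_closed by metis
  define T where "T = {t \<in> H. \<forall>g\<in>H. conj t (conj g h) = conj g h}"
  have TH: "t \<in> H" if "t \<in> T" for t using that T_def by auto
  have Tfix: "conj t (conj g h) = conj g h" if "t \<in> T" "g \<in> H" for t g using that T_def by auto
  have Th: "conj t h = h" "conj h t = t" if "t \<in> T" for t
  proof -
    show "conj t h = h" using Tfix[OF that, of \<one>] H h Hc by (simp add: subgroup.one_closed)
    then show "conj h t = t" using conj_fix_sym[of t h] TH that Hc h by simp
  qed
  have sT: "subgroup T G"
  proof (rule subgroupI)
    have "\<one> \<in> T" using H Hc h by (auto simp: T_def subgroup.one_closed)
    then show "T \<noteq> {}" by auto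
    fix a assume a: "a \<in> T"
    have "conj (inv a) (conj g h) = conj g h" if "g \<in> H" for g
      using a Tfix[OF a that] TH Hc h that by (metis conj_closed conj_inv_conj(1))
    then show "inv a \<in> T" using Hi[OF TH[OF a]] unfolding T_def by blast
    fix b assume b: "b \<in> T"
    have "conj (a \<otimes> b) (conj g h) = conj g h" if "g \<in> H" for g
      using a b Tfix TH Hc h that conj_conj[of a b "conj g h"] by simp
    then show "a \<otimes> b \<in> T" using Hcl(1)[OF TH[OF a] TH[OF b]] unfolding T_def by blast
  qed (use Hc TH in auto)
  have invT: "conj k ` T \<subseteq> T" if k: "k \<in> H" for k
  proof
    fix z assume "z \<in> conj k ` T"
    then obtain t where t: "t \<in> T" "z = conj k t" by auto
    have "conj z (conj g h) = conj g h" if g: "g \<in> H" for g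
    proof -
      have "conj z (conj g h) = conj k (conj t (conj (inv k \<otimes> g) h))"
        using t TH Hc h g k by (simp add: conj_def word)
      also have "\<dots> = conj k (conj (inv k \<otimes> g) h)" using Tfix t g k Hcl(1) Hi by simp
      also have "\<dots> = conj g h" using Hc h g k by (simp add: conj_conj)
      finally show ?thesis .
    qed
    moreover have "z \<in> H" using t TH k Hcl(2) by simp
    ultimately show "z \<in> T" unfolding T_def by blast
  qed
  define C where "C = {c \<in> H. \<forall>t\<in>T. conj c t = t}"
  have CH: "c \<in> H" if "c \<in> C" for c using that C_def by auto
  have Cfix: "conj c t = t" if "t \<in> T" "c \<in> C" for t c using that C_def by auto
  have sC: "subgroup C G"
  proof (rule subgroupI)
    have "\<one> \<in> C" using H Hc TH by (auto simp: C_def subgroup.one_closed)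
    then show "C \<noteq> {}" by auto
    fix a assume a: "a \<in> C"
    have "conj (inv a) t = t" if "t \<in> T" for t
      using a Cfix[OF that a] TH CH Hc that by (metis conj_inv_conj(1))
    then show "inv a \<in> C" using Hi[OF CH[OF a]] unfolding C_def by blast
    fix b assume b: "b \<in> C"
    have "conj (a \<otimes> b) t = t" if "t \<in> T" for t
      using a b Cfix TH CH Hc that conj_conj[of a b t] by simp
    then show "a \<otimes> b \<in> C" using Hcl(1)[OF CH[OF a] CH[OF b]] unfolding C_def by blast
  qed (use Hc CH in auto)
  have invC: "conj k ` C \<subseteq> C" if k: "k \<in> H" for k
  proof
    fix z assume "z \<in> conj k ` C"
    then obtain c where c: "c \<in> C" "z = conj k c" by auto
    have "conj z t = t" if t: "t \<in> T" for t
    proof -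
      have "conj z t = conj k (conj c (conj (inv k) t))"
        using t TH CH Hc c k by (simp add: conj_def word)
      also have "\<dots> = conj k (conj (inv k) t)" using Cfix[of _ c] invT[of "inv k"] t c k Hi by auto
      also have "\<dots> = t" using Hc TH t k by simp
      finally show ?thesis .
    qed
    moreover have "z \<in> H" using c CH k Hcl(2) by simp
    ultimately show "z \<in> C" unfolding C_def by blast
  qed
  \<comment> \<open>If \<open>h\<close> commutes with its conjugate by \<open>g\<close>, which has
    the same prime order, \<open>cyc\<close> makes the conjugate a power of
    \<open>h\<close>.\<close>
  have conclude: "normalises g h" if hg: "conj h (conj g h) = conj g h"
  proof -
    have "conj g h [^] l = \<one>" using conj_pow[of g h l] g h Hc by simp
    then obtain k::nat where "conj g h = h [^] k" using cyc[OF l h(1,2,3) _ _ hg] g h Hcl by auto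
    then show ?thesis using normalises_def by auto
  qed
  show ?thesis
  proof (cases "C \<subseteq> T")
    case True
    have "h \<in> C" using h Th by (auto simp: C_def)
    then have "h \<in> T" using True by auto
    then show ?thesis using conclude Tfix g by auto
  next
    case False
    have Hs: "H \<subseteq> carrier G" using H subgroup.subset by auto
    have "\<exists>B q. subgroup B G \<and> B \<subseteq> C \<and> \<not> B \<subseteq> T \<and> (\<forall>g\<in>H. conj g ` B \<subseteq> B) \<and>
      (\<forall>L. subgroup L G \<longrightarrow> L \<subseteq> B \<longrightarrow> (\<forall>g\<in>H. conj g ` L \<subseteq> L) \<longrightarrow> L \<subseteq> T \<or> L = B) \<and>
      (\<forall>a\<in>B. \<forall>b\<in>B. conj a b \<otimes> inv b \<in> T) \<and> Factorial_Ring.prime (q::nat) \<and> (\<forall>m\<in>B. m [^] q \<in> T)"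
      by (rule chief_factor[OF sol Hs sC _ sT _ False]) (use invC invT in auto)
    then obtain B q where sB: "subgroup B G" and BC: "B \<subseteq> C" and BT: "\<not> B \<subseteq> T"
      and invB': "\<forall>g\<in>H. conj g ` B \<subseteq> B" and BB': "\<forall>a\<in>B. \<forall>b\<in>B. conj a b \<otimes> inv b \<in> T"
      and q: "Factorial_Ring.prime (q::nat)" and Bq': "\<forall>m\<in>B. m [^] q \<in> T"
      by (elim exE conjE) (rule that)
    note invB = invB'[rule_format] and BB = BB'[rule_format] and Bq = Bq'[rule_format]
    have BH: "b \<in> H" if "b \<in> B" for b using BC CH that by auto
    have Bc: "b \<in> carrier G" if "b \<in> B" for b using BH Hc that by auto
    have Tc: "t \<in> carrier G" if "t \<in> T" for t using TH Hc that by auto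
    have TB: "conj b t = t" if "t \<in> T" "b \<in> B" for t b using Cfix BC that by auto
    have q2: "odd q"
    proof
      assume "even q"
      then have "q = 2" using q primes_dvd_imp_eq two_is_prime_nat by blast
      obtain b where b: "b \<in> B" "b \<notin> T" using BT by auto
      have "coprime q (card H)" using \<open>q = 2\<close> odd by simp
      then obtain k::nat where "(b [^] q) [^] k = b"
        using pow_root[of b "card H" q] subgroup_pow_card[OF H BH[OF b(1)]] Bc[OF b(1)] by auto
      then show False using subgroup_pow_closed[OF sT Bq[OF b(1)], of k] b(2) by simp
    qed
    then have "2 dvd q - 1" by simp
    \<comment> \<open>This kills the power of the commutator \<open>z\<close> in
      \<open>class_two_pow\<close>, and is the place where odd order enters.\<close>
    then have qd: "q dvd q * (q - 1) div 2" by (simp add: div_mult_swap[symmetric])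
    \<comment> \<open>The commutator lies in \<open>T\<close>, which \<open>B\<close> centralises.
      Since \<open>b [^] q \<in> T\<close> is fixed by \<open>c\<close>, expanding the
      \<open>q\<close>-th power of \<open>conj c b\<close> gives
      \<open>z [^] q = \<one>\<close>.\<close>
    have class2: "\<exists>z\<in>T. z \<in> B \<and> c \<otimes> b = z \<otimes> b \<otimes> c \<and> z \<otimes> b = b \<otimes> z \<and> z \<otimes> c = c \<otimes> z \<and> z [^] q = \<one>"
      if b: "b \<in> B" and c: "c \<in> B" for b c
    proof (intro bexI conjI)
      let ?z = "conj c b \<otimes> inv b"
      show zT: "?z \<in> T" using BB b c by auto
      show "?z \<in> B" using sB b c conj_mem by (simp add: subgroup.m_closed subgroup.m_inv_closed)
      show "c \<otimes> b = ?z \<otimes> b \<otimes> c" using Bc b c by (simp add: conj_def word)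
      have "b \<otimes> ?z = ?z \<otimes> b" "c \<otimes> ?z = ?z \<otimes> c"
        using TB[OF zT] b c conj_fix[of _ ?z] Bc Tc[OF zT] by blast+
      then show zb: "?z \<otimes> b = b \<otimes> ?z" and "?z \<otimes> c = c \<otimes> ?z" by auto
      have "b [^] q = conj c b [^] q" using TB[OF Bq[OF b] c] conj_pow[of c b q] b c Bc by simp
      also have "conj c b = ?z \<otimes> b" using b c Bc by (simp add: m_assoc)
      also have "(?z \<otimes> b) [^] q = ?z [^] q \<otimes> b [^] q" using zb b c Bc by (intro pow_mult_distrib) auto
      finally show "?z [^] q = \<one>"
        using r_cancel_one'[OF nat_pow_closed[OF Bc[OF b]] nat_pow_closed[OF Tc[OF zT]]] by blast
    qed
    \<comment> \<open>If \<open>B \<inter> T\<close> contains an element of order \<open>q\<close>,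
      it is central in \<open>B\<close>, and \<open>cyc\<close> puts all others into the group it
      generates. Otherwise all commutators in \<open>B\<close> vanish, so \<open>B\<close> is
      abelian; \<open>cyc\<close> applies again, and \<open>pq\<close> shows that \<open>h\<close>
      centralises the resulting cyclic group.\<close>
    have Om: "\<exists>c0\<in>B. c0 [^] q = \<one> \<and> conj h c0 = c0 \<and> (\<forall>c\<in>B. c [^] q = \<one> \<longrightarrow> (\<exists>k::nat. c = c0 [^] k))"
    proof (cases "\<exists>c0\<in>B. c0 \<in> T \<and> c0 \<noteq> \<one> \<and> c0 [^] q = \<one>")
      case True
      then obtain c0 where c0: "c0 \<in> B" "c0 \<in> T" "c0 \<noteq> \<one>" "c0 [^] q = \<one>" by auto
      have "\<exists>k::nat. c = c0 [^] k" if "c \<in> B" "c [^] q = \<one>" for c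
      proof (rule cyc[OF q BH[OF c0(1)] c0(3,4) BH[OF that(1)] that(2)])
        show "conj c0 c = c" using TB[OF c0(2) that(1)] conj_fix_sym Bc c0(1) that(1) by simp
      qed
      then show ?thesis using c0 Th by blast
    next
      case False
      then have comm: "conj c d = d" if "c \<in> B" "d \<in> B" for c d
        using class2[OF that(2,1)] that Bc by (metis conj_fix l_one)
      show ?thesis
      proof (cases "\<exists>c0\<in>B. c0 \<noteq> \<one> \<and> c0 [^] q = \<one>")
        case True
        then obtain c0 where c0: "c0 \<in> B" "c0 \<noteq> \<one>" "c0 [^] q = \<one>" by auto
        have *: "\<exists>k::nat. c = c0 [^] k" if "c \<in> B" "c [^] q = \<one>" for c
          using cyc[OF q BH[OF c0(1)] c0(2,3) BH[OF that(1)] that(2)] comm c0(1) that(1) by auto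
        have "conj h c0 \<in> B" "conj h c0 [^] q = \<one>"
          using invB h c0 conj_pow[of h c0 q] Hc Bc by auto
        then have "normalises h c0" using * normalises_def by auto
        then have "conj h c0 = c0" using pq[OF l q h(1,3) BH[OF c0(1)] c0(3)] by auto
        then show ?thesis using * c0 by blast
      next
        case False
        then show ?thesis using sB h Hc by (intro bexI[of _ \<one>]) (auto simp: subgroup.one_closed intro: exI[of _ 0])
      qed
    qed
    then obtain c0 where c0: "c0 \<in> B" "c0 [^] q = \<one>" "conj h c0 = c0"
      and Oc: "\<And>c. c \<in> B \<Longrightarrow> c [^] q = \<one> \<Longrightarrow> \<exists>k::nat. c = c0 [^] k" by blast
    have Ocomm: "conj c d = d" if cd: "c \<in> B" "d \<in> B" "c [^] q = \<one>" "d [^] q = \<one>" for c d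
    proof -
      obtain i j::nat where "c = c0 [^] i" "d = c0 [^] j" using Oc cd by blast
      then show ?thesis using Bc[OF c0(1)] by (simp add: conj_fix nat_pow_comm)
    qed
    have hc: "conj h c = c" if c: "c \<in> B" "c [^] q = \<one>" for c
    proof -
      obtain k::nat where "c = c0 [^] k" using Oc c by blast
      then show ?thesis using c0 h Hc Bc by (simp add: conj_pow)
    qed
    show ?thesis
    proof (rule ccontr)
      assume no: "\<not> normalises g h"
      have hb: "conj h b = b" if b: "b \<in> B" for b
      proof -
        \<comment> \<open>Comparing \<open>q\<close>-th powers of \<open>b\<close> and
          \<open>conj h b\<close> gives \<open>?c [^] q = \<one>\<close>. Then \<open>h\<close>
          commutes with \<open>?c\<close>, iteration gives
          \<open>(conj h ^^ i) b = b \<otimes> ?c [^] i\<close>, and \<open>i = l\<close> yields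
          \<open>?c [^] l = \<one>\<close>.\<close>
        let ?c = "inv b \<otimes> conj h b"
        have c: "?c \<in> B" using b sB invB[OF h(1)] by (auto simp: subgroup.m_closed subgroup.m_inv_closed)
        have bc: "conj h b = b \<otimes> ?c" using b h Hc Bc by simp
        obtain z where z: "z \<in> T" "?c \<otimes> b = z \<otimes> b \<otimes> ?c" "z \<otimes> b = b \<otimes> z" "z \<otimes> ?c = ?c \<otimes> z" "z [^] q = \<one>"
          using class2[OF b c] by auto
        obtain j where j: "q * (q - 1) div 2 = q * j" using qd by auto
        have "b [^] q = conj h (b [^] q)" using Th(2)[OF Bq[OF b]] by simp
        also have "\<dots> = (b \<otimes> ?c) [^] q" unfolding bc[symmetric] using b h Hc Bc by (simp add: conj_pow)
        also have "\<dots> = z [^] (q * (q - 1) div 2) \<otimes> b [^] q \<otimes> ?c [^] q"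
          by (rule class_two_pow) (use b Bc c Tc z in auto)
        also have "z [^] (q * (q - 1) div 2) = \<one>"
          unfolding j using z Tc by (simp flip: nat_pow_pow)
        finally have "b [^] q = b [^] q \<otimes> ?c [^] q" using Bc[OF b] by simp
        then have cq: "?c [^] q = \<one>"
          using l_cancel_one'[OF nat_pow_closed[OF Bc[OF b]] nat_pow_closed[OF Bc[OF c]]] by blast
        have it: "(conj h ^^ i) b = b \<otimes> ?c [^] i" for i
        proof (induction i)
          case (Suc i)
          have "(conj h ^^ Suc i) b = conj h b \<otimes> conj h (?c [^] i)"
            using Suc conj_mult[of h b "?c [^] i"] h b Hc Bc[OF b] Bc[OF c] by simp
          also have "conj h (?c [^] i) = ?c [^] i"
            using conj_pow[of h ?c i] hc[OF c cq] h Hc Bc[OF c] by simp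
          also have "conj h b \<otimes> ?c [^] i = b \<otimes> (?c \<otimes> ?c [^] i)"
            using bc Bc[OF b] Bc[OF c] by (metis m_assoc nat_pow_closed)
          also have "?c \<otimes> ?c [^] i = ?c [^] Suc i"
            using nat_pow_comm[of ?c 1 i] Bc[OF c] by simp
          finally show ?case .
        qed (use b Bc in simp)
        have "b \<otimes> ?c [^] l = b" using it[of l] conj_funpow[of h b l] h b Hc Bc by simp
        then have cl: "?c [^] l = \<one>"
          using l_cancel_one[OF Bc[OF b] nat_pow_closed[OF Bc[OF c]]] by blast
        have "?c = \<one>"
        proof (cases "l = q")
          case False
          then have "coprime l q" using l q primes_coprime by blast
          then show ?thesis using coprime_pow_one[OF Bc[OF c] cl cq] by simp
        next
          \<comment> \<open>If \<open>?c\<close> were nontrivial, \<open>h\<close> would be a power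
            of it and so lie in \<open>B\<close>, where it commutes with its conjugates because they
            all have order \<open>q\<close>.\<close>
          case True
          show ?thesis
          proof (rule ccontr)
            assume "?c \<noteq> \<one>"
            then obtain k::nat where k: "h = ?c [^] k"
              using cyc[OF q BH[OF c] _ cq h(1)] h(3) True hc[OF c cq] conj_fix_sym[of h ?c] Hc[OF h(1)] Bc[OF c] by metis
            then have hB: "h \<in> B" by (subst k) (rule subgroup_pow_closed[OF sB c])
            have "conj g h \<in> B" "conj g h [^] q = \<one>"
              using hB invB[OF g] conj_pow[of g h q] h True g Hc by auto
            then have "conj h (conj g h) = conj g h" using Ocomm hB h(3) True by simp
            then show False using conclude no by simp
          qed
        qed
        then show ?thesis using bc Bc[OF b] by simp
      qed
      have "B \<subseteq> T"
      proof
        fix b assume b: "b \<in> B"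
        have "conj b (conj k h) = conj k h" if k: "k \<in> H" for k
        proof -
          have "conj (inv k) b \<in> B" using invB[of "inv k"] k Hi b by auto
          then have "conj (conj (inv k) b) h = h" using hb conj_fix_sym h Hc Bc by metis
          then have "conj k (conj (conj (inv k) b) h) = conj k h" by simp
          moreover have "conj k (conj (conj (inv k) b) h) = conj b (conj k h)"
            using k b h Hc Bc by (simp add: conj_def word)
          ultimately show ?thesis by simp
        qed
        then show "b \<in> T" using BH b by (auto simp: T_def)
      qed
      then show False using BT by simp
    qed
  qed
qed

end

section \<open>Distances in a soluble group\<close>

context fin_group
begin

section \<open>Fixed-point-free conjugation and short paths\<close>

lemma conj_fix_mult: "\<lbrakk>c \<in> carrier G; a \<in> carrier G; b \<in> carrier G; conj c a = a; conj c b = b\<rbrakk>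
    \<Longrightarrow> conj c (a \<otimes> b) = a \<otimes> b"
  by (simp add: conj_mult)

lemma conj_fix_inv: "\<lbrakk>c \<in> carrier G; a \<in> carrier G; conj c a = a\<rbrakk> \<Longrightarrow> conj c (inv a) = inv a"
  by (simp add: conj_inv)

lemma conj_fix_conj: "\<lbrakk>c \<in> carrier G; a \<in> carrier G; b \<in> carrier G; conj c a = a; conj c b = b\<rbrakk>
    \<Longrightarrow> conj c (conj a b) = conj a b"
  unfolding conj_def[of a b] by (simp add: conj_fix_mult conj_fix_inv)

lemma conj_fix_pow: "\<lbrakk>c \<in> carrier G; a \<in> carrier G; conj c a = a\<rbrakk> \<Longrightarrow> conj c (a [^] (n::nat)) = a [^] n"
  by (simp add: conj_pow)

text \<open>Without fixed points the map sending \<open>d\<close> to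
  \<open>conj d m \<otimes> inv m\<close> is injective on the finite group \<open>E\<close>, hence
  onto: the coset of \<open>m\<close> consists of conjugates of \<open>m\<close> under
  \<open>E\<close>.\<close>

lemma fpf_conj_surj:
  assumes E: "subgroup E G" and m: "m \<in> carrier G" "conj m ` E \<subseteq> E"
    and fpf: "\<And>d. d \<in> E \<Longrightarrow> conj m d = d \<Longrightarrow> d = \<one>" and e: "e \<in> E"
  shows "\<exists>d\<in>E. e \<otimes> m = conj d m"
proof -
  have Ec: "x \<in> carrier G" if "x \<in> E" for x using E that subgroup.mem_carrier by metis
  let ?f = "\<lambda>d. conj d m \<otimes> inv m"
  have feq: "?f d = d \<otimes> inv (conj m d)" if "d \<in> E" for d
    using that Ec m by (simp add: conj_def word)
  have "?f ` E = E"
  proof (rule endo_inj_surj[OF finite_subgroup[OF E]])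
    show "?f ` E \<subseteq> E"
      using feq m(2) E by (auto simp: image_subset_iff subgroup.m_closed subgroup.m_inv_closed)
    show "inj_on ?f E"
    proof (rule inj_onI)
      fix a b assume ab: "a \<in> E" "b \<in> E" "?f a = ?f b"
      then have "conj a m = conj b m" using Ec m by simp
      then have "conj (inv b \<otimes> a) m = m" using ab Ec m by (simp flip: conj_conj)
      then have "conj m (inv b \<otimes> a) = inv b \<otimes> a" using conj_fix_sym ab Ec m by simp
      moreover have "inv b \<otimes> a \<in> E" using ab E by (simp add: subgroup.m_closed subgroup.m_inv_closed)
      ultimately have "inv b \<otimes> a = \<one>" using fpf by blast
      then have "b \<otimes> (inv b \<otimes> a) = b" using ab Ec by simp
      then show "a = b" using ab Ec by simp
    qed
  qed
  then have "e \<in> ?f ` E" using e by simp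
  then obtain d where d: "d \<in> E" "e = ?f d" by blast
  then have "e \<otimes> m = conj d m" using Ec m by (simp add: m_assoc)
  then show ?thesis using d by blast
qed

lemma nbr_commI: "\<lbrakk>a \<in> nvert G; b \<in> nvert G; conj a b = b\<rbrakk> \<Longrightarrow> nbr a b"
  unfolding nbr_def by (auto simp: nvert_iff normalises_comm)

lemma walk_le_Suc: "nbr x y \<Longrightarrow> walk_le k y z \<Longrightarrow> walk_le (Suc k) x z"
  using walk_le_trans[of 1 x y k z] walk_le_1 by simp

lemma walk_le_Suc0: "nbr x y \<Longrightarrow> walk_le (Suc 0) x y"
  using walk_le_1 by simp

lemma walk_le_2: "nbr x y \<Longrightarrow> nbr y z \<Longrightarrow> walk_le 2 x z"
  using walk_le_Suc[OF _ walk_le_Suc0] by (simp add: numeral_2_eq_2)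

lemma walk_le_3: "nbr x y \<Longrightarrow> nbr y z \<Longrightarrow> nbr z w \<Longrightarrow> walk_le 3 x w"
  using walk_le_Suc[OF _ walk_le_2] by (simp add: numeral_3_eq_3 numeral_2_eq_2)

lemma nbr_pow:
  assumes "x \<in> carrier G" "x [^] (k::nat) \<noteq> \<one>" shows "nbr x (x [^] k)"
proof -
  have "x \<noteq> \<one>" using assms(2) by auto
  moreover have "conj x (x [^] k) = x [^] k" using conj_fix_pow[of x x k] conj_fix[of x x] assms(1) by simp
  ultimately show ?thesis using assms by (intro nbr_commI) (simp_all add: nvert_iff)
qed

lemma subgroup_centralizer:
  assumes "V \<subseteq> carrier G" shows "subgroup {g \<in> carrier G. \<forall>v\<in>V. conj g v = v} G"
proof (rule subgroupI)
  let ?C = "{g \<in> carrier G. \<forall>v\<in>V. conj g v = v}"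
  have "\<one> \<in> ?C" using assms by (simp add: subset_iff)
  then show "?C \<noteq> {}" by blast
  fix a assume a: "a \<in> ?C"
  have "conj (inv a) v = v" if v: "v \<in> V" for v
  proof -
    have "v \<in> carrier G" "conj a v = v" using a v assms by blast+
    then show ?thesis using conj_inv_conj(1)[of a v] a by simp
  qed
  then show "inv a \<in> ?C" using a by simp
  fix b assume b: "b \<in> ?C"
  have "conj (a \<otimes> b) v = v" if "v \<in> V" for v using conj_conj[of a b v] a b assms that by auto
  then show "a \<otimes> b \<in> ?C" using a b by simp
qed auto

lemma centralizer_invariant:
  assumes V: "V \<subseteq> carrier G" "\<And>g v. g \<in> carrier G \<Longrightarrow> v \<in> V \<Longrightarrow> conj g v \<in> V"
    and g: "g \<in> carrier G" and d: "d \<in> carrier G" "\<And>v. v \<in> V \<Longrightarrow> conj d v = v" and v: "v \<in> V"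
  shows "conj (conj g d) v = v"
proof -
  have vc: "v \<in> carrier G" using V v by auto
  have "conj (conj g d) v = conj g (conj d (conj (inv g) v))"
    using g d(1) vc by (simp add: conj_def word)
  also have "\<dots> = v" using d(2)[OF V(2)[OF _ v]] g vc by simp
  finally show ?thesis .
qed

text \<open>\<open>D\<close> and \<open>H\<close> become Frobenius kernel and complement. The
  elements \<open>n\<close> and \<open>m\<close> are the centres of stars containing all vertices of
  \<open>D\<close> and of \<open>H\<close>, which bounds the diameters of the components by
  2.\<close>

definition frobenius_data :: "'a set \<Rightarrow> 'a set \<Rightarrow> 'a \<Rightarrow> 'a \<Rightarrow> bool" where
  "frobenius_data H D m n \<longleftrightarrow> subgroup H G \<and> subgroup D G \<and> (\<forall>g\<in>carrier G. \<forall>d\<in>D. conj g d \<in> D) \<and>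
    m \<in> H \<and> m \<noteq> \<one> \<and> (\<forall>h\<in>H. normalises h m) \<and> (\<forall>g\<in>carrier G. \<exists>d\<in>D. \<exists>h\<in>H. g = d \<otimes> h) \<and>
    n \<in> D \<and> n \<noteq> \<one> \<and> (\<forall>d\<in>D. conj d n = n) \<and> (\<forall>h\<in>H. \<forall>d\<in>D. \<not> nbr h d)"

end

locale normal_series = fin_group +
  fixes N D M :: "'a set" and r q :: nat
  assumes sol: "solvable G"
    and sN: "subgroup N G" and N1: "N \<noteq> {\<one>}" and invN: "\<And>g n. g \<in> carrier G \<Longrightarrow> n \<in> N \<Longrightarrow> conj g n \<in> N"
    and Nab: "\<And>u v. u \<in> N \<Longrightarrow> v \<in> N \<Longrightarrow> conj u v = v"
    and r: "Factorial_Ring.prime r" and Nr: "\<And>v. v \<in> N \<Longrightarrow> v [^] r = \<one>"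
    and minN: "\<And>L. subgroup L G \<Longrightarrow> L \<subseteq> N \<Longrightarrow> (\<And>g n. g \<in> carrier G \<Longrightarrow> n \<in> L \<Longrightarrow> conj g n \<in> L) \<Longrightarrow> L = {\<one>} \<or> L = N"
    and D_def: "D = {g \<in> carrier G. \<forall>n\<in>N. conj g n = n}"
    and sM: "subgroup M G" and MD: "\<not> M \<subseteq> D" and invM: "\<And>g n. g \<in> carrier G \<Longrightarrow> n \<in> M \<Longrightarrow> conj g n \<in> M"
    and MM: "\<And>a b. a \<in> M \<Longrightarrow> b \<in> M \<Longrightarrow> conj a b \<otimes> inv b \<in> D"
    and q: "Factorial_Ring.prime q" and Mq: "\<And>m. m \<in> M \<Longrightarrow> m [^] q \<in> D"
begin

section \<open>The action of \<open>M\<close> on \<open>N\<close>\<close>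

lemma carr: "n \<in> N \<Longrightarrow> n \<in> carrier G" "m \<in> M \<Longrightarrow> m \<in> carrier G" "d \<in> D \<Longrightarrow> d \<in> carrier G"
  using sN sM D_def subgroup.mem_carrier by auto

lemma DN: "d \<in> D \<Longrightarrow> n \<in> N \<Longrightarrow> conj d n = n"
  using D_def by auto

lemma DI: "g \<in> carrier G \<Longrightarrow> (\<And>n. n \<in> N \<Longrightarrow> conj g n = n) \<Longrightarrow> g \<in> D"
  using D_def by auto

lemma sD: "subgroup D G"
  unfolding D_def using carr(1) by (intro subgroup_centralizer) blast

lemma invD: assumes g: "g \<in> carrier G" and d: "d \<in> D" shows "conj g d \<in> D"
proof (rule DI)
  show "conj (conj g d) n = n" if "n \<in> N" for n
    using centralizer_invariant[of N g d n] carr(1) carr(3)[OF d] invN DN[OF d] g that by blast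
qed (use g carr(3)[OF d] in simp)

lemma ND: "N \<subseteq> D"
proof
  fix n assume "n \<in> N"
  then show "n \<in> D" using Nab carr(1) by (intro DI) simp_all
qed

lemma nonone: obtains n where "n \<in> N" "n \<noteq> \<one>"
  using N1 sN subgroup.one_closed by blast

lemma vert: "n \<in> N \<Longrightarrow> n \<noteq> \<one> \<Longrightarrow> n \<in> nvert G" "m \<in> M \<Longrightarrow> m \<noteq> \<one> \<Longrightarrow> m \<in> nvert G" "d \<in> D \<Longrightarrow> d \<noteq> \<one> \<Longrightarrow> d \<in> nvert G"
  using carr nvert_iff by auto

lemma r_dvd_card: assumes W: "subgroup W G" "W \<subseteq> N" "W \<noteq> {\<one>}" shows "r dvd card W"
proof -
  obtain w where w: "w \<in> W" "w \<noteq> \<one>" using W subgroup.one_closed by blast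
  then show ?thesis using pow_eq_one_iff[of w r "card W"] r Nr W carr subgroup_pow_card by blast
qed

lemma M_commutes_on_N:
  assumes "a \<in> M" "b \<in> M" "v \<in> N" shows "conj a (conj b v) = conj b (conj a v)"
proof -
  have e: "conj a b \<otimes> inv b \<in> D" using MM assms by auto
  have "conj a (conj b v) = conj (conj a b \<otimes> inv b) (conj b (conj a v))"
    using assms carr by (simp add: conj_def word)
  then show ?thesis using DN[OF e] invN assms carr by simp
qed

lemma subgroup_fixed:
  assumes "subgroup V G" "m \<in> carrier G" shows "subgroup {v \<in> V. conj m v = v} G"
proof (rule subgroupI)
  have Vc: "v \<in> carrier G" if "v \<in> V" for v using assms that subgroup.mem_carrier by metis
  show "{v \<in> V. conj m v = v} \<subseteq> carrier G" using Vc by auto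
  show "{v \<in> V. conj m v = v} \<noteq> {}" using assms subgroup.one_closed by (auto intro!: exI[of _ \<one>])
qed (use assms conj_fix_inv conj_fix_mult subgroup.mem_carrier[OF assms(1)] subgroup.m_closed[OF assms(1)] subgroup.m_inv_closed[OF assms(1)] in auto)

text \<open>If \<open>q = r\<close>, each element of \<open>M\<close> acts on
  \<open>r\<close>-groups with period \<open>r\<close> and so has fixed points. A minimal
  \<open>M\<close>-invariant subgroup of \<open>N\<close> is then fixed pointwise, the fixed points
  of \<open>M\<close> in \<open>N\<close> form a nontrivial normal subgroup, and minimality of
  \<open>N\<close> puts \<open>M\<close> into \<open>D\<close>.\<close>

lemma q_ne_r: "q \<noteq> r"
proof
  assume qr: "q = r"
  let ?P = "\<lambda>W. subgroup W G \<and> W \<subseteq> N \<and> W \<noteq> {\<one>} \<and> (\<forall>m\<in>M. \<forall>w\<in>W. conj m w \<in> W)"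
  have "?P N" using sN N1 invN carr by auto
  then obtain W where W: "?P W" and min: "\<And>L. ?P L \<Longrightarrow> card W \<le> card L"
    using ex_has_least_nat[of ?P N card] by blast
  have WN: "w \<in> N" if "w \<in> W" for w using W that by auto
  have fx: "conj m w = w" if m: "m \<in> M" and w: "w \<in> W" for m w
  proof -
    let ?C = "{v \<in> W. conj m v = v}"
    have "\<exists>y\<in>W. y \<noteq> \<one> \<and> conj m y = y"
    proof (rule exists_fixed_point[of _ _ r])
      show "r dvd card W" using r_dvd_card W by auto
      show "conj (m [^] r) y = y" if "y \<in> W" for y using DN Mq[OF m] qr WN that by auto
    qed (use W m carr r in auto)
    moreover have "conj k v \<in> ?C" if "k \<in> M" "v \<in> ?C" for k v
      using that W m M_commutes_on_N[OF m, of k v] by auto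
    moreover have "subgroup ?C G" using subgroup_fixed W m carr by auto
    ultimately have "?P ?C" using W by auto
    then have "card W \<le> card ?C" using min by blast
    then have "?C = W" using finite_subgroup W by (intro card_seteq) auto
    then show ?thesis using w by auto
  qed
  let ?L = "{v \<in> N. \<forall>m\<in>M. conj m v = v}"
  have "subgroup ?L G"
  proof (rule subgroupI)
    show "?L \<noteq> {}" using sN carr by (auto intro!: exI[of _ \<one>] simp: subgroup.one_closed)
  qed (use carr sN conj_fix_inv conj_fix_mult in \<open>auto simp: subgroup.m_closed subgroup.m_inv_closed\<close>)
  moreover have "conj g v \<in> ?L" if g: "g \<in> carrier G" and v: "v \<in> ?L" for g v
  proof -
    have "conj m (conj g v) = conj g v" if m: "m \<in> M" for m
    proof -
      have "conj m (conj g v) = conj g (conj (conj (inv g) m) v)"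
        using g v m carr by (simp add: conj_def word)
      also have "\<dots> = conj g v" using v invM[of "inv g" m] g m by auto
      finally show ?thesis .
    qed
    then show ?thesis using invN g v by auto
  qed
  ultimately have "?L = {\<one>} \<or> ?L = N" by (intro minN) auto
  moreover have "W \<subseteq> ?L" using fx WN by auto
  moreover obtain w where "w \<in> W" "w \<noteq> \<one>" using W subgroup.one_closed by blast
  ultimately have "?L = N" by auto
  then have "conj m v = v" if "m \<in> M" "v \<in> N" for m v using that by blast
  then have "M \<subseteq> D" using carr(2) by (intro subsetI DI) simp_all
  then show False using MD by simp
qed

text \<open>For \<open>m\<close> in \<open>M\<close> outside \<open>D\<close> the power
  \<open>m [^] t\<close> is a \<open>q\<close>-element still outside \<open>D\<close>, since
  \<open>m [^] q \<in> D\<close> and \<open>t\<close> is prime to \<open>q\<close>; it lies in a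
  conjugate of \<open>Q\<close>.\<close>

lemma sylow_not_in_D:
  assumes Q: "subgroup Q G" "Q \<subseteq> M" "card Q = q ^ a" "card M = q ^ a * t" "\<not> q dvd t"
  shows "\<not> Q \<subseteq> D"
proof
  assume QD: "Q \<subseteq> D"
  obtain m where m: "m \<in> M" "m \<notin> D" using MD by auto
  let ?y = "m [^] t"
  have yM: "?y \<in> M" using subgroup_pow_closed[OF sM] m by auto
  have mc: "m \<in> carrier G" using m carr by auto
  have yq: "?y [^] (q ^ a) = \<one>"
    using subgroup_pow_card[OF sM m(1)] Q(4) mc by (simp add: nat_pow_pow mult.commute)
  have "?y \<notin> D"
  proof
    assume y: "?y \<in> D"
    have "coprime t q" using Q(5) q by (metis coprime_commute prime_imp_coprime)
    then obtain u v where uv: "t * u = q * v + 1" using bezout_nat[of t q] Q(5) by (metis coprime_imp_gcd_eq_1 dvd_0_right)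
    have "m \<otimes> (m [^] q) [^] v = ?y [^] u"
      using mc uv by (simp add: nat_pow_pow nat_pow_Suc2[symmetric])
    moreover have "?y [^] u \<in> D" "inv ((m [^] q) [^] v) \<in> D"
      using y Mq[OF m(1)] subgroup_pow_closed[OF sD] sD by (auto simp: subgroup.m_inv_closed)
    ultimately have "m \<otimes> (m [^] q) [^] v \<otimes> inv ((m [^] q) [^] v) \<in> D" using sD subgroup.m_closed by metis
    then show False using m mc by (simp add: m_assoc)
  qed
  let ?A = "generate G {?y}"
  have A: "subgroup ?A G" "?A \<subseteq> M"
    using generate_is_subgroup[of "{?y}"] generate_subgroup_incl[of "{?y}" M] sM yM mc by auto
  have "ord ?y dvd q ^ a" using yq pow_eq_id mc by auto
  then obtain b where "ord ?y = q ^ b" using q divides_primepow_nat by blast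
  then have cA: "card ?A = q ^ b" using generate_pow_card mc by simp
  obtain d where d: "d \<in> M" "?A \<subseteq> conj d ` Q"
    using sylow_conjugate[OF sM Q(1-4) q Q(5) A cA] by auto
  have "?y \<in> ?A" by (rule generate.incl) simp
  then have "?y \<in> conj d ` Q" using d by auto
  then have "?y \<in> D" using QD invD d carr by auto
  then show False using \<open>?y \<notin> D\<close> by simp
qed

section \<open>Three kinds of vertices\<close>

definition full :: "'a \<Rightarrow> bool" where "full x \<longleftrightarrow> (\<forall>n\<in>N. n \<noteq> \<one> \<longrightarrow> walk_le 3 x n)"

text \<open>The condition \<open>w \<notin> D\<close> on the whole list says that \<open>a\<close>
  and \<open>b\<close> generate a group of rank two meeting \<open>D\<close> trivially. All
  \<open>w\<close> are within distance 2, so whichever of them has a fixed point on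
  \<open>N\<close>, that point is within distance 3.\<close>

definition rank2 :: "'a \<Rightarrow> bool" where
  "rank2 x \<longleftrightarrow> (\<exists>a b. a \<in> M \<and> b \<in> M \<and> a [^] q = \<one> \<and> b [^] q = \<one> \<and> conj a b = b \<and>
    (\<forall>w\<in>insert a {b \<otimes> a [^] i | i::nat. True}. w \<notin> D \<and> walk_le 2 x w))"

definition self_centralizing :: "'a \<Rightarrow> bool" where
  "self_centralizing m \<longleftrightarrow> m \<in> M \<and> m \<notin> D \<and> m [^] q = \<one> \<and> (\<forall>d\<in>D. conj m d = d \<longrightarrow> d = \<one>) \<and>
    (\<forall>b\<in>M. conj m b = b \<longrightarrow> (\<exists>k::nat. b = m [^] k))"

lemma nbr_DN: "d \<in> D \<Longrightarrow> d \<noteq> \<one> \<Longrightarrow> n \<in> N \<Longrightarrow> n \<noteq> \<one> \<Longrightarrow> nbr d n"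
  by (rule nbr_commI) (auto simp: vert DN)

lemma full_if_near_D:
  assumes "nbr x y" "nbr y d" "d \<in> D" "d \<noteq> \<one>" shows "full x"
  unfolding full_def using assms nbr_DN walk_le_3 by blast

text \<open>The elements \<open>m [^] q\<close>, \<open>b [^] q\<close> and the commutator of
  \<open>m\<close> and \<open>b\<close> lie in \<open>D\<close> and are fixed by \<open>c\<close>,
  hence are trivial.\<close>

lemma rank2I:
  assumes x: "nbr x c" and c: "c \<in> carrier G" and fpf: "\<And>d. d \<in> D \<Longrightarrow> conj c d = d \<Longrightarrow> d = \<one>"
    and m: "m \<in> M" "m \<noteq> \<one>" "conj c m = m" and b: "b \<in> M" "conj c b = b" "\<nexists>k::nat. b = m [^] k"
  shows "rank2 x"
  unfolding rank2_def
proof (intro exI conjI ballI)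
  show "m \<in> M" "b \<in> M" using m b by auto
  show "m [^] q = \<one>" "b [^] q = \<one>" using fpf Mq m b c conj_fix_pow carr by auto
  have "conj m b \<otimes> inv b = \<one>"
    using fpf MM[OF m(1) b(1)] conj_fix_mult conj_fix_inv conj_fix_conj m b c carr by simp
  then show "conj m b = b" using m b carr by (metis conj_closed inv_closed inv_equality inv_inv)
  fix w assume w: "w \<in> insert m {b \<otimes> m [^] i | i::nat. True}"
  have w1: "w \<noteq> \<one>"
  proof
    assume "w = \<one>"
    then obtain i::nat where i: "b \<otimes> m [^] i = \<one>" using w m by auto
    then have "b = inv (m [^] i)" using m b carr by (metis inv_equality nat_pow_closed)
    also have "\<exists>k::nat. inv (m [^] i) = m [^] k"
      using inv_eq_pow[of "m [^] i"] m carr by (auto simp: nat_pow_pow)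
    finally show False using b(3) by simp
  qed
  have wc: "conj c w = w" "w \<in> carrier G" using w m b c carr by (auto simp: conj_fix_mult conj_fix_pow)
  then show "w \<notin> D" using fpf w1 by auto
  have "nbr c w" using x wc w1 by (intro nbr_commI) (auto simp: nvert_iff nbr_def)
  then show "walk_le 2 x w" using walk_le_2 x by blast
qed

text \<open>\<open>x0\<close> is replaced by a power \<open>x\<close> of prime order, one step away.
  Unless \<open>x\<close> reaches \<open>D\<close> directly, it acts freely on \<open>D\<close>, and
  the centraliser of \<open>x\<close> in \<open>M\<close> decides: noncyclic gives
  \<open>rank2\<close>, and cyclic gives a subgroup normalised by \<open>x0\<close>.\<close>

lemma classification:
  assumes x0: "x0 \<in> nvert G"
  shows "full x0 \<or> rank2 x0 \<or> (\<exists>m. self_centralizing m \<and> normalises x0 m)"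
proof -
  have x0c: "x0 \<in> carrier G" "x0 \<noteq> \<one>" using x0 nvert_iff by auto
  obtain k p where p: "Factorial_Ring.prime (p::nat)" "x0 [^] (k::nat) \<noteq> \<one>" "(x0 [^] k) [^] p = \<one>"
    using prime_pow_exists[OF x0c] by auto
  define x where "x = x0 [^] k"
  have x: "x \<in> carrier G" "x \<noteq> \<one>" "x [^] p = \<one>" using p x0c x_def by auto
  have xx: "nbr x0 x" using nbr_pow x0c p x_def by auto
  have xv: "x \<in> nvert G" using x nvert_iff by auto
  show ?thesis
  proof (cases "\<exists>n\<in>N. n \<noteq> \<one> \<and> normalises x n")
    case True
    then obtain n where n: "n \<in> N" "n \<noteq> \<one>" "normalises x n" by auto
    then have "nbr x n" using xv vert by (auto simp: nbr_def)
    then show ?thesis using full_if_near_D[OF xx] n ND by auto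
  next
    case noN: False
    show ?thesis
    proof (cases "\<exists>d\<in>D. d \<noteq> \<one> \<and> conj x d = d")
      case True
      then show ?thesis using full_if_near_D[OF xx nbr_commI] xv vert by blast
    next
      case noD: False
      then have fpD: "d = \<one>" if "d \<in> D" "conj x d = d" for d using that by auto
      \<comment> \<open>If \<open>p\<close> does not divide \<open>card M\<close>, a free action of
        \<open>x\<close> on an invariant Sylow \<open>q\<close>-subgroup would make that subgroup
        trivial on \<open>N\<close>, contradicting \<open>sylow_not_in_D\<close>.\<close>
      have "\<exists>m\<in>M. m \<noteq> \<one> \<and> conj x m = m"
      proof (cases "p dvd card M")
        case True
        show ?thesis
          by (rule exists_fixed_point[OF sM x(1) _ p(1)]) (use True x invM carr in auto)
      next
        case False
        have "conj x ` M \<subseteq> M" using invM x by auto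
        then obtain Q a t where Q: "subgroup Q G" "Q \<subseteq> M" "card Q = q ^ a" "card M = q ^ a * t" "\<not> q dvd t"
          and Qx: "conj x ` Q \<subseteq> Q"
          using invariant_sylow[OF sM x(1,3) p(1) _ False q] by blast
        show ?thesis
        proof (rule ccontr)
          assume no: "\<not> ?thesis"
          have "conj b v = v" if v: "v \<in> N" and b: "b \<in> Q" for b v
          proof (rule frobenius_action_trivial[OF sN Nab Nr _ Q(1) _ x(1,3) p(1) _ Qx _ _ v b])
            have "coprime r q" using r q q_ne_r primes_coprime by blast
            then show "coprime r (card Q)" using Q(3) by simp
            fix w assume "w \<in> N" "conj x w = w"
            then show "w = \<one>" using fpD ND by auto
          next
            fix c assume "c \<in> Q" "conj x c = c"
            then show "c = \<one>" using no Q(2) by auto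
          next
            fix c assume "c \<in> Q"
            then show "conj c ` N \<subseteq> N" using invN Q(2) carr by auto
          next
            show "conj x ` N \<subseteq> N" using invN x by auto
          qed
          then have "Q \<subseteq> D" using Q(2) carr(2) by (intro subsetI DI) (auto simp: subset_iff)
          then show False using sylow_not_in_D[OF Q] by simp
        qed
      qed
      then obtain m where m: "m \<in> M" "m \<noteq> \<one>" "conj x m = m" by auto
      have mc: "m \<in> carrier G" using m carr by auto
      show ?thesis
      proof (cases "\<exists>b\<in>M. conj x b = b \<and> (\<nexists>k::nat. b = m [^] k)")
        case True
        then show ?thesis using rank2I[OF xx x(1) fpD m] by blast
      next
        case noM: False
        \<comment> \<open>\<open>x0\<close> commutes with its power \<open>x\<close>, so it
          preserves the centraliser of \<open>x\<close> in \<open>M\<close>, which here consists of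
          powers of \<open>m\<close>.\<close>
        have "conj x0 m \<in> M" using invM m x0c by auto
        moreover have "conj x (conj x0 m) = conj x0 m"
        proof -
          have xx0: "x \<otimes> x0 = x0 \<otimes> x" using x0c unfolding x_def using nat_pow_comm[of x0 k 1] by simp
          have "conj x (conj x0 m) = conj (x \<otimes> x0) m" using x x0c mc by (intro conj_conj)
          also have "\<dots> = conj x0 (conj x m)" unfolding xx0 using x x0c mc by (intro conj_conj[symmetric])
          finally show ?thesis using m(3) by simp
        qed
        ultimately have nzm: "normalises x0 m" using noM unfolding normalises_def by blast
        then have xm: "nbr x0 m" using x0 vert m by (auto simp: nbr_def)
        \<comment> \<open>The case distinction is repeated with \<open>m\<close>, a neighbour of
          \<open>x0\<close>, in place of \<open>x\<close>.\<close>
        show ?thesis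
        proof (cases "\<exists>d\<in>D. d \<noteq> \<one> \<and> conj m d = d")
          case True
          then show ?thesis using full_if_near_D[OF xm nbr_commI] vert m by blast
        next
          case False
          then have fpm: "d = \<one>" if "d \<in> D" "conj m d = d" for d using that by auto
          show ?thesis
          proof (cases "\<exists>b\<in>M. conj m b = b \<and> (\<nexists>k::nat. b = m [^] k)")
            case True
            then show ?thesis using rank2I[OF xm mc fpm m(1,2)] mc by (auto simp: conj_fix)
          next
            case False
            have "m \<notin> D" using fpD m by auto
            moreover have "m [^] q = \<one>" using fpD[OF Mq[OF m(1)]] conj_fix_pow x m mc by auto
            ultimately have "self_centralizing m" using m fpm False unfolding self_centralizing_def by blast
            then show ?thesis using nzm by blast
          qed
        qed
      qed
    qed
  qed
qed

text \<open>Stated for any \<open>M\<close>-invariant \<open>V\<close>, so that it applies a second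
  time to the fixed points of one element.\<close>

lemma rank2_fixed:
  assumes "rank2 x" and V: "subgroup V G" "V \<subseteq> N" "V \<noteq> {\<one>}" "\<And>m v. m \<in> M \<Longrightarrow> v \<in> V \<Longrightarrow> conj m v \<in> V"
  shows "\<exists>w\<in>M. w \<noteq> \<one> \<and> walk_le 2 x w \<and> (\<exists>v\<in>V. v \<noteq> \<one> \<and> conj w v = v)"
proof -
  obtain a b where ab: "a \<in> M" "b \<in> M" "a [^] q = \<one>" "b [^] q = \<one>" "conj a b = b"
    and w: "\<And>w. w \<in> insert a {b \<otimes> a [^] i | i::nat. True} \<Longrightarrow> w \<notin> D \<and> walk_le 2 x w"
    using assms(1) unfolding rank2_def by blast
  have "\<exists>w \<in> insert a {b \<otimes> a [^] i | i::nat. True}. \<exists>v\<in>V. v \<noteq> \<one> \<and> conj w v = v"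
  proof (rule rank_two_fixed_point[OF V(1) _ V(3) _ _ q])
    show "coprime r q" using r q q_ne_r primes_coprime by blast
    show "conj u v = v" if "u \<in> V" "v \<in> V" for u v using Nab V(2) that by blast
    show "v [^] r = \<one>" if "v \<in> V" for v using Nr V(2) that by blast
    show "conj a ` V \<subseteq> V" "conj b ` V \<subseteq> V" using V(4) ab(1,2) by blast+
  qed (use ab carr(2) in simp_all)
  then obtain c v where c: "c \<in> insert a {b \<otimes> a [^] i | i::nat. True}" "v \<in> V" "v \<noteq> \<one>" "conj c v = v" by blast
  have "c \<in> M" using c(1) ab subgroup_pow_closed[OF sM] sM by (auto simp: subgroup.m_closed)
  moreover have "c \<noteq> \<one>" using w[OF c(1)] sD subgroup.one_closed by auto
  ultimately show ?thesis using w[OF c(1)] c by blast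
qed

lemma walk_le_3_via:
  assumes "walk_le 2 x w" "w \<in> M" "w \<noteq> \<one>" "v \<in> N" "v \<noteq> \<one>" "conj w v = v" shows "walk_le 3 x v"
proof -
  have "nbr w v" using assms vert by (intro nbr_commI) auto
  then show ?thesis using walk_le_trans[OF assms(1), of 1 v] walk_le_1 by simp
qed

lemma rank2_near: "rank2 x \<Longrightarrow> \<exists>v\<in>N. v \<noteq> \<one> \<and> walk_le 3 x v"
  using rank2_fixed[of x N] sN N1 invN carr walk_le_3_via by (metis order_refl)

text \<open>\<open>M\<close> acts on \<open>N\<close> as an abelian group, so the fixed points of
  \<open>w\<close> are \<open>M\<close>-invariant. The rank two group near \<open>y\<close> has an
  element fixing one of them, and this point is near both \<open>x\<close> and
  \<open>y\<close>.\<close>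

lemma rank2_rank2:
  assumes "rank2 x" "rank2 y" shows "\<exists>v\<in>N. v \<noteq> \<one> \<and> walk_le 3 x v \<and> walk_le 3 y v"
proof -
  obtain w u where w: "w \<in> M" "w \<noteq> \<one>" "walk_le 2 x w" "u \<in> N" "u \<noteq> \<one>" "conj w u = u"
    using rank2_fixed[OF assms(1) sN order_refl N1] invN carr by blast
  let ?V = "{v \<in> N. conj w v = v}"
  have "\<exists>w'\<in>M. w' \<noteq> \<one> \<and> walk_le 2 y w' \<and> (\<exists>v\<in>?V. v \<noteq> \<one> \<and> conj w' v = v)"
  proof (rule rank2_fixed[OF assms(2)])
    show "subgroup ?V G" using subgroup_fixed sN w carr by auto
    show "?V \<noteq> {\<one>}" using w by auto
    fix m v assume "m \<in> M" "v \<in> ?V"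
    then show "conj m v \<in> ?V" using M_commutes_on_N[of w m v] w invN carr by auto
  qed auto
  then obtain w' v where "w' \<in> M" "w' \<noteq> \<one>" "walk_le 2 y w'" "v \<in> N" "conj w v = v" "v \<noteq> \<one>" "conj w' v = v" by auto
  then show ?thesis using walk_le_3_via w by blast
qed

lemma walk_le_6: "walk_le 3 x v \<Longrightarrow> walk_le 3 y v \<Longrightarrow> walk_le 6 x y"
  using walk_le_trans[of 3 x v 3 y] walk_le_sym by simp

lemma diameter_no_self_centralizing:
  assumes "\<nexists>m. self_centralizing m" "x \<in> nvert G" "y \<in> nvert G" shows "walk_le 6 x y"
proof -
  obtain n where n: "n \<in> N" "n \<noteq> \<one>" using nonone by auto
  have "full x \<or> rank2 x" "full y \<or> rank2 y" using classification assms by blast+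
  then have "\<exists>v. walk_le 3 x v \<and> walk_le 3 y v"
    using n rank2_rank2 rank2_near unfolding full_def by metis
  then show ?thesis using walk_le_6 by blast
qed

section \<open>The case of a self-centralising element of \<open>M\<close>\<close>

context
  fixes m assumes sc: "self_centralizing m"
begin

lemma m: "m \<in> M" "m \<notin> D" "m [^] q = \<one>" "\<And>d. d \<in> D \<Longrightarrow> conj m d = d \<Longrightarrow> d = \<one>"
  "\<And>b. b \<in> M \<Longrightarrow> conj m b = b \<Longrightarrow> \<exists>k::nat. b = m [^] k" "m \<in> carrier G" "m \<noteq> \<one>"
proof -
  show "m \<noteq> \<one>" using sc sD unfolding self_centralizing_def by (metis subgroup.one_closed)
qed (use sc carr in \<open>auto simp: self_centralizing_def\<close>)

text \<open>A Frattini argument: \<open>conj b m\<close> lies in the coset of \<open>m\<close>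
  modulo \<open>D \<inter> M\<close>, so it equals \<open>conj d m\<close> for some \<open>d\<close>
  there, and \<open>inv d \<otimes> b\<close> centralises \<open>m\<close>.\<close>

lemma M_decomp: assumes b: "b \<in> M" shows "\<exists>d\<in>D. \<exists>k::nat. b = d \<otimes> m [^] k"
proof -
  let ?E = "D \<inter> M"
  have E: "subgroup ?E G" using sD sM subgroups_Inter_pair by blast
  have e: "conj b m \<otimes> inv m \<in> ?E"
    using MM[OF b m(1)] invM b m(1) sM carr by (auto simp: subgroup.m_closed subgroup.m_inv_closed)
  have "\<exists>d\<in>?E. (conj b m \<otimes> inv m) \<otimes> m = conj d m"
    by (rule fpf_conj_surj[OF E m(6) _ _ e]) (use invD invM m in auto)
  then obtain d where d: "d \<in> ?E" "conj b m = conj d m" using b m carr by (auto simp: m_assoc)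
  have dc: "d \<in> carrier G" using d carr by auto
  have bc: "b \<in> carrier G" using b carr by auto
  have "conj (inv d \<otimes> b) m = m" using d(2) dc bc m by (simp flip: conj_conj)
  then have "conj m (inv d \<otimes> b) = inv d \<otimes> b" using conj_fix_sym dc bc m by simp
  moreover have "inv d \<otimes> b \<in> M" using d b sM by (simp add: subgroup.m_closed subgroup.m_inv_closed)
  ultimately obtain k::nat where "inv d \<otimes> b = m [^] k" using m(5) by blast
  then have "d \<otimes> (inv d \<otimes> b) = d \<otimes> m [^] k" by simp
  then have "b = d \<otimes> m [^] k" using dc bc by simp
  then show ?thesis using d by blast
qed

lemma m_root: assumes "m [^] (i::nat) \<noteq> \<one>" shows "\<exists>j::nat. (m [^] i) [^] j = m"
proof -
  have "\<not> q dvd i" using pow_eq_one_iff[OF m(6,7) q m(3)] assms by simp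
  then have "coprime i q" using q by (metis coprime_commute prime_imp_coprime)
  then show ?thesis using pow_root m by auto
qed

text \<open>A nontrivial power of \<open>m\<close> has \<open>m\<close> among its own powers, so it
  acts on \<open>D\<close> as freely as \<open>m\<close> and \<open>fpf_conj_surj\<close> applies to
  it.\<close>

lemma M_conj:
  assumes b: "b \<in> M" "b \<notin> D"
  shows "\<exists>d\<in>D. \<exists>i::nat. b = conj d (m [^] i) \<and> m [^] i \<noteq> \<one>"
proof -
  obtain e and i::nat where e: "e \<in> D" "b = e \<otimes> m [^] i" using M_decomp b by blast
  have i1: "m [^] i \<noteq> \<one>" using e b carr by auto
  then obtain j::nat where j: "(m [^] i) [^] j = m" using m_root by auto
  have "\<exists>d\<in>D. e \<otimes> m [^] i = conj d (m [^] i)"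
  proof (rule fpf_conj_surj[OF sD _ _ _ e(1)])
    fix d assume d: "d \<in> D" "conj (m [^] i) d = d"
    then have "conj ((m [^] i) [^] j) d = d" using pow_fix carr m by blast
    then show "d = \<one>" using j m d by simp
  qed (use m invD in auto)
  then show ?thesis using e i1 by blast
qed

text \<open>\<open>conj g m\<close> lies in \<open>M\<close> outside \<open>D\<close>, hence is
  conjugate under \<open>D\<close> to a power of \<open>m\<close>.\<close>

lemma frattini: assumes g: "g \<in> carrier G" shows "\<exists>d\<in>D. \<exists>h. normalises h m \<and> h \<in> carrier G \<and> g = d \<otimes> h"
proof -
  have "conj g m \<notin> D"
  proof
    assume "conj g m \<in> D"
    then have "conj (inv g) (conj g m) \<in> D" using invD g by blast
    then show False using g m by simp
  qed
  then obtain d and i::nat where d: "d \<in> D" "conj g m = conj d (m [^] i)" using M_conj invM g m by blast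
  have "conj (inv d \<otimes> g) m = m [^] i" using d carr g m by (simp flip: conj_conj)
  then have "normalises (inv d \<otimes> g) m" using normalises_def by auto
  moreover have "g = d \<otimes> (inv d \<otimes> g)" using d carr g by simp
  ultimately show ?thesis using d carr g by (metis inv_closed m_closed)
qed

text \<open>The groups generated by self-centralising elements are all conjugate under
  \<open>D\<close>, so one fixed \<open>m\<close> serves every vertex.\<close>

lemma normalises_transfer:
  assumes "self_centralizing m'" "normalises x m'" "x \<in> carrier G"
  shows "\<exists>d\<in>D. normalises (conj (inv d) x) m"
proof -
  have m': "m' \<in> M" "m' \<notin> D" "m' \<in> carrier G" using assms carr self_centralizing_def by auto
  obtain d and i::nat where d: "d \<in> D" "m' = conj d (m [^] i)" "m [^] i \<noteq> \<one>" using M_conj[OF m'(1,2)] by blast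
  then obtain j::nat where j: "(m [^] i) [^] j = m" using m_root by auto
  have "m' [^] j = conj d m" using d carr m j conj_pow[of d "m [^] i" j] by simp
  then have "normalises x (conj d m)" using normalises_pow_right[OF assms(3) m'(3) assms(2), of j] by simp
  then have "normalises (conj (inv d) x) (conj (inv d) (conj d m))"
    using normalises_conj[of "inv d" x "conj d m"] assms(3) d carr m by simp
  then show ?thesis using d carr m by auto
qed

lemma no_rank2: "\<not> rank2 x"
proof
  assume "rank2 x"
  then obtain a b where ab: "a \<in> M" "b \<in> M"
    and w: "\<And>w. w \<in> insert a {b \<otimes> a [^] i | i::nat. True} \<Longrightarrow> w \<notin> D"
    unfolding rank2_def by blast
  obtain d and i::nat where a: "d \<in> D" "a = d \<otimes> m [^] i" using M_decomp ab by blast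
  obtain e and j::nat where b: "e \<in> D" "b = e \<otimes> m [^] j" using M_decomp ab by blast
  have "m [^] i \<noteq> \<one>" using w[of a] a carr by auto
  then have "\<not> q dvd i" using pow_eq_one_iff[OF m(6,7) q m(3)] by simp
  then have "coprime i q" using q by (metis coprime_commute prime_imp_coprime)
  \<comment> \<open>\<open>(q - 1) * j\<close> stands for minus \<open>j\<close> modulo
    \<open>q\<close>: this \<open>k\<close> puts \<open>b \<otimes> a [^] k\<close> into
    \<open>D\<close>, which \<open>rank2\<close> forbids.\<close>
  then obtain k where k: "[i * k = (q - 1) * j] (mod q)"
    using cong_solve_coprime_nat[of i q] by (metis cong_mult_rcancel_nat cong_scalar_right mult.assoc mult.left_neutral One_nat_def)
  have pw: "\<exists>f\<in>D. a [^] n = f \<otimes> m [^] (i * n)" for n :: nat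
  proof (induction n)
    case 0
    then show ?case using sD by (intro bexI[of _ \<one>]) (auto simp: subgroup.one_closed)
  next
    case (Suc n)
    then obtain f where f: "f \<in> D" "a [^] n = f \<otimes> m [^] (i * n)" by auto
    have "a [^] Suc n = f \<otimes> conj (m [^] (i * n)) d \<otimes> (m [^] (i * n) \<otimes> m [^] i)"
      using f a carr m by (simp add: conj_def word)
    also have "m [^] (i * n) \<otimes> m [^] i = m [^] (i * Suc n)" using m by (simp add: nat_pow_mult add.commute)
    finally show ?case using f invD a m sD by (metis nat_pow_closed subgroup.m_closed)
  qed
  obtain f where f: "f \<in> D" "a [^] k = f \<otimes> m [^] (i * k)" using pw by blast
  have "[j + i * k = j + (q - 1) * j] (mod q)" using k by (simp add: cong_add_lcancel_nat)
  also have "j + (q - 1) * j = q * j" using prime_gt_0_nat[OF q] by (cases q) auto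
  also have "[q * j = 0] (mod q)" by (simp add: cong_def)
  finally have "m [^] (j + i * k) = m [^] (0::nat)" using pow_cong m by blast
  then have mm: "m [^] j \<otimes> m [^] (i * k) = \<one>" using m by (simp add: nat_pow_mult)
  have "b \<otimes> a [^] k = e \<otimes> conj (m [^] j) f \<otimes> (m [^] j \<otimes> m [^] (i * k))"
    using f b carr m by (simp add: conj_def word)
  also have "\<dots> = e \<otimes> conj (m [^] j) f" unfolding mm using f b carr m by simp
  finally have "b \<otimes> a [^] k \<in> D" using f b invD m sD by (metis nat_pow_closed subgroup.m_closed)
  then show False using w by blast
qed

definition H where "H = {g \<in> carrier G. normalises g m}"

lemma sH: "subgroup H G" unfolding H_def by (rule subgroup_normalises[OF m(6)])

lemma vertex_cases:
  assumes "x \<in> nvert G" shows "full x \<or> (\<exists>d\<in>D. conj (inv d) x \<in> H)"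
proof -
  have xc: "x \<in> carrier G" using assms nvert_iff by auto
  show ?thesis using classification[OF assms] no_rank2 normalises_transfer xc carr unfolding H_def by fastforce
qed

text \<open>\<open>D\<close> fixes \<open>N\<close> pointwise: conjugating a path from
  \<open>conj (inv d) x\<close> to \<open>n\<close> by \<open>d\<close> moves its start to
  \<open>x\<close> and keeps its end.\<close>

lemma walk_le_3_via_H:
  assumes x: "x \<in> nvert G" and d: "d \<in> D" "conj (inv d) x \<in> H"
    and a: "a \<in> nvert G" "normalises (conj (inv d) x) a" and b: "nbr a b" and n: "n \<in> N" and bn: "nbr b n"
  shows "walk_le 3 x n"
proof -
  have c: "d \<in> carrier G" "x \<in> carrier G" "a \<in> carrier G" "b \<in> carrier G" "n \<in> carrier G"
    using d carr x a b bn by (auto simp: nvert_iff nbr_def)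
  have cv: "conj d y \<in> nvert G" if "y \<in> nvert G" for y using that c conj_eq_one by (auto simp: nvert_iff)
  have cn: "nbr (conj d y) (conj d z)" if "nbr y z" for y z
    using that cv normalises_conj[of d] c unfolding nbr_def nvert_iff by blast
  have "normalises x (conj d a)" using normalises_conj[of d "conj (inv d) x" a] a c by simp
  then have "nbr x (conj d a)" using x cv a by (auto simp: nbr_def)
  moreover have "nbr (conj d b) n" using cn[OF bn] DN[OF d(1) n] by simp
  ultimately show ?thesis using walk_le_3 cn b by blast
qed

lemma all_near:
  assumes "n \<in> N" "n \<noteq> \<one>" and "\<And>x d. \<lbrakk>x \<in> nvert G; d \<in> D; conj (inv d) x \<in> H\<rbrakk> \<Longrightarrow> walk_le 3 x n"
    and "x \<in> nvert G" "y \<in> nvert G"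
  shows "walk_le 6 x y"
proof -
  have "walk_le 3 z n" if z: "z \<in> nvert G" for z
    using vertex_cases[OF z] assms(1,2) assms(3)[OF z] unfolding full_def by auto
  then show ?thesis using walk_le_6 assms(4,5) by blast
qed

lemma diameter_or_frobenius:
  "(\<forall>x\<in>nvert G. \<forall>y\<in>nvert G. walk_le 6 x y) \<or> (\<exists>n. frobenius_data H D m n)"
proof (cases "\<exists>h\<in>H. \<exists>n\<in>N. h \<noteq> \<one> \<and> n \<noteq> \<one> \<and> normalises h n")
  case True
  then obtain h n where h: "h \<in> H" "n \<in> N" "h \<noteq> \<one>" "n \<noteq> \<one>" "normalises h n" by auto
  have hv: "h \<in> nvert G" "n \<in> nvert G" "m \<in> nvert G" using h vert m nvert_iff H_def by auto
  \<comment> \<open>Up to conjugation by \<open>d\<close> the path is \<open>x - m - h - n\<close>: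
    everything in \<open>H\<close> normalises the group generated by \<open>m\<close>.\<close>
  have "walk_le 3 x n" if "x \<in> nvert G" "d \<in> D" "conj (inv d) x \<in> H" for x d
    by (rule walk_le_3_via_H[OF that, of m h]) (use hv h that in \<open>auto simp: nbr_def H_def\<close>)
  then show ?thesis using all_near[OF h(2,4)] by blast
next
  case False
  then have no: "n = \<one>" if "h \<in> H" "n \<in> N" "h \<noteq> \<one>" "normalises h n" for h n using that by blast
  have Hc: "h \<in> carrier G" if "h \<in> H" for h using that H_def by auto
  have Hcl: "x \<otimes> y \<in> H" if "x \<in> H" "y \<in> H" for x y using sH that subgroup.m_closed by metis
  have nofix: "n = \<one>" if "h \<in> H" "n \<in> N" "h \<noteq> \<one>" "conj h n = n" for h n
    using no that Hc carr normalises_comm by blast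
  obtain n0 where n0: "n0 \<in> N" "n0 \<noteq> \<one>" using nonone by auto
  have HD: "h = \<one>" if "h \<in> H" "h \<in> D" for h using nofix[of h n0] that DN n0 by blast
  have orderr: "l \<noteq> r" if l: "Factorial_Ring.prime l" "x \<in> H" "x \<noteq> \<one>" "x [^] l = \<one>" for l x
  proof
    assume "l = r"
    then have "\<exists>y\<in>N. y \<noteq> \<one> \<and> conj x y = y"
      using l Hc carr invN r_dvd_card[OF sN order_refl N1] by (intro exists_fixed_point[OF sN _ _ r]) auto
    then show False using nofix l by blast
  qed
  \<comment> \<open>A fixed-point-free involution inverts \<open>N\<close>, since
    \<open>n0 \<otimes> conj x n0\<close> is fixed, and so would normalise a cyclic subgroup of
    \<open>N\<close>.\<close>
  have odd: "odd (card H)"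
  proof
    assume "even (card H)"
    then obtain x where x: "x \<in> H" "x \<noteq> \<one>" "x [^] (2::nat) = \<one>" using cauchy[OF sH two_is_prime_nat] by auto
    have xx: "conj x (conj x n0) = n0" using conj_conj[of x x n0] x Hc n0 carr by (simp add: numeral_2_eq_2)
    let ?u = "n0 \<otimes> conj x n0"
    have n0': "conj x n0 \<in> N" using invN x Hc n0 by auto
    have uN: "?u \<in> N" using sN n0 n0' by (simp add: subgroup.m_closed)
    have "conj x ?u = conj x n0 \<otimes> n0" using xx x Hc n0 carr conj_mult[of x n0 "conj x n0"] by simp
    also have "\<dots> = ?u" using Nab[OF n0(1) n0'] conj_fix n0 n0' carr by metis
    finally have "?u = \<one>" using nofix uN x by blast
    then have "conj x n0 = inv n0" using n0 n0' carr by (metis inv_equality inv_inv inv_closed)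
    then have "normalises x n0" unfolding normalises_def using inv_eq_pow n0 carr by auto
    then show False using no x n0 by blast
  qed
  \<comment> \<open>The free action on \<open>N\<close> provides both hypotheses of
    \<open>prime_subgroups_normal\<close>: independent commuting elements of equal prime order are
    excluded by \<open>rank_two_fixed_point\<close>, and a nontrivial action of \<open>y\<close> on
    the group of \<open>z\<close> would make \<open>z\<close> trivial on \<open>N\<close> by
    \<open>frobenius_action_trivial\<close>.\<close>
  have normal: "normalises g h" if "h \<in> H" "h \<noteq> \<one>" "h [^] l = \<one>" "Factorial_Ring.prime (l::nat)" "g \<in> H" for h l g
  proof (rule prime_subgroups_normal[OF sol sH odd _ _ that])
    fix l x u
    assume a: "Factorial_Ring.prime (l::nat)" "x \<in> H" "x \<noteq> \<one>" "x [^] l = \<one>" "u \<in> H" "u [^] l = \<one>" "conj x u = u"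
    have "coprime r l" using r a(1) orderr[OF a(1-4)] primes_coprime by blast
    then have "\<exists>w \<in> insert x {u \<otimes> x [^] i | i::nat. True}. \<exists>v\<in>N. v \<noteq> \<one> \<and> conj w v = v"
      using Hc invN a Nab Nr N1 by (intro rank_two_fixed_point[OF sN _ _ _ _ a(1)]) auto
    then obtain w v where w: "w \<in> insert x {u \<otimes> x [^] i | i::nat. True}" "v \<in> N" "v \<noteq> \<one>" "conj w v = v" by auto
    have "w \<in> H" using w(1) a Hcl subgroup_pow_closed[OF sH] by auto
    then have "w = \<one>" using nofix w by blast
    then obtain i::nat where "u \<otimes> x [^] i = \<one>" using w a by auto
    then have "u = inv (x [^] i)" using a Hc by (metis inv_equality nat_pow_closed)
    then show "\<exists>k::nat. u = x [^] k" using inv_eq_pow[of "x [^] i"] a Hc by (auto simp: nat_pow_pow)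
  next
    fix l s y z
    assume a: "Factorial_Ring.prime (l::nat)" "Factorial_Ring.prime (s::nat)" "y \<in> H" "y [^] l = \<one>" "z \<in> H" "z [^] s = \<one>" "normalises y z"
    show "conj y z = z"
    proof (rule ccontr)
      assume ne: "conj y z \<noteq> z"
      then have y1: "y \<noteq> \<one>" "z \<noteq> \<one>" using a Hc by auto
      let ?Q = "generate G {z}"
      have zc: "z \<in> carrier G" "y \<in> carrier G" using a Hc by auto
      have Qel: "?Q = {z [^] n | n::nat. True}" using mem_generate_single zc by auto
      have "ord z dvd s" using a(6) pow_eq_id zc by auto
      then have "ord z = s" using a(2) y1 ord_eq_1 zc by (metis prime_nat_iff)
      then have cQ: "card ?Q = s" using generate_pow_card zc by simp
      have "conj z n0 = n0"
      proof (rule frobenius_action_trivial[OF sN Nab Nr _ _ _ zc(2) a(4,1) _ _ _ _ n0(1)])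
        show "coprime r (card ?Q)" using r a orderr[of s z] y1 primes_coprime cQ by metis
        show "subgroup ?Q G" using generate_is_subgroup zc by auto
        show "z \<in> ?Q" by (rule generate.incl) simp
        show "conj y ` N \<subseteq> N" using invN zc by auto
        obtain i::nat where i: "conj y z = z [^] i" using a normalises_def by auto
        have "conj y (z [^] n) = z [^] (i * n)" for n :: nat
          using conj_pow[OF zc(2,1), of n] i nat_pow_pow[OF zc(1), of i n] by simp
        then show "conj y ` ?Q \<subseteq> ?Q" unfolding Qel by blast
        show "conj c ` N \<subseteq> N" if c: "c \<in> ?Q" for c
        proof -
          obtain n::nat where "c = z [^] n" using c Qel by blast
          then show ?thesis using invN zc(1) by blast
        qed
        show "v = \<one>" if "v \<in> N" "conj y v = v" for v using nofix that y1 a by blast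
        fix c assume c: "c \<in> ?Q" "conj y c = c"
        then obtain n::nat where n: "c = z [^] n" using Qel by auto
        show "c = \<one>"
        proof (rule ccontr)
          assume "c \<noteq> \<one>"
          then have "\<not> s dvd n" using pow_eq_one_iff[OF zc(1) y1(2) a(2,6)] n by simp
          then have "coprime n s" using a(2) by (metis coprime_commute prime_imp_coprime)
          then obtain j::nat where "c [^] j = z" using pow_root[OF zc(1) a(6)] n by auto
          then have "conj y z = z" using conj_fix_pow[of y c j] c(2) zc n by auto
          then show False using ne by simp
        qed
      qed
      then show False using nofix a(5) y1(2) n0 by blast
    qed
  qed
  show ?thesis
  proof (cases "\<exists>h\<in>H. \<exists>d\<in>D. nbr h d")
    case True
    then obtain h d where h: "h \<in> H" "d \<in> D" "nbr h d" by auto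
    then have hv: "h \<in> nvert G" "d \<in> nvert G" by (auto simp: nbr_def)
    have hc: "h \<in> carrier G" "h \<noteq> \<one>" "d \<in> carrier G" "d \<noteq> \<one>" using hv by (auto simp: nvert_iff)
    obtain k p where p: "Factorial_Ring.prime (p::nat)" "h [^] (k::nat) \<noteq> \<one>" "(h [^] k) [^] p = \<one>"
      using prime_pow_exists[OF hc(1,2)] by auto
    let ?h = "h [^] k"
    have hH: "?h \<in> H" using subgroup_pow_closed[OF sH h(1)] .
    have "normalises ?h d"
    proof (cases "normalises h d")
      case True
      then show ?thesis using normalises_pow_left hc by auto
    next
      case False
      then have "normalises d h" using h nbr_def by auto
      then obtain i::nat where i: "conj d h = h [^] i" using normalises_def by auto
      \<comment> \<open>If instead \<open>d\<close> normalises the group of \<open>h\<close>, the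
        commutator lies in \<open>H \<inter> D\<close>, which is trivial; then \<open>h\<close> and
        \<open>d\<close> commute.\<close>
      have "conj d h \<otimes> inv h \<in> H" using i sH h(1) subgroup_pow_closed[OF sH h(1)] by (simp add: subgroup.m_closed subgroup.m_inv_closed)
      moreover have "conj d h \<otimes> inv h = d \<otimes> conj h (inv d)" using hc by (simp add: conj_def word)
      moreover have "d \<otimes> conj h (inv d) \<in> D" using h(2) hc invD sD by (simp add: subgroup.m_closed subgroup.m_inv_closed)
      ultimately have "d \<otimes> conj h (inv d) = \<one>" using HD by metis
      then have "d \<otimes> inv (conj h d) = \<one>" using hc conj_inv by simp
      then have "conj h d = d" using hc by (metis conj_closed inv_closed inv_equality inv_inv)
      then show ?thesis using pow_fix normalises_comm hc by auto
    qed
    then have hd': "nbr ?h d" using hv hc p by (auto simp: nbr_def nvert_iff)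
    \<comment> \<open>The prime order power \<open>?h\<close> generates a normal subgroup of
      \<open>H\<close>, so up to conjugation the path is \<open>x - ?h - d - n0\<close>.\<close>
    have "walk_le 3 x n0" if x: "x \<in> nvert G" and e: "e \<in> D" "conj (inv e) x \<in> H" for x e
    proof (rule walk_le_3_via_H[OF x e _ _ hd' n0(1)])
      show "?h \<in> nvert G" using hd' nbr_def by auto
      show "normalises (conj (inv e) x) ?h" using normal[OF hH p(2,3,1) e(2)] .
      show "nbr d n0" using nbr_DN h(2) hc n0 by auto
    qed
    then show ?thesis using all_near[OF n0] by blast
  next
    case False
    have "\<exists>d\<in>D. \<exists>h\<in>H. g = d \<otimes> h" if "g \<in> carrier G" for g
      using frattini[OF that] unfolding H_def by blast
    moreover have "m \<in> H" using m normalises_self H_def by auto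
    ultimately have "frobenius_data H D m n0"
      unfolding frobenius_data_def using sH sD invD m n0 ND DN False H_def by auto
    then show ?thesis by blast
  qed
qed

end

lemma dichotomy: "(\<forall>x\<in>nvert G. \<forall>y\<in>nvert G. walk_le 6 x y) \<or> (\<exists>H m n. frobenius_data H D m n)"
  using diameter_no_self_centralizing diameter_or_frobenius by blast

end

section \<open>The dichotomy for soluble groups\<close>

context fin_group
begin

theorem diameter_dichotomy:
  assumes sol: "solvable G"
  shows "(\<forall>x\<in>nvert G. \<forall>y\<in>nvert G. walk_le 6 x y) \<or> (\<exists>H D m n. frobenius_data H D m n)"
proof (cases "carrier G = {\<one>}")
  case True
  then show ?thesis by (auto simp: nvert_def)
next
  case False
  have c1: "subgroup (carrier G) G" "subgroup {\<one>} G" using subgroup_self triv_subgroup by auto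
  have n1: "\<not> carrier G \<subseteq> {\<one>}" using False one_closed by blast
  have "\<exists>N r. subgroup N G \<and> N \<subseteq> carrier G \<and> \<not> N \<subseteq> {\<one>} \<and> (\<forall>g\<in>carrier G. conj g ` N \<subseteq> N) \<and>
    (\<forall>L. subgroup L G \<longrightarrow> L \<subseteq> N \<longrightarrow> (\<forall>g\<in>carrier G. conj g ` L \<subseteq> L) \<longrightarrow> L \<subseteq> {\<one>} \<or> L = N) \<and>
    (\<forall>a\<in>N. \<forall>b\<in>N. conj a b \<otimes> inv b \<in> {\<one>}) \<and> Factorial_Ring.prime (r::nat) \<and> (\<forall>m\<in>N. m [^] r \<in> {\<one>})"
    by (rule chief_factor[OF sol order_refl c1(1) _ c1(2) _ n1]) auto
  then obtain N r where N: "subgroup N G" "\<not> N \<subseteq> {\<one>}" and invN: "\<forall>g\<in>carrier G. conj g ` N \<subseteq> N"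
    and minN: "\<forall>L. subgroup L G \<longrightarrow> L \<subseteq> N \<longrightarrow> (\<forall>g\<in>carrier G. conj g ` L \<subseteq> L) \<longrightarrow> L \<subseteq> {\<one>} \<or> L = N"
    and Nab: "\<forall>a\<in>N. \<forall>b\<in>N. conj a b \<otimes> inv b \<in> {\<one>}" and r: "Factorial_Ring.prime (r::nat)"
    and Nr: "\<forall>m\<in>N. m [^] r \<in> {\<one>}"
    by (elim exE conjE) (rule that)
  have Nc: "n \<in> carrier G" if "n \<in> N" for n using N that subgroup.mem_carrier by metis
  have Nab': "conj u v = v" if "u \<in> N" "v \<in> N" for u v
    using Nab that Nc by (metis conj_closed inv_closed inv_equality inv_inv singletonD)
  obtain n where n: "n \<in> N" "n \<noteq> \<one>" using N by auto
  define D where "D = {g \<in> carrier G. \<forall>n\<in>N. conj g n = n}"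
  show ?thesis
  proof (cases "carrier G \<subseteq> D")
    case True
    \<comment> \<open>Here \<open>N\<close> is central, so \<open>n\<close> is adjacent to every
      vertex.\<close>
    have nn: "walk_le 1 x n" if "x \<in> nvert G" for x
    proof -
      have "x \<in> D" using that True by (auto simp: nvert_iff)
      then have "conj x n = n" using n D_def by auto
      then show ?thesis unfolding walk_le_1 using that n Nc by (intro nbr_commI) (auto simp: nvert_iff)
    qed
    have "walk_le 6 x y" if "x \<in> nvert G" "y \<in> nvert G" for x y
      using walk_le_mono[OF walk_le_trans[OF nn[OF that(1)] walk_le_sym[OF nn[OF that(2)]]] that(2)] by simp
    then show ?thesis by blast
  next
    case False
    have NG: "N \<subseteq> carrier G" using Nc by auto
    have sD: "subgroup D G" unfolding D_def by (rule subgroup_centralizer[OF NG])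
    have invD: "conj g ` D \<subseteq> D" if g: "g \<in> carrier G" for g
    proof
      fix z assume "z \<in> conj g ` D"
      then obtain d where d: "d \<in> carrier G" "\<And>n. n \<in> N \<Longrightarrow> conj d n = n" "z = conj g d"
        unfolding D_def by blast
      have "conj z n = n" if "n \<in> N" for n
        unfolding d(3) by (rule centralizer_invariant[OF NG _ g d(1,2) that]) (use invN in blast)
      then show "z \<in> D" unfolding D_def using g d by simp
    qed
    have "\<exists>M q. subgroup M G \<and> M \<subseteq> carrier G \<and> \<not> M \<subseteq> D \<and> (\<forall>g\<in>carrier G. conj g ` M \<subseteq> M) \<and>
      (\<forall>L. subgroup L G \<longrightarrow> L \<subseteq> M \<longrightarrow> (\<forall>g\<in>carrier G. conj g ` L \<subseteq> L) \<longrightarrow> L \<subseteq> D \<or> L = M) \<and>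
      (\<forall>a\<in>M. \<forall>b\<in>M. conj a b \<otimes> inv b \<in> D) \<and> Factorial_Ring.prime (q::nat) \<and> (\<forall>m\<in>M. m [^] q \<in> D)"
      by (rule chief_factor[OF sol order_refl c1(1) _ sD _ False]) (use invD in auto)
    then obtain M q where M: "subgroup M G" "\<not> M \<subseteq> D" and invM: "\<forall>g\<in>carrier G. conj g ` M \<subseteq> M"
      and MM: "\<forall>a\<in>M. \<forall>b\<in>M. conj a b \<otimes> inv b \<in> D" and q: "Factorial_Ring.prime (q::nat)"
      and Mq: "\<forall>m\<in>M. m [^] q \<in> D"
      by (elim exE conjE) (rule that)
    interpret normal_series G N D M r q
    proof (intro normal_series.intro normal_series_axioms.intro)
      show "fin_group G" by unfold_locales
      show "N \<noteq> {\<one>}" using N by blast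
      show "conj g n \<in> N" if "g \<in> carrier G" "n \<in> N" for g n using invN that by blast
      show "conj g n \<in> M" if "g \<in> carrier G" "n \<in> M" for g n using invM that by blast
      show "v [^] r = \<one>" if "v \<in> N" for v using Nr that by blast
      show "m [^] q \<in> D" if "m \<in> M" for m using Mq that by blast
      show "conj a b \<otimes> inv b \<in> D" if "a \<in> M" "b \<in> M" for a b using MM that by blast
      fix L assume L: "subgroup L G" "L \<subseteq> N" "\<And>g n. g \<in> carrier G \<Longrightarrow> n \<in> L \<Longrightarrow> conj g n \<in> L"
      then have "L \<subseteq> {\<one>} \<or> L = N" using minN by blast
      then show "L = {\<one>} \<or> L = N" using L(1) subgroup.one_closed by blast
    qed (fact sol N M r q D_def Nab')+
    show ?thesis using dichotomy by blast
  qed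
qed

end

section \<open>Frobenius groups\<close>

context fin_group
begin

section \<open>From the Frobenius condition to disconnectedness\<close>

lemma conj_coset: "g <# C #> inv g = conj g ` C"
  unfolding l_coset_def r_coset_def conj_def by auto

lemma nbr_conj:
  assumes "nbr x y" "g \<in> carrier G" shows "nbr (conj g x) (conj g y)"
  using assms normalises_conj[of g] conj_eq_one unfolding nbr_def nvert_iff by auto

lemma frobenius_complement_iff:
  "frobenius_complement G C \<longleftrightarrow> subgroup C G \<and> C \<noteq> {\<one>} \<and> C \<noteq> carrier G \<and>
    (\<forall>g\<in>carrier G. \<forall>u\<in>C. u \<noteq> \<one> \<longrightarrow> u \<in> conj g ` C \<longrightarrow> g \<in> C)"
proof -
  have "\<one> \<in> C \<inter> conj g ` C" if "subgroup C G" "g \<in> carrier G" for g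
    using that subgroup.one_closed by (auto intro!: image_eqI[of _ _ \<one>])
  then show ?thesis unfolding frobenius_complement_def conj_coset by blast
qed

lemma complement_conj:
  assumes C: "frobenius_complement G C" and ab: "a \<in> carrier G" "b \<in> carrier G"
    and u: "u \<noteq> \<one>" "u \<in> conj a ` C" "u \<in> conj b ` C"
  shows "inv a \<otimes> b \<in> C"
proof -
  have sC: "subgroup C G" using C frobenius_complement_iff by auto
  obtain c e where c: "c \<in> C" "u = conj a c" "e \<in> C" "u = conj b e" using u by auto
  then have cc: "c \<in> carrier G" "e \<in> carrier G" using sC subgroup.mem_carrier by auto
  have "c = conj (inv a) (conj b e)" using c ab cc by (metis conj_inv_conj(1))
  then have "c = conj (inv a \<otimes> b) e" using ab cc by (simp add: conj_conj)
  moreover have "c \<noteq> \<one>" using c u ab by auto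
  ultimately show ?thesis using C c ab unfolding frobenius_complement_iff by blast
qed

text \<open>\<open>conj x y\<close> is a nontrivial common element of the conjugates of
  \<open>C\<close> by \<open>g\<close> and by \<open>x \<otimes> g\<close>, so \<open>g\<close>
  conjugates an element of \<open>C\<close> to \<open>x\<close>.\<close>

lemma complement_normalizes:
  assumes C: "frobenius_complement G C" and g: "g \<in> carrier G" and x: "x \<in> carrier G"
    and y: "y \<in> conj g ` C" "y \<noteq> \<one>" and normalises: "normalises x y"
  shows "x \<in> conj g ` C"
proof -
  have sC: "subgroup (conj g ` C) G" using C frobenius_complement_iff subgroup_conj_image g by auto
  have yc: "y \<in> carrier G" using sC y subgroup.mem_carrier by metis
  have "subgroup C G" using C frobenius_complement_iff by simp
  then have CG: "C \<subseteq> carrier G" by (rule subgroup.subset)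
  obtain i::nat where i: "conj x y = y [^] i" using normalises normalises_def by auto
  have "conj x y \<in> conj g ` C" using subgroup_pow_closed[OF sC y(1), of i] i by simp
  moreover have "conj x y \<in> conj (x \<otimes> g) ` C"
  proof -
    obtain c where c: "c \<in> C" "y = conj g c" using y by auto
    then have "conj x y = conj (x \<otimes> g) c" using conj_conj[of x g c] x g CG by auto
    then show ?thesis using c by blast
  qed
  moreover have "conj x y \<noteq> \<one>" using conj_eq_one x yc y by simp
  ultimately have *: "inv g \<otimes> (x \<otimes> g) \<in> C" using complement_conj[OF C g] x g by blast
  have "x = conj g (inv g \<otimes> (x \<otimes> g))" using x g by (simp add: conj_def word)
  then show ?thesis using * by blast
qed

lemma frob_condition_disconnected:
  assumes "frob_condition G"
  shows "\<exists>x\<in>nvert G. \<exists>y\<in>nvert G. \<forall>k. \<not> walk_le k x y"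
proof -
  obtain K C where C: "frobenius_complement G C" and K: "K = frobenius_kernel G C"
    and KC: "K <#> C = carrier G"
    and cond: "\<And>p r :: nat. \<lbrakk>Factorial_Ring.prime p; p dvd card C; Factorial_Ring.prime r; r dvd card K\<rbrakk> \<Longrightarrow> \<not> p dvd (r - 1)"
    using assms unfolding frob_condition_def by blast
  have sC: "subgroup C G" "C \<noteq> {\<one>}" "C \<noteq> carrier G" using C frobenius_complement_iff by auto
  have Cc: "c \<in> carrier G" if "c \<in> C" for c using sC that subgroup.mem_carrier by metis
  define U where "U = (\<Union>g\<in>carrier G. conj g ` C)"
  have KU: "K = (carrier G - U) \<union> {\<one>}" unfolding K frobenius_kernel_def conj_coset U_def ..
  have Uconj: "conj g u \<in> U" if gu: "g \<in> carrier G" "u \<in> U" for g u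
  proof -
    obtain a c where a: "a \<in> carrier G" "c \<in> C" "u = conj a c" using gu U_def by auto
    then have "conj g u = conj (g \<otimes> a) c" using gu Cc by (simp add: conj_conj)
    then show ?thesis unfolding U_def using a gu by blast
  qed
  have Uconj': "u \<in> U" if "g \<in> carrier G" "u \<in> carrier G" "conj g u \<in> U" for g u
    using Uconj[of "inv g" "conj g u"] that by simp
  \<comment> \<open>In such an edge only \<open>c\<close> can normalise the group of
    \<open>z\<close>, as normalisers of nontrivial cyclic subgroups of \<open>C\<close> stay in
    \<open>C\<close>. On prime order powers this is a free action of order \<open>p\<close> on a
    group of order \<open>r\<close>, so \<open>p\<close> divides \<open>r - 1\<close>.\<close>
  have key: "\<not> nbr z c" if z: "z \<in> carrier G" "z \<notin> U" and c: "c \<in> C" for z c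
  proof
    assume nb: "nbr z c"
    then have c1: "c \<noteq> \<one>" "z \<noteq> \<one>" by (auto simp: nbr_def nvert_iff)
    have cc: "c \<in> carrier G" using Cc c by auto
    have C1: "conj \<one> ` C = C" using Cc by simp
    have CU: "C \<subseteq> U" unfolding U_def using C1 by blast
    have inC: "x \<in> C" if "normalises x y" "y \<in> C" "y \<noteq> \<one>" "x \<in> carrier G" for x y
      using complement_normalizes[OF C one_closed that(4) _ that(3,1)] that(2) C1 by simp
    have "\<not> normalises z c" using inC c c1 z CU by blast
    then have normalises: "normalises c z" using nb nbr_def by auto
    obtain k p where p: "Factorial_Ring.prime (p::nat)" "c [^] (k::nat) \<noteq> \<one>" "(c [^] k) [^] p = \<one>"
      using prime_pow_exists[OF cc c1(1)] by auto
    obtain j r where r: "Factorial_Ring.prime (r::nat)" "z [^] (j::nat) \<noteq> \<one>" "(z [^] j) [^] r = \<one>"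
      using prime_pow_exists[OF z(1) c1(2)] by auto
    define d where "d = c [^] k"
    define y where "y = z [^] j"
    have d: "d \<in> C" "d \<in> carrier G" "d \<noteq> \<one>" "d [^] p = \<one>"
      using p subgroup_pow_closed[OF sC(1) c] Cc d_def by auto
    have y: "y \<in> carrier G" "y \<noteq> \<one>" "y [^] r = \<one>" using r z y_def by auto
    have dy: "normalises d y" unfolding d_def y_def using normalises normalises_pow_left normalises_pow_right cc z by simp
    have zz: "conj z z = z" using z conj_fix by simp
    have zy: "normalises z y" unfolding y_def using conj_fix_pow[OF z(1) z(1) zz] z by (intro normalises_comm) auto
    have yU: "y \<notin> U"
    proof
      assume "y \<in> U"
      then obtain g where "g \<in> carrier G" "y \<in> conj g ` C" unfolding U_def by auto
      then have "z \<in> U" using complement_normalizes[OF C _ z(1) _ y(2) zy] U_def by blast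
      then show False using z by simp
    qed
    have "p dvd card C" using pow_eq_one_iff[OF d(2,3) p(1) d(4)] subgroup_pow_card[OF sC(1) d(1)] by simp
    \<comment> \<open>\<open>K\<close> is given as a set, so \<open>r\<close> is found by counting:
      \<open>conj y\<close> permutes \<open>K\<close> with period \<open>r\<close>, and its fixed
      points form the centraliser of \<open>y\<close>, a subgroup containing
      \<open>y\<close>.\<close>
    moreover have "r dvd card K"
    proof -
      have Kc: "K \<subseteq> carrier G" "finite K" using KU fin by auto
      have "conj y ` K \<subseteq> K"
      proof
        fix w assume "w \<in> conj y ` K"
        then obtain v where v: "v \<in> K" "w = conj y v" by auto
        then have "v \<in> carrier G" using Kc by auto
        moreover have "w \<notin> U" if "v \<noteq> \<one>" using Uconj'[OF y(1) \<open>v \<in> carrier G\<close>] v that KU by auto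
        ultimately show "w \<in> K" using v y KU by (cases "v = \<one>") auto
      qed
      moreover have "{v \<in> K. conj y v = v} = {v \<in> carrier G. \<forall>w\<in>{y}. conj v w = w}"
      proof -
        have "v \<in> K" if v: "v \<in> carrier G" "conj y v = v" for v
        proof (rule ccontr)
          assume "v \<notin> K"
          then have "v \<in> U" "v \<noteq> \<one>" using v KU by auto
          then obtain g where "g \<in> carrier G" "v \<in> conj g ` C" unfolding U_def by auto
          moreover have "normalises y v" using v y normalises_comm by auto
          ultimately have "y \<in> U" using complement_normalizes[OF C _ y(1)] \<open>v \<noteq> \<one>\<close> U_def by blast
          then show False using yU by simp
        qed
        moreover have "conj y v = v \<longleftrightarrow> conj v y = y" if "v \<in> carrier G" for v
          using that y conj_fix_sym by blast
        ultimately show ?thesis using Kc by blast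
      qed
      moreover have "r dvd card {v \<in> carrier G. \<forall>w\<in>{y}. conj v w = w}"
      proof -
        have s: "subgroup {v \<in> carrier G. \<forall>w\<in>{y}. conj v w = w} G" by (rule subgroup_centralizer) (use y in simp)
        have "conj y y = y" using conj_fix y by simp
        then show ?thesis using subgroup_pow_card[OF s, of y] pow_eq_one_iff[OF y(1,2) r(1) y(3)] y by simp
      qed
      moreover have "conj (y [^] r) v = v" if "v \<in> K" for v using that Kc(1) y(3) by auto
      ultimately show ?thesis using fixed_point_dvd[OF Kc(2,1) y(1) _ r(1)] by simp
    qed
    moreover have "p dvd r - 1"
    proof -
      let ?S = "generate G {y} - {\<one>}"
      have Sel: "generate G {y} = {y [^] n | n::nat. True}" using mem_generate_single y by auto
      have "ord y dvd r" using y(3) pow_eq_id y(1) by auto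
      then have "ord y = r" using r(1) y ord_eq_1 by (metis prime_nat_iff)
      then have "card (generate G {y}) = r" using generate_pow_card y by simp
      moreover have "\<one> \<in> generate G {y}" by (rule generate.one)
      ultimately have cS: "card ?S = r - 1" by simp
      \<comment> \<open>A nontrivial power of \<open>y\<close> fixed by \<open>d\<close> commutes
        with \<open>d\<close>, hence lies in \<open>C\<close>, and would force \<open>y\<close> into
        \<open>C\<close>.\<close>
      have "p dvd card ?S"
      proof (rule prime_period_dvd[OF _ p(1)])
        have "generate G {y} \<subseteq> carrier G" using generate_incl y by simp
        then show "finite ?S" using fin finite_subset by blast
        fix s assume s: "s \<in> ?S"
        then obtain n::nat where n: "s = y [^] n" "s \<noteq> \<one>" using Sel by auto
        obtain i::nat where i: "conj d y = y [^] i" using dy normalises_def by auto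
        have "conj d s = y [^] (i * n)" using n conj_pow[OF d(2) y(1), of n] i y by (simp add: nat_pow_pow)
        then show "conj d s \<in> ?S" using Sel n d y conj_eq_one[of d s] by blast
        show "(conj d ^^ p) s = s" using conj_funpow[of d s p] d n y by simp
        show "conj d s \<noteq> s"
        proof
          assume "conj d s = s"
          then have "normalises s d" using conj_fix_sym[of d s] d n y by (intro normalises_comm) auto
          then have "s \<in> C" using inC d n y by blast
          moreover have "normalises y s" using n y normalises_comm conj_fix_pow[OF y(1) y(1)] conj_fix by simp
          ultimately have "y \<in> C" using inC n y by blast
          then show False using yU CU by auto
        qed
      qed
      then show ?thesis using cS by simp
    qed
    ultimately show False using cond p r by blast
  qed
  have step: "w \<in> carrier G - U" if nb: "nbr z w" and z: "z \<in> carrier G - U" for z w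
  proof (rule ccontr)
    have wc: "w \<in> carrier G" using nb by (auto simp: nbr_def nvert_iff)
    assume "w \<notin> carrier G - U"
    then obtain g c where g: "g \<in> carrier G" "c \<in> C" "w = conj g c" using wc U_def by auto
    have "nbr (conj (inv g) z) c" using nbr_conj[OF nb, of "inv g"] g Cc by simp
    moreover have "conj (inv g) z \<in> carrier G" "conj (inv g) z \<notin> U"
      using z g Uconj'[of "inv g" z] by auto
    ultimately show False using key g by blast
  qed
  have reach: "w \<in> carrier G - U" if "walk_le k z w" "z \<in> carrier G - U" for k z w
    using that
  proof (induction k arbitrary: w)
    case (Suc k)
    then obtain v where v: "walk_le k z v" "nbr v w" unfolding walk_le_def by auto
    then show ?case using Suc step by blast
  qed (auto simp: walk_le_def)
  obtain y where y: "y \<in> C" "y \<noteq> \<one>" using sC subgroup.one_closed by blast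
  have yU: "y \<in> U" unfolding U_def using y Cc by (auto intro!: bexI[of _ \<one>] image_eqI[of _ _ y])
  have "\<exists>x\<in>K. x \<noteq> \<one>"
  proof (rule ccontr)
    assume "\<not> ?thesis"
    then have "K = {\<one>}" using KU by auto
    then have "K <#> C = C" using Cc by (auto simp: set_mult_def)
    then show False using KC sC by simp
  qed
  then obtain x where "x \<in> carrier G - U" "x \<noteq> \<one>" using KU by auto
  then show ?thesis using reach y yU Cc by (intro bexI[of _ x] bexI[of _ y]) (auto simp: nvert_iff)
qed

section \<open>Structure and components in the disconnected case\<close>

context
  fixes H D m n assumes fd: "frobenius_data H D m n"
begin

lemma fd_facts: "subgroup H G" "subgroup D G" "\<And>g d. g \<in> carrier G \<Longrightarrow> d \<in> D \<Longrightarrow> conj g d \<in> D"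
  "m \<in> H" "m \<noteq> \<one>" "\<And>h. h \<in> H \<Longrightarrow> normalises h m" "\<And>g. g \<in> carrier G \<Longrightarrow> \<exists>d\<in>D. \<exists>h\<in>H. g = d \<otimes> h"
  "n \<in> D" "n \<noteq> \<one>" "\<And>d. d \<in> D \<Longrightarrow> conj d n = n" "\<And>h d. h \<in> H \<Longrightarrow> d \<in> D \<Longrightarrow> \<not> nbr h d"
  using fd unfolding frobenius_data_def by blast+

lemma fd_carr: "h \<in> H \<Longrightarrow> h \<in> carrier G" "d \<in> D \<Longrightarrow> d \<in> carrier G"
  using fd_facts(1,2) subgroup.mem_carrier by metis+

lemma fd_int: assumes "d \<in> D" "d \<in> H" shows "d = \<one>"
proof (rule ccontr)
  assume "d \<noteq> \<one>"
  then have "nbr d d" using assms fd_carr nbr_refl by (simp add: nvert_iff)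
  then show False using fd_facts(11) assms by blast
qed

lemma fd_fpf: assumes "h \<in> H" "h \<noteq> \<one>" "d \<in> D" "conj h d = d" shows "d = \<one>"
proof (rule ccontr)
  assume "d \<noteq> \<one>"
  then have "nbr h d" using assms fd_carr by (intro nbr_commI) (auto simp: nvert_iff)
  then show False using fd_facts(11) assms by blast
qed

text \<open>\<open>H\<close> acts freely on \<open>D\<close>, so \<open>fpf_conj_surj\<close> turns
  the coset of \<open>h\<close> modulo \<open>D\<close> into conjugates of \<open>h\<close>.\<close>

lemma fd_outside: assumes g: "g \<in> carrier G" "g \<notin> D" shows "\<exists>d\<in>D. \<exists>h\<in>H. h \<noteq> \<one> \<and> g = conj d h"
proof -
  obtain e h where e: "e \<in> D" "h \<in> H" "g = e \<otimes> h" using fd_facts(7) g by blast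
  have h1: "h \<noteq> \<one>" using e g fd_carr by auto
  have "\<exists>d\<in>D. e \<otimes> h = conj d h"
    by (rule fpf_conj_surj[OF fd_facts(2)]) (use e fd_carr fd_facts(3) fd_fpf h1 in auto)
  then show ?thesis using e h1 by blast
qed

lemma fd_complement: "frobenius_complement G H"
  unfolding frobenius_complement_iff
proof (intro conjI ballI impI)
  show "subgroup H G" "H \<noteq> {\<one>}" using fd_facts by auto
  show "H \<noteq> carrier G" using fd_int fd_facts(8,9) fd_carr(2) by blast
  fix g u assume g: "g \<in> carrier G" and u: "u \<in> H" "u \<noteq> \<one>" "u \<in> conj g ` H"
  obtain d h where d: "d \<in> D" "h \<in> H" "g = d \<otimes> h" using fd_facts(7) g by blast
  obtain k where k: "k \<in> H" "u = conj g k" using u by auto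
  let ?k = "conj h k"
  have kH: "?k \<in> H" using conj_mem[OF fd_facts(1)] d k by auto
  have uk: "u = conj d ?k" using k d fd_carr by (simp add: conj_conj)
  \<comment> \<open>The commutator of \<open>d\<close> and \<open>?k\<close> lies in both
    \<open>H\<close> and \<open>D\<close>, hence is trivial; a free action then leaves only
    \<open>d = \<one>\<close>.\<close>
  have "u \<otimes> inv ?k \<in> H" using u kH fd_facts(1) by (simp add: subgroup.m_closed subgroup.m_inv_closed)
  moreover have eq: "u \<otimes> inv ?k = d \<otimes> inv (conj ?k d)"
    unfolding uk using d k fd_carr by (simp add: conj_def word)
  moreover have "d \<otimes> inv (conj ?k d) \<in> D"
    using d kH fd_carr fd_facts(2,3) by (simp add: subgroup.m_closed subgroup.m_inv_closed)
  ultimately have "d \<otimes> inv (conj ?k d) = \<one>" using fd_int by simp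
  then have "conj ?k d = d" using d kH fd_carr by (metis conj_closed inv_closed inv_equality inv_inv)
  moreover have "?k \<noteq> \<one>" using u uk d fd_carr by auto
  ultimately have "d = \<one>" using fd_fpf kH d by blast
  then show "g \<in> H" using d fd_carr by simp
qed

lemma fd_kernel: "frobenius_kernel G H = D"
proof -
  have "x = \<one>" if x: "x \<in> D" "g \<in> carrier G" "x \<in> conj g ` H" for x g
  proof -
    obtain h where h: "h \<in> H" "x = conj g h" using x by auto
    then have "conj (inv g) x = h" using x fd_carr by simp
    then have "h \<in> D" using fd_facts(3)[of "inv g" x] x by simp
    then have "h = \<one>" using fd_int h by blast
    then show ?thesis using h x by simp
  qed
  moreover have "x \<in> (\<Union>g\<in>carrier G. conj g ` H)" if "x \<in> carrier G" "x \<notin> D" for x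
    using fd_outside[OF that] fd_carr by blast
  moreover have "D \<subseteq> carrier G" "\<one> \<in> D" using fd_carr fd_facts(2) subgroup.one_closed by auto
  ultimately show ?thesis unfolding frobenius_kernel_def conj_coset by blast
qed

text \<open>If \<open>p\<close> divided \<open>r - 1\<close>, an element \<open>x\<close> of order
  \<open>p\<close> in \<open>H\<close> would act on an invariant Sylow \<open>r\<close>-subgroup of
  \<open>D\<close>; inside a minimal \<open>x\<close>-invariant subgroup, elementary abelian,
  \<open>exists_eigenvector\<close> then produces an edge between \<open>H\<close> and
  \<open>D\<close>.\<close>

lemma fd_condition: assumes solv: "solvable G" shows "frob_condition G"
  unfolding frob_condition_def
proof (intro exI conjI allI impI)
  show "frobenius_complement G H" by (rule fd_complement)
  show "D = frobenius_kernel G H" by (rule fd_kernel[symmetric])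
  show "D <#> H = carrier G" unfolding set_mult_def using fd_facts(7) fd_carr by fastforce
  fix p r :: nat
  assume p: "Factorial_Ring.prime p" "p dvd card H" and r: "Factorial_Ring.prime r" "r dvd card D"
  show "\<not> p dvd (r - 1)"
  proof
    assume pr: "p dvd r - 1"
    obtain x where x: "x \<in> H" "x \<noteq> \<one>" "x [^] p = \<one>" using cauchy[OF fd_facts(1) p] by auto
    have xc: "x \<in> carrier G" using x fd_carr by auto
    have xD: "conj x ` D \<subseteq> D" using fd_facts(3) xc by blast
    have "\<not> p dvd card D"
    proof
      assume "p dvd card D"
      then have "\<exists>y\<in>D. y \<noteq> \<one> \<and> conj x y = y"
        using x xc fd_carr by (intro exists_fixed_point[OF fd_facts(2) xc _ p(1) xD]) auto
      then show False using fd_fpf x by blast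
    qed
    then obtain S a t where S: "subgroup S G" "S \<subseteq> D" "card S = r ^ a" "card D = r ^ a * t" "\<not> r dvd t" "conj x ` S \<subseteq> S"
      using invariant_sylow[OF fd_facts(2) xc x(3) p(1) xD _ r(1)] by blast
    have "a \<noteq> 0" using S r(2) by (auto intro: ccontr)
    then have "card S \<noteq> 1" using S(3) prime_gt_1_nat[OF r(1)] by simp
    then have S1: "\<not> S \<subseteq> {\<one>}" using S(1) subgroup.one_closed by (metis is_singletonI is_singleton_altdef subset_singletonD empty_iff)
    have "\<exists>V q. subgroup V G \<and> V \<subseteq> S \<and> \<not> V \<subseteq> {\<one>} \<and> (\<forall>g\<in>{x}. conj g ` V \<subseteq> V) \<and>
      (\<forall>L. subgroup L G \<longrightarrow> L \<subseteq> V \<longrightarrow> (\<forall>g\<in>{x}. conj g ` L \<subseteq> L) \<longrightarrow> L \<subseteq> {\<one>} \<or> L = V) \<and>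
      (\<forall>a\<in>V. \<forall>b\<in>V. conj a b \<otimes> inv b \<in> {\<one>}) \<and> Factorial_Ring.prime (q::nat) \<and> (\<forall>m\<in>V. m [^] q \<in> {\<one>})"
      by (rule chief_factor[OF solv _ S(1) _ triv_subgroup _ S1]) (use S xc in auto)
    then obtain V q where V: "subgroup V G" "V \<subseteq> S" "\<not> V \<subseteq> {\<one>}" and xV: "\<forall>g\<in>{x}. conj g ` V \<subseteq> V"
      and Vab: "\<forall>a\<in>V. \<forall>b\<in>V. conj a b \<otimes> inv b \<in> {\<one>}" and q: "Factorial_Ring.prime (q::nat)"
      and Vq: "\<forall>m\<in>V. m [^] q \<in> {\<one>}"
      by (elim exE conjE) (rule that)
    have Vc: "v \<in> carrier G" if "v \<in> V" for v using V(1) that subgroup.mem_carrier by metis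
    obtain v where v: "v \<in> V" "v \<noteq> \<one>" using V(3) by auto
    have vq: "v [^] q = \<one>" using Vq v by auto
    have "q dvd r ^ a"
      using pow_eq_one_iff[OF Vc[OF v(1)] v(2) q vq] subgroup_pow_card[OF S(1), of v] S(3) V(2) v(1) by auto
    then have qr: "q = r" using q r(1) by (metis prime_dvd_power_nat primes_dvd_imp_eq)
    have "conj u w = w" if "u \<in> V" "w \<in> V" for u w
      using Vab that Vc by (metis conj_closed inv_closed inv_equality inv_inv singletonD)
    then have "\<exists>v\<in>V. v \<noteq> \<one> \<and> normalises x v"
      using V Vq qr xV x by (intro exists_eigenvector[OF V(1) _ _ _ r(1) p(1) pr xc x(3)]) auto
    then obtain w where w: "w \<in> V" "w \<noteq> \<one>" "normalises x w" by blast
    then have "nbr x w" using x xc Vc by (simp add: nbr_def nvert_iff)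
    then show False using fd_facts(11) x w(1) V(2) S(2) by blast
  qed
qed

lemma fd_nbr_D: assumes "nbr x y" "x \<in> D" shows "y \<in> D"
proof (rule ccontr)
  assume "y \<notin> D"
  moreover have "y \<in> carrier G" using assms(1) by (simp add: nbr_def nvert_iff)
  ultimately obtain d h where d: "d \<in> D" "h \<in> H" "y = conj d h" using fd_outside by blast
  have "nbr (conj (inv d) x) h" using nbr_conj[OF assms(1), of "inv d"] d fd_carr by simp
  moreover have "conj (inv d) x \<in> D" using fd_facts(3) assms(2) d fd_carr by simp
  ultimately show False using fd_facts(11) d nbr_sym by blast
qed

text \<open>If \<open>x\<close> normalises the group of \<open>y\<close>, then \<open>y\<close> lies
  in some conjugate of \<open>H\<close>, which must also contain \<open>x\<close>. Two conjugates of
  \<open>H\<close> sharing a nontrivial element coincide.\<close>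

lemma fd_nbr_H: assumes nb: "nbr x y" and x: "x \<in> conj d ` H" and d: "d \<in> carrier G" shows "y \<in> conj d ` H"
proof -
  have v: "x \<in> carrier G" "x \<noteq> \<one>" "y \<in> carrier G" "y \<noteq> \<one>" using nb by (auto simp: nbr_def nvert_iff)
  show ?thesis
  proof (cases "normalises y x")
    case True
    then show ?thesis using complement_normalizes[OF fd_complement d v(3) x v(2)] by simp
  next
    case False
    then have xy: "normalises x y" using nb nbr_def by auto
    have "y \<notin> D"
    proof
      assume "y \<in> D"
      then have "x \<in> D" using fd_nbr_D nbr_sym nb by blast
      then have "x \<in> frobenius_kernel G H" using fd_kernel by simp
      then show False using v x d unfolding frobenius_kernel_def conj_coset by blast
    qed
    then obtain e h where e: "e \<in> D" "h \<in> H" "y = conj e h" using fd_outside v by blast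
    have ec: "e \<in> carrier G" using e fd_carr by auto
    have ye: "y \<in> conj e ` H" using e by blast
    have "x \<in> conj e ` H" using complement_normalizes[OF fd_complement ec v(1) ye v(4) xy] .
    then have de: "inv d \<otimes> e \<in> H" using complement_conj[OF fd_complement d ec v(2) x] by blast
    have "y = conj d (conj (inv d \<otimes> e) h)" using e ec d fd_carr by (simp add: conj_conj m_assoc[symmetric])
    moreover have "conj (inv d \<otimes> e) h \<in> H" using conj_mem[OF fd_facts(1) de] e by blast
    ultimately show ?thesis by blast
  qed
qed

text \<open>Walks stay inside \<open>D\<close> or inside one conjugate of \<open>H\<close>; the
  former is a star around \<open>n\<close>, the latter a star around the corresponding conjugate of
  \<open>m\<close>.\<close>

lemma fd_component:
  assumes "walk_le k x y" "x \<in> nvert G" "y \<in> nvert G" shows "walk_le 2 x y"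
proof (cases "x \<in> D")
  case True
  have "walk_le j x z \<Longrightarrow> z \<in> D" for j z
  proof (induction j arbitrary: z)
    case 0
    then show ?case using True by (simp add: walk_le_def)
  next
    case (Suc j)
    then obtain v where v: "walk_le j x v" "nbr v z" unfolding walk_le_def by auto
    then show ?case using Suc.IH fd_nbr_D by blast
  qed
  then have y: "y \<in> D" using assms by blast
  have nb: "nbr z n" if "z \<in> D" "z \<in> nvert G" for z
    using that fd_facts(8-10) fd_carr by (intro nbr_commI) (auto simp: nvert_iff)
  show ?thesis by (rule walk_le_2[OF nb[OF True assms(2)] nbr_sym[OF nb[OF y assms(3)]]])
next
  case False
  then obtain d h where d: "d \<in> D" "h \<in> H" "x = conj d h" using fd_outside assms(2) nvert_iff by blast
  have dc: "d \<in> carrier G" using d fd_carr by auto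
  have "walk_le j x z \<Longrightarrow> z \<in> conj d ` H" for j z
  proof (induction j arbitrary: z)
    case 0
    then have "z = x" by (simp add: walk_le_def)
    then show ?case using d by blast
  next
    case (Suc j)
    then obtain v where v: "walk_le j x v" "nbr v z" unfolding walk_le_def by auto
    then show ?case using Suc.IH fd_nbr_H dc by blast
  qed
  then have y: "y \<in> conj d ` H" using assms by blast
  have nb: "nbr z (conj d m)" if z: "z \<in> conj d ` H" "z \<in> nvert G" for z
  proof -
    obtain k where k: "k \<in> H" "z = conj d k" using z by auto
    then have "normalises z (conj d m)" using normalises_conj[of d k m] fd_facts(4,6) dc fd_carr by simp
    then show ?thesis using z fd_facts(4,5) dc fd_carr conj_eq_one by (auto simp: nbr_def nvert_iff)
  qed
  have "x \<in> conj d ` H" using d by blast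
  then show ?thesis using walk_le_2[OF nb nbr_sym[OF nb]] y assms by blast
qed

end

end

section \<open>Diameters\<close>

context fin_group
begin

lemma nconnected_iff: "nconnected G \<longleftrightarrow> (\<forall>x\<in>nvert G. \<forall>y\<in>nvert G. \<exists>k. walk_le k x y)"
  unfolding nconnected_def using ndist_finite_iff by blast

lemma ndiam_on_le_iff:
  assumes "S \<subseteq> nvert G" shows "ndiam_on G S \<le> enat k \<longleftrightarrow> (\<forall>x\<in>S. \<forall>y\<in>S. walk_le k x y)"
proof -
  have "ndiam_on G S \<le> enat k \<longleftrightarrow> (\<forall>x\<in>S. \<forall>y\<in>S. ndist G x y \<le> enat k)"
    unfolding ndiam_on_def Sup_le_iff by blast
  also have "\<dots> \<longleftrightarrow> (\<forall>x\<in>S. \<forall>y\<in>S. walk_le k x y)" using ndist_le_iff assms by blast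
  finally show ?thesis .
qed

lemma connected_walk_le_6:
  assumes "solvable G" "nconnected G" "x \<in> nvert G" "y \<in> nvert G" shows "walk_le 6 x y"
  using diameter_dichotomy[OF assms(1)] fd_condition[OF _ assms(1)] frob_condition_disconnected assms
  unfolding nconnected_iff by blast

lemma connectivity_and_diameter:
  assumes sol: "solvable G"
  shows "(\<not> nconnected G \<longleftrightarrow> frob_condition G) \<and>
    (\<not> nconnected G \<longrightarrow> (\<forall>x\<in>nvert G. ndiam_on G (ncomponent G x) \<le> 2)) \<and>
    (nconnected G \<longrightarrow> ndiam G \<le> 6)"
proof (intro conjI impI ballI)
  have fd: "\<exists>H D m n. frobenius_data H D m n" if "\<not> nconnected G"
    using diameter_dichotomy[OF sol] that unfolding nconnected_iff by blast
  show "\<not> nconnected G \<longleftrightarrow> frob_condition G"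
    using fd fd_condition[OF _ sol] frob_condition_disconnected unfolding nconnected_iff by blast
  show "ndiam G \<le> 6" if "nconnected G"
    unfolding ndiam_def numeral_eq_enat
    using ndiam_on_le_iff[of "nvert G" 6] connected_walk_le_6[OF sol that] by blast
  fix x assume nc: "\<not> nconnected G" and x: "x \<in> nvert G"
  obtain H D m n where f: "frobenius_data H D m n" using fd[OF nc] by blast
  have sub: "ncomponent G x \<subseteq> nvert G" unfolding ncomponent_def by auto
  have "walk_le 2 a b" if ab: "a \<in> ncomponent G x" "b \<in> ncomponent G x" for a b
  proof -
    have v: "a \<in> nvert G" "b \<in> nvert G" using ab sub by auto
    obtain k l where "walk_le k x a" "walk_le l x b" using ab ndist_finite_iff x unfolding ncomponent_def by blast
    then have "walk_le (k + l) a b" using walk_le_sym walk_le_trans by blast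
    then show ?thesis using fd_component[OF f] v by blast
  qed
  then show "ndiam_on G (ncomponent G x) \<le> 2"
    unfolding numeral_eq_enat using ndiam_on_le_iff[OF sub, of 2] by blast
qed

lemma ndiam_eq_6:
  assumes "solvable G" "nconnected G" "x \<in> nvert G" "y \<in> nvert G" "\<not> walk_le 5 x y" shows "ndiam G = 6"
proof -
  have "\<not> ndiam G \<le> enat 5" unfolding ndiam_def using ndiam_on_le_iff[of "nvert G" 5] assms by blast
  moreover have "ndiam G \<le> enat 6" unfolding ndiam_def using ndiam_on_le_iff[of "nvert G" 6] connected_walk_le_6 assms by blast
  ultimately show ?thesis unfolding numeral_eq_enat by (cases "ndiam G") auto
qed

end

section \<open>Transport along isomorphisms\<close>

lemma group_isomorphic_copy:
  fixes G :: "'a monoid" and f :: "'a \<Rightarrow> 'b"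
  assumes "group G" "inj_on f (carrier G)"
  obtains H :: "'b monoid" where "group H" "f \<in> iso G H"
proof -
  let ?i = "inv_into (carrier G) f"
  \<comment> \<open>\<open>H0\<close> is only a target making \<open>f\<close> a homomorphism; the
    group laws hold after restriction to the image, and come from those of \<open>G\<close>.\<close>
  define H0 where "H0 = \<lparr>carrier = (UNIV :: 'b set), monoid.mult = (\<lambda>a b. f (?i a \<otimes>\<^bsub>G\<^esub> ?i b)), one = f \<one>\<^bsub>G\<^esub>\<rparr>"
  define H where "H = H0\<lparr>carrier := f ` carrier G, one := f \<one>\<^bsub>G\<^esub>\<rparr>"
  have "f \<in> hom G H0" unfolding H0_def hom_def using assms(2) by auto
  then have "group H" unfolding H_def by (rule group.hom_imp_img_group[OF assms(1)])
  moreover have "f \<in> iso G H"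
    unfolding iso_def hom_def H_def H0_def bij_betw_def using assms(2) by auto
  ultimately show ?thesis by (rule that)
qed

lemma iso_normalises:
  assumes "fin_group G" "fin_group H" and f: "f \<in> iso G H" and xy: "x \<in> carrier G" "y \<in> carrier G"
  shows "fin_group.normalises H (f x) (f y) \<longleftrightarrow> fin_group.normalises G x y"
proof -
  interpret G: fin_group G by fact
  interpret H: fin_group H by fact
  interpret f: group_hom G H f
    using f by (simp add: group_hom_def group_hom_axioms_def iso_def G.is_group H.is_group)
  have inj: "inj_on f (carrier G)" using f by (simp add: iso_def bij_betw_def)
  have "H.conj (f x) (f y) = f (G.conj x y)" using xy by (simp add: G.conj_def H.conj_def)
  moreover have "f y [^]\<^bsub>H\<^esub> i = f (y [^]\<^bsub>G\<^esub> i)" for i :: nat using xy by (simp add: f.hom_nat_pow)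
  ultimately show ?thesis
    unfolding G.normalises_def H.normalises_def using inj_on_eq_iff[OF inj] xy by simp
qed

lemma iso_vert: assumes "group G" "group H" "f \<in> iso G H" shows "f ` nvert G = nvert H"
proof -
  interpret f: group_hom G H f
    using assms by (simp add: group_hom_def group_hom_axioms_def iso_def)
  have "inj_on f (carrier G)" "f ` carrier G = carrier H" using assms(3) by (auto simp: iso_def bij_betw_def)
  then show ?thesis unfolding nvert_def by (subst inj_on_image_set_diff[of f "carrier G"]) auto
qed

lemma iso_walk_le:
  assumes G: "fin_group G" and H: "fin_group H" and f: "f \<in> iso G H" and x: "x \<in> nvert G" "y \<in> nvert G"
  shows "fin_group.walk_le H k (f x) (f y) \<longleftrightarrow> fin_group.walk_le G k x y"
proof -
  interpret G: fin_group G by fact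
  interpret H: fin_group H by fact
  have vert: "f ` nvert G = nvert H" using iso_vert f G.is_group H.is_group by blast
  have inj: "inj_on f (carrier G)" using f by (simp add: iso_def bij_betw_def)
  have nbr: "H.nbr (f u) (f v) \<longleftrightarrow> G.nbr u v" if "u \<in> nvert G" "v \<in> nvert G" for u v
    using that vert iso_normalises[OF G H f] unfolding G.nbr_def H.nbr_def by (auto simp: nvert_def)
  show ?thesis using x
  proof (induction k arbitrary: y)
    case 0
    then show ?case using inj_on_eq_iff[OF inj] by (auto simp: G.walk_le_def H.walk_le_def nvert_def)
  next
    case (Suc k)
    show ?case
    proof
      assume "H.walk_le (Suc k) (f x) (f y)"
      then obtain v where v: "H.walk_le k (f x) v" "H.nbr v (f y)" unfolding H.walk_le_def by auto
      then have "v \<in> nvert H" unfolding H.nbr_def by auto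
      then obtain u where u: "u \<in> nvert G" "v = f u" using vert by blast
      then have "G.walk_le k x u" "G.nbr u y" using v Suc nbr by auto
      then show "G.walk_le (Suc k) x y" unfolding G.walk_le_def by auto
    next
      assume "G.walk_le (Suc k) x y"
      then obtain u where u: "G.walk_le k x u" "G.nbr u y" unfolding G.walk_le_def by auto
      then have uv: "u \<in> nvert G" unfolding G.nbr_def by auto
      then have "H.walk_le k (f x) (f u)" "H.nbr (f u) (f y)" using u Suc nbr by auto
      then show "H.walk_le (Suc k) (f x) (f y)" unfolding H.walk_le_def by auto
    qed
  qed
qed

text \<open>The existential claim fixes the element type, while the example lives on maps between
  vectors.\<close>

lemma transport_diameter_6:
  fixes G :: "'a monoid" and f :: "'a \<Rightarrow> 'b"
  assumes G: "fin_group G" and f: "inj_on f (carrier G)" and sol: "solvable G"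
    and conn: "\<And>x y. x \<in> nvert G \<Longrightarrow> y \<in> nvert G \<Longrightarrow> \<exists>k. fin_group.walk_le G k x y"
    and far: "x0 \<in> nvert G" "y0 \<in> nvert G" "\<not> fin_group.walk_le G 5 x0 y0"
  shows "\<exists>H :: 'b monoid. group H \<and> finite (carrier H) \<and> solvable H \<and> ndiam H = 6"
proof -
  interpret G: fin_group G by fact
  obtain H :: "'b monoid" where H: "group H" and iso: "f \<in> iso G H"
    using group_isomorphic_copy[OF G.is_group f] by blast
  interpret H: group H by fact
  interpret f: group_hom G H f
    using iso by (simp add: group_hom_def group_hom_axioms_def iso_def G.is_group H.is_group)
  have im: "f ` carrier G = carrier H" using iso by (simp add: iso_def bij_betw_def)
  then have fin: "finite (carrier H)" using G.fin by (metis finite_imageI)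
  interpret H: fin_group H by unfold_locales (rule fin)
  have solH: "solvable H"
    using f.solvable_imp_solvable_img[of "carrier G"] sol im unfolding solvable_def by simp
  have vert: "f ` nvert G = nvert H" using iso_vert iso G.is_group H.is_group by blast
  have "nconnected H"
    unfolding H.nconnected_iff vert[symmetric]
    using conn iso_walk_le[OF G H.fin_group_axioms iso] by blast
  then have "ndiam H = 6"
    using H.ndiam_eq_6[OF solH, of "f x0" "f y0"] far iso_walk_le[OF G H.fin_group_axioms iso] vert by blast
  then show ?thesis using H fin solH by blast
qed

section \<open>A soluble group of diameter six\<close>

type_synonym f25 = "5 \<times> 5"
type_synonym vec = "f25 \<times> f25 \<times> f25"

text \<open>The pair \<open>(a, b)\<close> stands for \<open>a + b \<omega>\<close> in the field with \<open>25\<close> elements, where \<open>\<omega>\<^sup>2 + \<omega> + 1 = 0\<close>.\<close>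

definition om :: "f25 \<Rightarrow> f25" where "om = (\<lambda>(a, b). (- b, a - b))"

definition Rot :: "vec \<Rightarrow> vec" where "Rot = (\<lambda>(a, b, c). (om c, a, b))"

definition Om :: "vec \<Rightarrow> vec" where "Om = (\<lambda>(a, b, c). (om a, om b, om c))"

definition sg :: "bool \<Rightarrow> f25 \<Rightarrow> f25" where "sg e a = (if e then - a else a)"

definition Sg :: "bool \<Rightarrow> bool \<Rightarrow> vec \<Rightarrow> vec" where
  "Sg e f = (\<lambda>(a, b, c). (sg e a, sg f b, sg (e \<noteq> f) c))"

definition Lin :: "(vec \<Rightarrow> vec) set" where "Lin = {Sg e f \<circ> Rot ^^ k | e f k. True}"

definition Tr :: "vec \<Rightarrow> vec \<Rightarrow> vec" where "Tr w = (\<lambda>v. w + v)"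

text \<open>Realised by permutations of the vectors, so that associativity is that of composition
  and identities can be tested at single vectors.\<close>

definition Aff :: "(vec \<Rightarrow> vec) monoid" where
  "Aff = \<lparr>carrier = {Tr w \<circ> A | w A. A \<in> Lin}, monoid.mult = (\<circ>), one = id\<rparr>"

text \<open>A vector moved by every nontrivial element of \<open>Lin\<close>: the stabilisers of
  \<open>0\<close> and \<open>ones\<close> in \<open>Aff\<close> meet trivially, and evaluation at
  \<open>ones\<close> separates the elements of \<open>Lin\<close>.\<close>

definition ones :: vec where "ones = ((1, 0), (1, 0), (1, 0))"

section \<open>The linear group\<close>

lemma om_simps: "om (a + b) = om a + om b" "om (a - b) = om a - om b" "om (- a) = - om a" "om 0 = 0"
  "om (om (om a)) = a" "om (sg e a) = sg e (om a)"
  by (cases a; cases b; simp add: om_def sg_def zero_prod_def)+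

lemma om_fixed: "om a = a \<Longrightarrow> a = 0"
proof -
  have "\<forall>a b::5. (- b, a - b) = (a, b) \<longrightarrow> a = 0 \<and> b = 0" by code_simp
  then show "om a = a \<Longrightarrow> a = 0" by (cases a) (auto simp: om_def zero_prod_def)
qed

lemma sg_simps: "sg e (a + b) = sg e a + sg e b" "sg e (sg f a) = sg (e \<noteq> f) a" "sg False a = a" "sg e 0 = 0"
  by (auto simp: sg_def)

lemma Sg_add: "Sg e f (u + v) = Sg e f u + Sg e f v"
  by (cases u; cases v) (auto simp: Sg_def sg_def)

lemma Rot_add: "Rot (u + v) = Rot u + Rot v"
  by (cases u; cases v) (auto simp: Rot_def om_def)

lemma Sg_Sg: "Sg e f \<circ> Sg e' f' = Sg (e \<noteq> e') (f \<noteq> f')"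
proof -
  have *: "((e \<noteq> f) \<noteq> (e' \<noteq> f')) = ((e \<noteq> e') \<noteq> (f \<noteq> f'))" by auto
  show ?thesis by (rule ext) (auto simp only: Sg_def o_apply split_beta sg_simps * prod.sel)
qed

lemma Sg_id: "Sg False False = id"
  by (auto simp: Sg_def sg_simps)

lemma Rot_Sg: "Rot \<circ> Sg e f = Sg (e \<noteq> f) e \<circ> Rot"
proof -
  have *: "((e \<noteq> f) \<noteq> e) = f" by auto
  show ?thesis by (rule ext) (auto simp only: Sg_def Rot_def o_apply split_beta om_simps * prod.sel)
qed

lemma Rot3: "Rot ^^ 3 = Om"
  by (rule ext) (auto simp: Rot_def Om_def numeral_eq_Suc)

lemma Om3: "Om ^^ 3 = id"
  by (rule ext) (auto simp: Om_def om_simps numeral_eq_Suc)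

lemma Rot9: "Rot ^^ 9 = id"
  using Om3 unfolding Rot3[symmetric] by (simp add: funpow_mult)

lemma Rot_mod: "Rot ^^ k = Rot ^^ (k mod 9)"
proof -
  have "Rot ^^ (k mod 9 + 9 * (k div 9)) = Rot ^^ (k mod 9) \<circ> (Rot ^^ 9) ^^ (k div 9)"
    by (simp only: funpow_add funpow_mult)
  then show ?thesis by (simp add: Rot9)
qed

lemma Rot_pow_Sg: "\<exists>e' f'. Rot ^^ k \<circ> Sg e f = Sg e' f' \<circ> Rot ^^ k"
proof (induction k)
  case (Suc k)
  then obtain e' f' where *: "Rot ^^ k \<circ> Sg e f = Sg e' f' \<circ> Rot ^^ k" by blast
  have "Rot ^^ Suc k \<circ> Sg e f = Rot \<circ> (Rot ^^ k \<circ> Sg e f)" by (simp add: comp_assoc)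
  also have "\<dots> = (Rot \<circ> Sg e' f') \<circ> Rot ^^ k" unfolding * by (simp add: comp_assoc)
  also have "\<dots> = Sg (e' \<noteq> f') e' \<circ> Rot ^^ Suc k" unfolding Rot_Sg by (simp add: comp_assoc)
  finally show ?case by blast
qed auto

lemma LinI: "Sg e f \<circ> Rot ^^ k \<in> Lin" unfolding Lin_def by blast

lemma LinE: assumes "A \<in> Lin" obtains e f k where "A = Sg e f \<circ> Rot ^^ k" "k < 9"
proof -
  obtain e f k where "A = Sg e f \<circ> Rot ^^ k" using assms Lin_def by blast
  then have "A = Sg e f \<circ> Rot ^^ (k mod 9)" using Rot_mod by metis
  then show ?thesis by (rule that) simp
qed

lemma Sg_Lin: "Sg e f \<in> Lin" using LinI[of e f 0] by simp

lemma Rot_Lin: "Rot ^^ k \<in> Lin" using LinI[of False False k] by (simp add: Sg_id)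

lemma id_Lin: "id \<in> Lin" using Sg_Lin[of False False] by (simp add: Sg_id)

lemma Lin_comp: assumes "A \<in> Lin" "B \<in> Lin" shows "A \<circ> B \<in> Lin"
proof -
  obtain e f k where A: "A = Sg e f \<circ> Rot ^^ k" using LinE assms(1) by blast
  obtain e' f' l where B: "B = Sg e' f' \<circ> Rot ^^ l" using LinE assms(2) by blast
  obtain e'' f'' where *: "Rot ^^ k \<circ> Sg e' f' = Sg e'' f'' \<circ> Rot ^^ k" using Rot_pow_Sg by blast
  have "A \<circ> B = Sg e f \<circ> (Rot ^^ k \<circ> Sg e' f') \<circ> Rot ^^ l" unfolding A B by (simp only: comp_assoc)
  also have "\<dots> = (Sg e f \<circ> Sg e'' f'') \<circ> (Rot ^^ k \<circ> Rot ^^ l)" unfolding * by (simp only: comp_assoc)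
  also have "\<dots> = Sg (e \<noteq> e'') (f \<noteq> f'') \<circ> Rot ^^ (k + l)" unfolding Sg_Sg by (simp add: funpow_add)
  finally show ?thesis using LinI by simp
qed

lemma Lin_pow: "A \<in> Lin \<Longrightarrow> A ^^ n \<in> Lin"
  by (induction n) (auto simp: id_Lin Lin_comp)

lemma Lin_add: assumes "A \<in> Lin" shows "A (u + v) = A u + A v"
proof -
  obtain e f k where A: "A = Sg e f \<circ> Rot ^^ k" using LinE assms by blast
  have "(Rot ^^ k) (u + v) = (Rot ^^ k) u + (Rot ^^ k) v" by (induction k) (auto simp: Rot_add)
  then show ?thesis unfolding A by (simp add: Sg_add)
qed

lemma Lin_zero: "A \<in> Lin \<Longrightarrow> A 0 = 0"
  using Lin_add[of A 0 0] by simp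

lemma Lin_minus: "A \<in> Lin \<Longrightarrow> A (- v) = - A v"
  using Lin_add[of A v "- v"] Lin_zero[of A] by (metis add.right_inverse minus_unique)

lemma Lin_diff: "A \<in> Lin \<Longrightarrow> A (u - v) = A u - A v"
  using Lin_add[of A u "- v"] Lin_minus[of A v] by simp

lemma Lin_inverse: assumes "A \<in> Lin" shows "\<exists>B\<in>Lin. B \<circ> A = id"
proof -
  obtain e f k where A: "A = Sg e f \<circ> Rot ^^ k" using LinE assms by blast
  have "(Rot ^^ (8 * k) \<circ> Sg e f) \<circ> A = Rot ^^ (8 * k) \<circ> (Sg e f \<circ> Sg e f) \<circ> Rot ^^ k"
    unfolding A by (simp add: comp_assoc)
  also have "\<dots> = Rot ^^ (9 * k)" unfolding Sg_Sg by (simp add: Sg_id flip: funpow_add)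
  also have "\<dots> = id" using Rot_mod[of "9 * k"] by simp
  finally have "(Rot ^^ (8 * k) \<circ> Sg e f) \<circ> A = id" .
  then show ?thesis using Lin_comp[OF Rot_Lin Sg_Lin] by blast
qed

lemma Lin_inj: "A \<in> Lin \<Longrightarrow> A u = A v \<Longrightarrow> u = v"
  using Lin_inverse[of A] by (metis comp_apply id_apply)

section \<open>The affine group\<close>

lemma Aff_simps [simp]: "x \<otimes>\<^bsub>Aff\<^esub> y = x \<circ> y" "\<one>\<^bsub>Aff\<^esub> = id"
  by (simp_all add: Aff_def)

lemma AffI: "A \<in> Lin \<Longrightarrow> Tr w \<circ> A \<in> carrier Aff"
  unfolding Aff_def partial_object.simps by blast

lemma AffE: assumes "x \<in> carrier Aff" obtains w A where "x = Tr w \<circ> A" "A \<in> Lin"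
  using assms unfolding Aff_def partial_object.simps by blast

lemma Tr_comp: "Tr u \<circ> Tr v = Tr (u + v)" by (auto simp: Tr_def)

lemma Tr_zero: "Tr 0 = id" by (auto simp: Tr_def)

lemma Lin_Tr: "A \<in> Lin \<Longrightarrow> A \<circ> Tr w = Tr (A w) \<circ> A"
  by (auto simp: Tr_def Lin_add)

lemma Aff_fin_group: "fin_group Aff"
proof -
  have "group Aff"
  proof (rule groupI)
    fix x y assume xy: "x \<in> carrier Aff" "y \<in> carrier Aff"
    obtain u A where x: "x = Tr u \<circ> A" "A \<in> Lin" using AffE xy(1) .
    obtain v B where y: "y = Tr v \<circ> B" "B \<in> Lin" using AffE xy(2) .
    have "x \<circ> y = Tr u \<circ> (A \<circ> Tr v) \<circ> B" unfolding x y by (simp only: comp_assoc)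
    also have "\<dots> = (Tr u \<circ> Tr (A v)) \<circ> (A \<circ> B)" unfolding Lin_Tr[OF x(2)] by (simp only: comp_assoc)
    finally have "x \<circ> y = Tr (u + A v) \<circ> (A \<circ> B)" unfolding Tr_comp .
    then show "x \<otimes>\<^bsub>Aff\<^esub> y \<in> carrier Aff" using AffI[OF Lin_comp[OF x(2) y(2)]] by simp
  next
    show "\<one>\<^bsub>Aff\<^esub> \<in> carrier Aff" using AffI[OF id_Lin, of 0] by (simp add: Tr_zero)
  next
    fix x assume "x \<in> carrier Aff"
    then obtain u A where x: "x = Tr u \<circ> A" "A \<in> Lin" using AffE by blast
    obtain B where B: "B \<in> Lin" "B \<circ> A = id" using Lin_inverse x by blast
    have "(Tr (- B u) \<circ> B) \<circ> x = Tr (- B u) \<circ> (B \<circ> Tr u) \<circ> A" unfolding x by (simp only: comp_assoc)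
    also have "\<dots> = (Tr (- B u) \<circ> Tr (B u)) \<circ> (B \<circ> A)" unfolding Lin_Tr[OF B(1)] by (simp only: comp_assoc)
    also have "\<dots> = id" unfolding Tr_comp B by (simp add: Tr_zero)
    finally show "\<exists>y\<in>carrier Aff. y \<otimes>\<^bsub>Aff\<^esub> x = \<one>\<^bsub>Aff\<^esub>"
      unfolding Aff_simps using AffI[OF B(1), of "- B u"] by blast
  qed (auto simp: comp_assoc)
  then show ?thesis by (simp add: fin_group_def fin_group_axioms_def)
qed

interpretation E: fin_group Aff by (rule Aff_fin_group)

lemma E_pow: "x [^]\<^bsub>Aff\<^esub> (n::nat) = x ^^ n"
  by (induction n) (simp_all add: funpow_Suc_right del: funpow.simps)

lemma Lin_Aff: "A \<in> Lin \<Longrightarrow> A \<in> carrier Aff"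
  using AffI[of A 0] by (simp add: Tr_zero)

lemma Tr_Aff: "Tr w \<in> carrier Aff"
  using AffI[OF id_Lin, of w] by simp

lemma E_normalises_iff:
  assumes "x \<in> carrier Aff" "y \<in> carrier Aff"
  shows "E.normalises x y \<longleftrightarrow> (\<exists>i. x \<circ> y = y ^^ i \<circ> x)"
proof -
  have "E.conj x y = y [^]\<^bsub>Aff\<^esub> i \<longleftrightarrow> x \<otimes>\<^bsub>Aff\<^esub> y = y [^]\<^bsub>Aff\<^esub> i \<otimes>\<^bsub>Aff\<^esub> x" for i :: nat
    unfolding E.conj_def using assms E.inv_solve_right' E.nat_pow_closed E.m_closed by metis
  then show ?thesis unfolding E.normalises_def E_pow by simp
qed

lemma E_commute: "x \<in> carrier Aff \<Longrightarrow> y \<in> carrier Aff \<Longrightarrow> E.conj x y = y \<longleftrightarrow> x \<circ> y = y \<circ> x"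
  using E.conj_fix by simp

text \<open>If \<open>x y\<close> and \<open>t y x\<close> agree, then \<open>t\<close> is the commutator of \<open>x\<close> and \<open>y\<close>, hence a power of \<open>y\<close>.\<close>

lemma E_commutator_pow:
  assumes "x \<in> carrier Aff" "y \<in> carrier Aff" "t \<in> carrier Aff" "E.normalises x y" "x \<circ> y = t \<circ> y \<circ> x"
  shows "E.normalises x t"
proof -
  obtain i::nat where i: "E.conj x y = y [^]\<^bsub>Aff\<^esub> i" using assms E.normalises_def by auto
  have "E.conj x y = t \<otimes>\<^bsub>Aff\<^esub> y" unfolding E.conj_def using assms(1-3,5)
    by (metis Aff_simps(1) E.inv_solve_right' E.m_closed)
  then have "t = y [^]\<^bsub>Aff\<^esub> i \<otimes>\<^bsub>Aff\<^esub> inv\<^bsub>Aff\<^esub> y" using i assms(2,3)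
    by (metis E.inv_solve_right E.nat_pow_closed)
  moreover obtain k::nat where "inv\<^bsub>Aff\<^esub> y = y [^]\<^bsub>Aff\<^esub> k" using E.inv_eq_pow assms(2) by blast
  ultimately have "t = y [^]\<^bsub>Aff\<^esub> (i + k)" using E.nat_pow_mult assms(2) by simp
  then show ?thesis using E.normalises_pow_right assms by simp
qed

section \<open>Neighbourhoods of \<open>Om\<close> and \<open>Rot\<close>\<close>

lemma Om_Lin: "Om \<in> Lin" using Rot_Lin[of 3] by (simp add: Rot3)

lemma Om_fixed: "Om w = w \<Longrightarrow> w = 0"
  by (cases w) (auto simp: Om_def zero_prod_def dest: om_fixed)

lemma Om_ne_id: "Om \<noteq> id"
proof
  assume "Om = id"
  then have "Om ones = ones" by simp
  then have "ones = 0" by (rule Om_fixed)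
  then show False by (simp add: ones_def zero_prod_def)
qed

lemma Om_commute: assumes "A \<in> Lin" shows "Om \<circ> A = A \<circ> Om"
proof -
  obtain e f k where A: "A = Sg e f \<circ> Rot ^^ k" using LinE assms by blast
  have s: "Om \<circ> Sg e f = Sg e f \<circ> Om"
    by (rule ext) (auto simp only: Om_def Sg_def o_apply split_beta prod.sel om_simps)
  have "Om \<circ> Rot ^^ k = Rot ^^ k \<circ> Om" unfolding Rot3[symmetric] by (simp add: add.commute flip: funpow_add)
  then have *: "(Om \<circ> Sg e f) \<circ> Rot ^^ k = (Sg e f \<circ> Rot ^^ k) \<circ> Om" unfolding s by (simp only: comp_assoc)
  show ?thesis unfolding A using * by (simp only: comp_assoc)
qed

text \<open>The iterate is the multiple \<open>l a\<close>. The polynomial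
  \<open>X^2 + X + 1\<close> has no root modulo 5, so \<open>om\<close> preserves no line over the
  prime field.\<close>

lemma no_eigenvector: assumes "om a = ((\<lambda>b. a + b) ^^ l) 0" shows "a = 0"
proof -
  obtain x y where a: "a = (x, y)" by (cases a)
  have "((\<lambda>b. a + b) ^^ l) 0 = (of_nat l * x, of_nat l * y)"
    by (induction l) (auto simp: a zero_prod_def algebra_simps)
  then have eq: "- y = of_nat l * x" "x - y = of_nat l * y" using assms by (auto simp: a om_def)
  have "\<forall>i x y::5. - y = i * x \<and> x - y = i * y \<longrightarrow> x = 0 \<and> y = 0" by code_simp
  then show ?thesis using eq by (auto simp: a zero_prod_def)
qed

text \<open>If \<open>g\<close> normalises the group of \<open>Om\<close>, evaluation at
  \<open>0\<close> makes \<open>g 0\<close> a fixed point of \<open>Om\<close>. In the other case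
  the commutator of \<open>Om\<close> and \<open>g\<close> is a translation, as \<open>Om\<close> is
  central in \<open>Lin\<close>; it is a power of \<open>g\<close> normalised by \<open>Om\<close>,
  hence trivial by \<open>no_eigenvector\<close>.\<close>

lemma near_Om:
  assumes "E.nbr g Om" shows "g \<in> Lin"
proof -
  have gc: "g \<in> carrier Aff" using assms by (auto simp: E.nbr_def E.nvert_iff)
  then obtain w A where g: "g = Tr w \<circ> A" and A: "A \<in> Lin" using AffE by blast
  have g0: "g 0 = w" using A by (simp add: g Tr_def Lin_zero)
  have oc: "Om \<in> carrier Aff" using Lin_Aff Om_Lin by blast
  have "w = 0"
  proof (cases "E.normalises g Om")
    case True
    then obtain i where i: "g \<circ> Om = Om ^^ i \<circ> g" using E_normalises_iff gc oc by blast
    have i3: "\<not> 3 dvd i"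
    proof
      assume "3 dvd i"
      then obtain q where "i = 3 * q" by auto
      then have "Om ^^ i = id" by (metis Om3 funpow_mult id_funpow)
      then have "g \<otimes>\<^bsub>Aff\<^esub> Om = g \<otimes>\<^bsub>Aff\<^esub> \<one>\<^bsub>Aff\<^esub>" using i by simp
      then have "Om = id" using gc oc E.l_cancel by (metis Aff_simps(2) E.one_closed)
      then show False using Om_ne_id by simp
    qed
    have "(g \<circ> Om) 0 = (Om ^^ i \<circ> g) 0" using i by simp
    then have "(Om ^^ i) w = w" using g0 Lin_zero[OF Om_Lin] by simp
    moreover have "(Om ^^ 3) w = w" by (simp add: Om3)
    moreover have "Factorial_Ring.prime (3::nat)" by simp
    then have "coprime i 3" using i3 by (metis coprime_commute prime_imp_coprime)
    moreover have "i \<noteq> 0" using i3 by (intro notI) simp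
    ultimately show ?thesis using funpow_coprime_fix Om_fixed by metis
  next
    case False
    then have normalises: "E.normalises Om g" using assms E.nbr_def by auto
    let ?z = "Om w - w"
    have "Om \<circ> g = Tr (Om w) \<circ> (Om \<circ> A)" 
      unfolding g comp_assoc[symmetric] Lin_Tr[OF Om_Lin, of w] ..
    also have "\<dots> = (Tr ?z \<circ> Tr w) \<circ> (A \<circ> Om)" unfolding Om_commute[OF A] Tr_comp by simp
    finally have "Om \<circ> g = Tr ?z \<circ> g \<circ> Om" unfolding g by (simp add: comp_assoc)
    then have "E.normalises Om (Tr ?z)" using E_commutator_pow[OF oc gc Tr_Aff normalises] by blast
    then obtain l where "Om \<circ> Tr ?z = Tr ?z ^^ l \<circ> Om" using E_normalises_iff oc Tr_Aff by blast
    then have "(Om \<circ> Tr ?z) 0 = (Tr ?z ^^ l \<circ> Om) 0" by simp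
    then have z: "Om ?z = (Tr ?z ^^ l) 0" using Lin_zero[OF Om_Lin] by (simp add: Tr_def)
    obtain a b c where abc: "?z = (a, b, c)" by (cases ?z) auto
    have "(Tr (a, b, c) ^^ l) 0 = (((\<lambda>x. a + x) ^^ l) 0, ((\<lambda>x. b + x) ^^ l) 0, ((\<lambda>x. c + x) ^^ l) 0)"
      by (induction l) (auto simp: Tr_def zero_prod_def)
    then have "om a = ((\<lambda>x. a + x) ^^ l) 0" "om b = ((\<lambda>x. b + x) ^^ l) 0" "om c = ((\<lambda>x. c + x) ^^ l) 0"
      using z unfolding abc by (auto simp: Om_def)
    then have "?z = 0" using no_eigenvector abc by (simp add: zero_prod_def)
    then show ?thesis using Om_fixed by simp
  qed
  then show ?thesis using g A Tr_zero by simp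
qed

lemma Lin_power_Om:
  assumes "0 < k" "k < 9" shows "\<exists>j. (Sg e f \<circ> Rot ^^ k) ^^ j = Om"
proof -
  have pw: "(F ^^ 2) v = F (F v)" "(F ^^ 3) v = F (F (F v))" "(F ^^ 4) v = F (F (F (F v)))"
    "(F ^^ 5) v = F (F (F (F (F v))))" "(F ^^ 6) v = F (F (F (F (F (F v)))))"
    "(F ^^ 7) v = F (F (F (F (F (F (F v))))))" "(F ^^ 8) v = F (F (F (F (F (F (F (F v)))))))"
    for F :: "vec \<Rightarrow> vec" and v by (simp_all add: numeral_eq_Suc)
  have k: "k = 1 \<or> k = 2 \<or> k = 3 \<or> k = 4 \<or> k = 5 \<or> k = 6 \<or> k = 7 \<or> k = 8" using assms by auto
  \<comment> \<open>For \<open>k\<close> prime to 3 the signs cancel in the cube, which is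
    \<open>Om ^^ k\<close>; a further square is taken when \<open>k\<close> is 2 modulo 3. For
    \<open>k = 3\<close> and \<open>k = 6\<close> an even exponent kills the signs, and the scalar
    part becomes \<open>Om ^^ 4 = Om\<close>.\<close>
  define j :: nat where "j = (if k = 1 \<or> k = 4 \<or> k = 7 then 3 else if k = 3 then 4 else if k = 6 then 2 else 6)"
  have "((Sg e f \<circ> Rot ^^ k) ^^ j) (a, b, c) = Om (a, b, c)" for a b c
    using k by (elim disjE; cases e; cases f; simp add: j_def pw Om_def Rot_def Sg_def sg_def om_simps)
  then show ?thesis by (intro exI[of _ j] ext) auto
qed


lemma E_nbr_pow: assumes "E.nbr a z" "z ^^ j \<noteq> id" shows "E.nbr a (z ^^ j)"
proof -
  have "a \<in> carrier Aff" "z \<in> carrier Aff" using assms by (auto simp: E.nbr_def E.nvert_iff)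
  then have "z ^^ j \<in> nvert Aff" "E.normalises a z \<Longrightarrow> E.normalises a (z ^^ j)" "E.normalises z a \<Longrightarrow> E.normalises (z ^^ j) a"
    using assms(2) E.normalises_pow_right[of a z j] E.normalises_pow_left[of z a j] E.nat_pow_closed[of z j]
    unfolding E_pow E.nvert_iff by simp_all
  then show ?thesis using assms(1) unfolding E.nbr_def by blast
qed

lemma Sg_ones: "Sg e f ones = Sg e' f' ones \<Longrightarrow> e = e' \<and> f = f'"
proof -
  have "\<forall>e f e' f'. Sg e f ones = Sg e' f' ones \<longrightarrow> e = e' \<and> f = f'" by code_simp
  then show "Sg e f ones = Sg e' f' ones \<Longrightarrow> e = e' \<and> f = f'" by blast
qed

lemma less_9: "(k::nat) < 9 \<Longrightarrow> k \<in> set [0, 1, 2, 3, 4, 5, 6, 7, 8]" by auto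

lemma Sg_Rot_ones: assumes "k < 9" "Sg e f ((Rot ^^ k) ones) = ones" shows "k = 0 \<and> \<not> e \<and> \<not> f"
proof -
  have "\<forall>e f. list_all (\<lambda>k. Sg e f ((Rot ^^ k) ones) = ones \<longrightarrow> k = 0 \<and> \<not> e \<and> \<not> f) [0, 1, 2, 3, 4, 5, 6, 7, 8]"
    by code_simp
  then show ?thesis using less_9[OF assms(1)] assms(2) unfolding list_all_iff by blast
qed

lemma Sg_pow: "Sg e f ^^ n = id \<or> Sg e f ^^ n = Sg e f"
proof (induction n)
  case (Suc n)
  have "Sg e f \<circ> Sg e f = id" unfolding Sg_Sg by (simp add: Sg_id)
  then show ?case using Suc unfolding funpow.simps(2) by (elim disjE) (simp_all only: comp_id simp_thms)
qed simp

text \<open>\<open>Om\<close> is a power of \<open>Rot\<close>, so neighbours of \<open>Rot\<close>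
  are linear by \<open>near_Om\<close>; it remains to exclude the signs.\<close>

lemma near_Rot:
  assumes nb: "E.nbr g Rot" shows "\<exists>k. 0 < k \<and> k < 9 \<and> g = Rot ^^ k"
proof -
  have "E.nbr g Om" using E_nbr_pow[OF nb, of 3] Om_ne_id unfolding Rot3 by simp
  then have "g \<in> Lin" by (rule near_Om)
  then obtain e f k where g: "g = Sg e f \<circ> Rot ^^ k" and k: "k < 9" by (rule LinE)
  have gc: "g \<in> carrier Aff" and g1: "g \<noteq> id" using nb by (auto simp: E.nbr_def E.nvert_iff)
  have rc: "Rot \<in> carrier Aff" using Lin_Aff Rot_Lin[of 1] by simp
  have "\<not> e \<and> \<not> f"
  proof (cases "E.normalises g Rot")
    case True
    then obtain i where i: "g \<circ> Rot = Rot ^^ i \<circ> g" using E_normalises_iff gc rc by blast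
    have "(Sg e f \<circ> Rot) \<circ> Rot ^^ k = (Rot ^^ i \<circ> Sg e f) \<circ> Rot ^^ k"
      using i unfolding g by (simp add: comp_assoc funpow_swap1 flip: funpow.simps(2) funpow_Suc_right)
    then have "Sg e f \<circ> Rot = Rot ^^ i \<circ> Sg e f"
      using E.right_cancel[of "Rot ^^ k" "Sg e f \<circ> Rot" "Rot ^^ i \<circ> Sg e f"]
        Lin_Aff Rot_Lin[of k] Lin_comp[OF Sg_Lin Rot_Lin[of 1]] Lin_comp[OF Rot_Lin Sg_Lin] by simp
    \<comment> \<open>At \<open>Sg e f ones\<close> the signs on the right cancel, which leaves
      finitely many equations to check.\<close>
    from comp_eq_dest[OF this, of "Sg e f ones"]
    have "Sg e f (Rot (Sg e f ones)) = (Rot ^^ i \<circ> (Sg e f \<circ> Sg e f)) ones" by simp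
    also have "\<dots> = (Rot ^^ (i mod 9)) ones"
      unfolding Sg_Sg by (simp add: Sg_id flip: Rot_mod)
    finally have eq: "Sg e f (Rot (Sg e f ones)) = (Rot ^^ (i mod 9)) ones" by simp
    have "\<forall>e f. list_all (\<lambda>k. Sg e f (Rot (Sg e f ones)) = (Rot ^^ k) ones \<longrightarrow> \<not> e \<and> \<not> f) [0, 1, 2, 3, 4, 5, 6, 7, 8]"
      by code_simp
    moreover have "i mod 9 \<in> set [0, 1, 2, 3, 4, 5, 6, 7, 8]" by (rule less_9) simp
    ultimately show ?thesis using eq unfolding list_all_iff by blast
  next
    case False
    then have normalises: "E.normalises Rot g" using nb E.nbr_def by auto
    \<comment> \<open>The commutator of \<open>Rot\<close> and \<open>g\<close>. It is normalised by
      \<open>Rot\<close>, and its conjugate under \<open>Rot\<close> is \<open>Sg e f\<close>, so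
      \<open>Sg e f\<close> would be a power of \<open>?t\<close>.\<close>
    let ?t = "Sg f (e \<noteq> f)"
    have "Rot \<circ> g = (Rot \<circ> Sg e f) \<circ> Rot ^^ k" unfolding g by (simp only: comp_assoc)
    also have "\<dots> = Sg (e \<noteq> f) e \<circ> (Rot ^^ k \<circ> Rot)"
      unfolding Rot_Sg by (simp add: comp_assoc flip: funpow.simps(2) funpow_Suc_right)
    also have "Sg (e \<noteq> f) e = ?t \<circ> Sg e f" unfolding Sg_Sg by (cases e; cases f) auto
    finally have "Rot \<circ> g = ?t \<circ> g \<circ> Rot" unfolding g by (simp only: comp_assoc)
    then have "E.normalises Rot ?t" using E_commutator_pow[OF rc gc Lin_Aff[OF Sg_Lin] normalises] by blast
    then obtain l where "Rot \<circ> ?t = ?t ^^ l \<circ> Rot" using E_normalises_iff rc Lin_Aff[OF Sg_Lin] by blast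
    moreover have "Rot \<circ> ?t = Sg e f \<circ> Rot" unfolding Rot_Sg by (cases e; cases f) auto
    ultimately have "Sg e f \<circ> Rot = ?t ^^ l \<circ> Rot" by simp
    then have "Sg e f = ?t ^^ l"
      using E.right_cancel[of Rot "Sg e f" "?t ^^ l"] rc Lin_Aff Sg_Lin Lin_pow by simp
    then have "Sg e f = Sg False False \<or> Sg e f = ?t" using Sg_pow[where e = f and f = "e \<noteq> f" and n = l] unfolding Sg_id by auto
    then have "Sg e f ones = Sg False False ones \<or> Sg e f ones = ?t ones" by auto
    then show ?thesis using Sg_ones by blast
  qed
  then have "g = Rot ^^ k" using g by (simp add: Sg_id)
  moreover have "k \<noteq> 0" using calculation g1 by (intro notI) simp
  ultimately show ?thesis using k by blast
qed

text \<open>The intermediate vertex is a nontrivial power of \<open>Rot\<close>, and every such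
  power has \<open>Om\<close> among its powers; so \<open>a\<close> is adjacent to
  \<open>Om\<close>.\<close>

lemma ball_2_Lin: assumes "E.walk_le 2 Rot a" shows "a \<in> Lin"
proof -
  obtain z where z: "E.nbr Rot z" "E.nbr z a"
    using assms unfolding E.walk_le_def numeral_2_eq_2 by auto
  obtain k where k: "0 < k" "k < 9" "z = Rot ^^ k" using near_Rot[OF E.nbr_sym[OF z(1)]] by blast
  obtain j where "(Sg False False \<circ> Rot ^^ k) ^^ j = Om" using Lin_power_Om[OF k(1,2)] by blast
  then have "z ^^ j = Om" unfolding k(3) Sg_id by simp
  then show ?thesis using E_nbr_pow[OF E.nbr_sym[OF z(2)], of j] Om_ne_id near_Om by simp
qed

section \<open>Two vertices at distance greater than 5\<close>

lemma inv_Tr: "inv\<^bsub>Aff\<^esub> (Tr w) = Tr (- w)"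
  by (rule E.inv_equality) (simp_all add: Tr_comp Tr_zero Tr_Aff)

lemma conj_Tr: "E.conj (Tr w) B = Tr w \<circ> B \<circ> Tr (- w)"
  unfolding E.conj_def inv_Tr by simp

text \<open>Excludes edges between the stabilisers of \<open>0\<close> and of \<open>ones\<close>.
  The sign of \<open>n\<close> covers both directions: an edge read backwards is translated by
  \<open>- ones\<close>.\<close>

lemma no_cross_normalizing:
  assumes A: "A \<in> Lin" "A \<noteq> id" and A': "A' \<in> Lin" "A' \<noteq> id" and n: "n = ones \<or> n = - ones"
  shows "\<not> E.normalises A (E.conj (Tr n) A')"
proof
  assume "E.normalises A (E.conj (Tr n) A')"
  then obtain i where i: "A \<circ> E.conj (Tr n) A' = E.conj (Tr n) A' ^^ i \<circ> A"
    using E_normalises_iff[OF Lin_Aff[OF A(1)] E.conj_closed[OF Tr_Aff Lin_Aff[OF A'(1)]]] by blast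
  define B where "B = A' ^^ i"
  have B: "B \<in> Lin" unfolding B_def by (rule Lin_pow[OF A'(1)])
  have "E.conj (Tr n) A' ^^ i = E.conj (Tr n) B"
    using E.conj_pow[OF Tr_Aff Lin_Aff[OF A'(1)], of n i] unfolding E_pow B_def by simp
  then have "A \<circ> E.conj (Tr n) A' = E.conj (Tr n) B \<circ> A" using i by simp
  from comp_eq_dest[OF this] have ev: "A (n + A' (v - n)) = n + B (A v - n)" for v
    unfolding conj_Tr by (simp add: Tr_def)
  \<comment> \<open>\<open>B\<close> fixes \<open>A n - n\<close>, which is nonzero as
    \<open>A\<close> moves \<open>ones\<close>. An element having \<open>Om\<close> as a power fixes
    no nonzero vector, so \<open>B\<close> must be a sign change.\<close>
  have Bz: "B (A n - n) = A n - n" using ev[of n] Lin_zero[OF A'(1)] by (simp add: algebra_simps)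
  have ev0: "A (n - A' n) = n - B n"
    using ev[of 0] by (simp add: Lin_zero[OF A(1)] Lin_minus[OF A'(1)] Lin_minus[OF B])
  have comm: "A \<circ> A' = B \<circ> A"
  proof
    fix v
    have "A (n + A' v - A' n) = n + B (A v) - B n"
      using ev[of v] by (simp add: Lin_diff[OF A'(1)] Lin_diff[OF B] algebra_simps)
    moreover have "A (n + A' v - A' n) = A (A' v) + A (n - A' n)"
      using Lin_add[OF A(1), of "A' v" "n - A' n"] by (simp add: algebra_simps)
    ultimately have "A (A' v) = B (A v)" using ev0 by (simp add: algebra_simps)
    then show "(A \<circ> A') v = (B \<circ> A) v" by simp
  qed
  have Bid: "B \<noteq> id"
  proof
    assume "B = id"
    then have "A (A' v) = A v" for v using comp_eq_dest[OF comm, of v] by simp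
    then have "A' = id" using Lin_inj[OF A(1)] by (intro ext) simp
    then show False using A' by simp
  qed
  have Aones: "A ones \<noteq> ones"
  proof
    obtain e f k where "A = Sg e f \<circ> Rot ^^ k" "k < 9" using A(1) by (rule LinE)
    moreover assume "A ones = ones"
    ultimately show False using Sg_Rot_ones[of k e f] A(2) Sg_id by simp
  qed
  let ?z = "A ones - ones"
  have Bz': "B ?z = ?z"
  proof (cases "n = ones")
    case False
    then have "A n - n = - ?z" using n Lin_minus[OF A(1)] by simp
    then show ?thesis using Bz Lin_minus[OF B, of ?z] by (metis neg_equal_iff_equal)
  qed (use Bz in simp)
  obtain e f k where Bk: "B = Sg e f \<circ> Rot ^^ k" "k < 9" using B by (rule LinE)
  have k0: "k = 0"
  proof (rule ccontr)
    assume "k \<noteq> 0"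
    then obtain j where "B ^^ j = Om" using Lin_power_Om[of k e f] Bk by auto
    then have "Om ?z = ?z" using funpow_fix[of B ?z j] Bz' by simp
    then have "?z = 0" by (rule Om_fixed)
    then show False using Aones by simp
  qed
  then have BS: "B = Sg e f" using Bk by simp
  have ef: "e \<or> f" using BS Bid Sg_id by auto
  obtain e' f' l where Al: "A = Sg e' f' \<circ> Rot ^^ l" "l < 9" using A(1) by (rule LinE)
  \<comment> \<open>Each sign change fixes one coordinate axis, so few \<open>A\<close> remain:
    besides the identity only \<open>Rot\<close> and its inverse \<open>Rot ^^ 8\<close>, each with
    one \<open>B\<close>.\<close>
  have "\<forall>e f e' f'. list_all (\<lambda>l. (e \<or> f) \<and> Sg e f (Sg e' f' ((Rot ^^ l) ones) - ones) = Sg e' f' ((Rot ^^ l) ones) - ones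
      \<longrightarrow> \<not> e' \<and> \<not> f' \<and> (l = 0 \<or> l = 1 \<and> \<not> e \<and> f \<or> l = 8 \<and> e \<and> f)) [0, 1, 2, 3, 4, 5, 6, 7, 8]"
    by code_simp
  moreover have "Sg e f (Sg e' f' ((Rot ^^ l) ones) - ones) = Sg e' f' ((Rot ^^ l) ones) - ones"
    using Bz' unfolding BS Al(1) o_apply .
  ultimately have "\<not> e' \<and> \<not> f' \<and> (l = 0 \<or> l = 1 \<and> \<not> e \<and> f \<or> l = 8 \<and> e \<and> f)"
    using less_9[OF Al(2)] ef unfolding list_all_iff by blast
  then have "A = id \<or> A = Rot \<and> B = Sg False True \<or> A = Rot ^^ 8 \<and> B = Sg True True"
    using Al BS by (auto simp: Sg_id)
  then consider (1) "A = Rot" "B = Sg False True" | (8) "A = Rot ^^ 8" "B = Sg True True" using A(2) by blast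
  then show False
  proof cases
    case 1
    \<comment> \<open>The relation between linear parts determines \<open>A'\<close> as a sign
      change different from \<open>B\<close>, while \<open>B\<close> is a nontrivial power of
      \<open>A'\<close>.\<close>
    have "Rot \<circ> Sg True True = Sg False True \<circ> Rot" unfolding Rot_Sg by simp
    from comp_eq_dest[OF this] have "A (A' v) = A (Sg True True v)" for v
      using comp_eq_dest[OF comm, of v] unfolding 1 by simp
    then have "A' = Sg True True" using Lin_inj[OF A(1)] by (intro ext) blast
    then have "B = id \<or> B = Sg True True" using Sg_pow B_def by simp
    then have "Sg False True ones = Sg False False ones \<or> Sg False True ones = Sg True True ones"
      using 1 Sg_id by auto
    then show False using Sg_ones by blast
  next
    case 8
    have r: "Rot ((Rot ^^ 8) v) = (Rot ^^ 9) v" for v by (simp add: numeral_eq_Suc)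
    then have r8: "Rot (A v) = v" for v unfolding 8 by (simp add: Rot9)
    have "A' v = Sg False True v" for v
    proof -
      have "A' v = Rot (B (A v))" using comp_eq_dest[OF comm, of v] r8[of "A' v"] by simp
      also have "\<dots> = Sg False True v"
        using comp_eq_dest[of Rot "Sg True True" "Sg False True" Rot "A v"] Rot_Sg[of True True] r8[of v] 8 by simp
      finally show ?thesis .
    qed
    then have "A' = Sg False True" by (intro ext)
    then have "B = id \<or> B = Sg False True" using Sg_pow B_def by simp
    then have "Sg True True ones = Sg False False ones \<or> Sg True True ones = Sg False True ones"
      using 8 Sg_id by auto
    then show False using Sg_ones by blast
  qed
qed

lemma Rot_vert: "Rot \<in> nvert Aff"
proof -
  have "Rot \<noteq> id" using Om_ne_id by (metis Rot3 id_funpow)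
  then show ?thesis using Lin_Aff Rot_Lin[of 1] by (simp add: E.nvert_iff)
qed

text \<open>5 = 2 + 1 + 2: the balls of radius 2 lie in the stabilisers of \<open>0\<close> and of
  \<open>ones\<close>, and the middle edge is impossible.\<close>

lemma far_apart: "\<not> E.walk_le 5 Rot (E.conj (Tr ones) Rot)"
proof
  assume "E.walk_le 5 Rot (E.conj (Tr ones) Rot)"
  then have "(E.nbr ^^ (2 + (1 + 2))) Rot (E.conj (Tr ones) Rot)" by (simp add: E.walk_le_def)
  then obtain a b where ab: "E.walk_le 2 Rot a" "E.nbr a b" "E.walk_le 2 b (E.conj (Tr ones) Rot)"
    unfolding relpowp_add E.walk_le_def by auto
  have v: "a \<in> carrier Aff" "a \<noteq> id" "b \<in> carrier Aff" "b \<noteq> id"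
    using ab(2) by (auto simp: E.nbr_def E.nvert_iff)
  define b' where "b' = E.conj (Tr (- ones)) b"
  have inv: "E.conj (Tr (- ones)) (E.conj (Tr ones) x) = x" "E.conj (Tr ones) (E.conj (Tr (- ones)) x) = x"
    if "x \<in> carrier Aff" for x using E.conj_inv_conj[OF Tr_Aff[of ones] that] unfolding inv_Tr .
  obtain c where c: "E.nbr b c" "E.nbr c (E.conj (Tr ones) Rot)" using ab(3) unfolding E.walk_le_def numeral_2_eq_2 by auto
  have "E.nbr b' (E.conj (Tr (- ones)) c)" "E.nbr (E.conj (Tr (- ones)) c) Rot"
    using E.nbr_conj[OF c(1) Tr_Aff] E.nbr_conj[OF c(2) Tr_Aff, of "- ones"] inv Rot_vert
    unfolding b'_def by (auto simp: E.nvert_iff)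
  then have "E.walk_le 2 Rot b'" using E.walk_le_2 E.nbr_sym by blast
  then have L: "a \<in> Lin" "b' \<in> Lin" using ab(1) ball_2_Lin by auto
  have b: "b = E.conj (Tr ones) b'" using inv v b'_def by simp
  have b1: "b' \<noteq> id" using v E.conj_eq_one[OF Tr_Aff v(3)] unfolding b'_def by simp
  have "E.normalises a b \<or> E.normalises b a" using ab(2) E.nbr_def by auto
  then show False
  proof
    assume "E.normalises a b"
    then show False using no_cross_normalizing[OF L(1) v(2) L(2) b1] b by blast
  next
    assume "E.normalises b a"
    then have "E.normalises b' (E.conj (Tr (- ones)) a)" unfolding b'_def using E.normalises_conj[OF Tr_Aff v(3,1)] by blast
    then show False using no_cross_normalizing[OF L(2) b1 L(1) v(2)] by blast
  qed
qed

section \<open>Connectedness of the example\<close>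

lemma Tr_vert: assumes "u \<noteq> 0" shows "Tr u \<in> nvert Aff"
proof -
  have "Tr u 0 = u" by (simp add: Tr_def)
  then have "Tr u \<noteq> id" using assms by force
  then show ?thesis using Tr_Aff by (simp add: E.nvert_iff)
qed

text \<open>\<open>1 - \<omega>\<close> is invertible in the field, so every affine map with linear
  part \<open>Om\<close> has a fixed point and is conjugate to \<open>Om\<close> by a
  translation.\<close>

lemma om_minus_surj: "\<exists>c. c - om c = a"
proof -
  have "\<forall>x y::5. \<exists>c d. c + d = x \<and> d - (c - d) = y" by code_simp
  then obtain c d where "c + d = fst a" "d - (c - d) = snd a" by blast
  then show ?thesis by (intro exI[of _ "(c, d)"]) (cases a, simp add: om_def)
qed

lemma reaches_translation:
  assumes "g \<in> nvert Aff" shows "\<exists>u k. u \<noteq> 0 \<and> E.walk_le k g (Tr u)"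
proof -
  have gc: "g \<in> carrier Aff" "g \<noteq> id" using assms by (auto simp: E.nvert_iff)
  obtain w A where g: "g = Tr w \<circ> A" "A \<in> Lin" using gc(1) by (rule AffE)
  obtain e f k where A: "A = Sg e f \<circ> Rot ^^ k" "k < 9" using g(2) by (rule LinE)
  show ?thesis
  proof (cases "k = 0")
    case True
    \<comment> \<open>The number of minus signs is even, so at least one of the three coordinates is
      left unchanged.\<close>
    define u :: vec where "u = (if \<not> e then ((1, 0), 0, 0) else if \<not> f then (0, (1, 0), 0) else (0, 0, (1, 0)))"
    have u: "u \<noteq> 0" "A u = u" unfolding A(1) True u_def by (auto simp: Sg_def sg_def zero_prod_def)
    have "g \<circ> Tr u = Tr u \<circ> g"
      unfolding g(1) by (rule ext) (simp add: Tr_def Lin_add[OF g(2)] u algebra_simps)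
    then have "E.nbr g (Tr u)" 
      using E.nbr_commI[OF assms Tr_vert[OF u(1)]] E_commute[OF gc(1) Tr_Aff] by simp
    then show ?thesis using u(1) E.walk_le_1 by blast
  next
    case False
    then obtain j where j: "A ^^ j = Om" using Lin_power_Om[of k e f] A by auto
    have "\<exists>w'. g ^^ i = Tr w' \<circ> A ^^ i" for i
    proof (induction i)
      case 0
      then show ?case by (intro exI[of _ 0]) (simp add: Tr_zero)
    next
      case (Suc i)
      then obtain w' where "g ^^ i = Tr w' \<circ> A ^^ i" by blast
      then have "g ^^ Suc i = Tr w \<circ> (A \<circ> Tr w') \<circ> A ^^ i" unfolding g(1) by (simp add: comp_assoc)
      also have "\<dots> = (Tr w \<circ> Tr (A w')) \<circ> A ^^ Suc i" unfolding Lin_Tr[OF g(2)] by (simp add: comp_assoc)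
      finally show ?case unfolding Tr_comp by blast
    qed
    then obtain w' where w': "g ^^ j = Tr w' \<circ> Om" using j by metis
    obtain a b c where abc: "w' = (a, b, c)" by (cases w') auto
    obtain a' b' c' where "a' - om a' = a" "b' - om b' = b" "c' - om c' = c" using om_minus_surj by metis
    then have "(a', b', c') - Om (a', b', c') = w'" unfolding abc by (simp add: Om_def)
    then obtain z where z: "z - Om z = w'" by blast
    have gj: "g ^^ j = E.conj (Tr z) Om"
      unfolding w' conj_Tr z[symmetric]
      by (rule ext) (simp add: Tr_def Lin_diff[OF Om_Lin] algebra_simps)
    \<comment> \<open>\<open>Sg False True\<close> commutes with \<open>Om\<close> and fixes the
      first axis. Its conjugate by \<open>Tr z\<close> therefore links \<open>g ^^ j\<close> to a
      translation.\<close>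
    define h where "h = E.conj (Tr z) (Sg False True)"
    define u :: vec where "u = ((1, 0), 0, 0)"
    have u: "u \<noteq> 0" unfolding u_def by (simp add: zero_prod_def)
    have Su: "Sg False True u = u" unfolding u_def by (simp add: Sg_def sg_def)
    have Sn: "Sg False True \<noteq> id" using Sg_ones[of False True False False] unfolding Sg_id by auto
    have hv: "h \<in> nvert Aff"
      using E.conj_eq_one[OF Tr_Aff Lin_Aff[OF Sg_Lin]] Sn Tr_Aff Lin_Aff[OF Sg_Lin]
      unfolding h_def E.nvert_iff by simp
    have gjv: "g ^^ j \<in> nvert Aff"
      using E.conj_eq_one[OF Tr_Aff Lin_Aff[OF Om_Lin]] Om_ne_id Tr_Aff Lin_Aff[OF Om_Lin]
      unfolding gj E.nvert_iff by simp
    have "E.nbr g (g ^^ j)" using E_nbr_pow[OF E.nbr_refl[OF assms], of j] gjv by (simp add: E.nvert_iff)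
    moreover have "E.nbr (g ^^ j) h"
    proof (rule E.nbr_commI[OF gjv hv])
      have "E.conj Om (Sg False True) = Sg False True"
        using E_commute[OF Lin_Aff[OF Om_Lin] Lin_Aff[OF Sg_Lin]] Om_commute[OF Sg_Lin] by blast
      then show "E.conj (g ^^ j) h = h"
        using E.conj_conj_conj[OF Tr_Aff[of z] Lin_Aff[OF Om_Lin] Lin_Aff[OF Sg_Lin[of False True]]]
        unfolding gj h_def by simp
    qed
    moreover have "E.nbr h (Tr u)"
    proof -
      have "h \<circ> Tr u = Tr u \<circ> h"
        unfolding h_def conj_Tr by (rule ext) (simp add: Tr_def Lin_add[OF Sg_Lin] Lin_diff[OF Sg_Lin] Su algebra_simps)
      moreover have "h \<in> carrier Aff" using hv by (simp add: E.nvert_iff)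
      ultimately show ?thesis using E.nbr_commI[OF hv Tr_vert[OF u]] E_commute[OF _ Tr_Aff] by simp
    qed
    ultimately show ?thesis using E.walk_le_3 u by blast
  qed
qed

lemma Aff_connected: assumes "x \<in> nvert Aff" "y \<in> nvert Aff" shows "\<exists>k. E.walk_le k x y"
proof -
  obtain u k v l where u: "u \<noteq> 0" "E.walk_le k x (Tr u)" "v \<noteq> 0" "E.walk_le l y (Tr v)"
    using reaches_translation assms by metis
  have "Tr u \<circ> Tr v = Tr v \<circ> Tr u" unfolding Tr_comp by (simp add: add.commute)
  then have "E.nbr (Tr u) (Tr v)" 
    using E.nbr_commI[OF Tr_vert[OF u(1)] Tr_vert[OF u(3)]] E_commute[OF Tr_Aff Tr_Aff] by simp
  then have "E.walk_le (k + 1 + l) x y" using E.walk_le_trans E.walk_le_sym u E.walk_le_1 by blast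
  then show ?thesis by blast
qed


section \<open>Solubility of the example\<close>

lemma Tr_Lin_inj:
  assumes "A \<in> Lin" "B \<in> Lin" "Tr u \<circ> A = Tr v \<circ> B" shows "u = v \<and> A = B"
proof -
  have e: "u + A x = v + B x" for x using comp_eq_dest[OF assms(3), of x] by (simp add: Tr_def)
  then have "u = v" using e[of 0] assms(1,2) by (simp add: Lin_zero)
  then show ?thesis using e by auto
qed

lemma Aff_comp: "A \<in> Lin \<Longrightarrow> (Tr u \<circ> A) \<circ> (Tr v \<circ> B) = Tr (u + A v) \<circ> (A \<circ> B)"
  by (rule ext) (simp add: Tr_def Lin_add add.assoc)

lemma Lin_comp_form: "\<exists>e'' f''. (Sg e f \<circ> Rot ^^ k) \<circ> (Sg e' f' \<circ> Rot ^^ l) = Sg e'' f'' \<circ> Rot ^^ (k + l)"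
proof -
  obtain e'' f'' where *: "Rot ^^ k \<circ> Sg e' f' = Sg e'' f'' \<circ> Rot ^^ k" using Rot_pow_Sg by blast
  have "(Sg e f \<circ> Rot ^^ k) \<circ> (Sg e' f' \<circ> Rot ^^ l) = Sg e f \<circ> (Rot ^^ k \<circ> Sg e' f') \<circ> Rot ^^ l"
    by (simp only: comp_assoc)
  also have "\<dots> = (Sg e f \<circ> Sg e'' f'') \<circ> Rot ^^ (k + l)" unfolding * funpow_add by (simp only: comp_assoc)
  finally show ?thesis unfolding Sg_Sg by blast
qed

lemma Lin_cancel: "A \<in> Lin \<Longrightarrow> B \<in> Lin \<Longrightarrow> C \<in> Lin \<Longrightarrow> B \<circ> A = C \<circ> A \<Longrightarrow> B = C"
  using E.right_cancel[of A B C] Lin_Aff by simp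

lemma commutator_linear_part:
  assumes "A \<in> Lin" "B \<in> Lin" "C \<in> Lin" "(Tr w \<circ> C) \<circ> ((Tr v \<circ> B) \<circ> (Tr u \<circ> A)) = (Tr u \<circ> A) \<circ> (Tr v \<circ> B)"
  shows "C \<circ> (B \<circ> A) = A \<circ> B"
proof -
  have "Tr (w + C (v + B u)) \<circ> (C \<circ> (B \<circ> A)) = Tr (u + A v) \<circ> (A \<circ> B)"
    using assms(4) unfolding Aff_comp[OF assms(1)] Aff_comp[OF assms(2)] Aff_comp[OF assms(3)] .
  then show ?thesis using Tr_Lin_inj Lin_comp assms(1-3) by metis
qed

text \<open>The derived series is bounded by the translations with sign changes, then by the
  translations, then by the trivial group.\<close>

lemma Aff_solvable: "solvable Aff"
proof -
  define K1 where "K1 = {Tr w \<circ> Sg e f | w e f. True}"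
  define K2 where "K2 = range Tr"
  have K1I: "Tr w \<circ> Sg e f \<in> K1" for w e f unfolding K1_def by blast
  have K1E: "\<exists>w e f. x = Tr w \<circ> Sg e f" if "x \<in> K1" for x using that unfolding K1_def by blast
  have c: "K1 \<subseteq> carrier Aff" "K2 \<subseteq> carrier Aff"
    using AffI[OF Sg_Lin] Tr_Aff unfolding K1_def K2_def by blast+
  have s1: "subgroup K1 Aff"
  proof (rule E.subgroup_finiteI[OF c(1)])
    show "\<one>\<^bsub>Aff\<^esub> \<in> K1" using K1I[of 0 False False] by (simp add: Tr_zero Sg_id)
    fix x y assume "x \<in> K1" "y \<in> K1"
    then obtain w e f w' e' f' where "x = Tr w \<circ> Sg e f" "y = Tr w' \<circ> Sg e' f'" using K1E by metis
    then show "x \<otimes>\<^bsub>Aff\<^esub> y \<in> K1" using K1I by (simp only: Aff_simps Aff_comp[OF Sg_Lin] Sg_Sg)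
  qed
  have s2: "subgroup K2 Aff"
  proof (rule E.subgroup_finiteI[OF c(2)])
    show "\<one>\<^bsub>Aff\<^esub> \<in> K2" unfolding K2_def Aff_simps Tr_zero[symmetric] by blast
    fix x y assume "x \<in> K2" "y \<in> K2"
    then obtain u v where "x = Tr u" "y = Tr v" unfolding K2_def by blast
    then show "x \<otimes>\<^bsub>Aff\<^esub> y \<in> K2" unfolding K2_def Aff_simps by (simp only: Tr_comp) blast
  qed
  have d1: "derived Aff (carrier Aff) \<subseteq> K1"
  proof (rule E.derived_leI[OF s1 order_refl])
    fix x y g assume xy: "x \<in> carrier Aff" "y \<in> carrier Aff" "g \<in> carrier Aff"
      and eq: "g \<otimes>\<^bsub>Aff\<^esub> (y \<otimes>\<^bsub>Aff\<^esub> x) = x \<otimes>\<^bsub>Aff\<^esub> y"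
    obtain u A where x: "x = Tr u \<circ> A" "A \<in> Lin" using xy(1) by (rule AffE)
    obtain v B where y: "y = Tr v \<circ> B" "B \<in> Lin" using xy(2) by (rule AffE)
    obtain w C where g: "g = Tr w \<circ> C" "C \<in> Lin" using xy(3) by (rule AffE)
    have l: "C \<circ> (B \<circ> A) = A \<circ> B"
      using commutator_linear_part[OF x(2) y(2) g(2)] eq unfolding Aff_simps x(1) y(1) g(1) .
    obtain e f i where A: "A = Sg e f \<circ> Rot ^^ i" using x(2) by (rule LinE)
    obtain e' f' j where B: "B = Sg e' f' \<circ> Rot ^^ j" using y(2) by (rule LinE)
    obtain e0 f0 k where C: "C = Sg e0 f0 \<circ> Rot ^^ k" "k < 9" using g(2) by (rule LinE)
    obtain e1 f1 where BA: "B \<circ> A = Sg e1 f1 \<circ> Rot ^^ (j + i)" unfolding A B using Lin_comp_form by blast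
    obtain e2 f2 where AB: "A \<circ> B = Sg e2 f2 \<circ> Rot ^^ (i + j)" unfolding A B using Lin_comp_form by blast
    have "(C \<circ> Sg e1 f1) \<circ> Rot ^^ (i + j) = Sg e2 f2 \<circ> Rot ^^ (i + j)"
      using l unfolding BA AB by (simp only: comp_assoc add.commute)
    then have cs: "C \<circ> Sg e1 f1 = Sg e2 f2" using Lin_cancel Rot_Lin Lin_comp[OF g(2) Sg_Lin] Sg_Lin by blast
    obtain e3 f3 where "(Sg e0 f0 \<circ> Rot ^^ k) \<circ> (Sg e1 f1 \<circ> Rot ^^ 0) = Sg e3 f3 \<circ> Rot ^^ (k + 0)"
      using Lin_comp_form by blast
    then have s3: "Sg e3 f3 \<circ> Rot ^^ k = Sg e2 f2" using cs unfolding C by simp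
    \<comment> \<open>The powers of \<open>Rot\<close> cancel in a commutator; evaluation at
      \<open>ones\<close> turns the remaining identity of sign changes into
      \<open>k = 0\<close>.\<close>
    have "Sg e2 f2 (Sg e3 f3 ((Rot ^^ k) ones)) = Sg e2 f2 (Sg e2 f2 ones)" using fun_cong[OF s3, of ones] by simp
    also have "\<dots> = ones" using fun_cong[OF Sg_Sg[of e2 f2 e2 f2], of ones] by (simp add: Sg_id)
    finally have "Sg (e2 \<noteq> e3) (f2 \<noteq> f3) ((Rot ^^ k) ones) = ones"
      using fun_cong[OF Sg_Sg[of e2 f2 e3 f3], of "(Rot ^^ k) ones"] by simp
    then have "k = 0" using Sg_Rot_ones[OF C(2)] by blast
    then show "g \<in> K1" unfolding g(1) C(1) using K1I by simp
  qed
  have d2: "derived Aff K1 \<subseteq> K2"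
  proof (rule E.derived_leI[OF s2 c(1)])
    fix x y g assume xy: "x \<in> K1" "y \<in> K1" "g \<in> carrier Aff"
      and eq: "g \<otimes>\<^bsub>Aff\<^esub> (y \<otimes>\<^bsub>Aff\<^esub> x) = x \<otimes>\<^bsub>Aff\<^esub> y"
    obtain u e f v e' f' where x: "x = Tr u \<circ> Sg e f" and y: "y = Tr v \<circ> Sg e' f'" using K1E xy by metis
    obtain w C where g: "g = Tr w \<circ> C" "C \<in> Lin" using xy(3) by (rule AffE)
    have "C \<circ> (Sg e' f' \<circ> Sg e f) = Sg e f \<circ> Sg e' f'"
      using commutator_linear_part[OF Sg_Lin Sg_Lin g(2)] eq unfolding Aff_simps x y g(1) .
    also have "Sg e f \<circ> Sg e' f' = id \<circ> (Sg e' f' \<circ> Sg e f)" unfolding Sg_Sg id_comp by (simp add: eq_commute)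
    finally have "C = id" using Lin_cancel[OF Lin_comp[OF Sg_Lin Sg_Lin] g(2) id_Lin] by blast
    then show "g \<in> K2" unfolding K2_def g(1) by simp
  qed
  have d3: "derived Aff K2 \<subseteq> {\<one>\<^bsub>Aff\<^esub>}"
  proof (rule E.derived_leI[OF E.triv_subgroup c(2)])
    fix x y g assume xy: "x \<in> K2" "y \<in> K2" "g \<in> carrier Aff"
      and eq: "g \<otimes>\<^bsub>Aff\<^esub> (y \<otimes>\<^bsub>Aff\<^esub> x) = x \<otimes>\<^bsub>Aff\<^esub> y"
    obtain u v where "x = Tr u" "y = Tr v" using xy unfolding K2_def by blast
    then have "x \<otimes>\<^bsub>Aff\<^esub> y = y \<otimes>\<^bsub>Aff\<^esub> x" by (simp add: Tr_comp add.commute)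
    then have "g \<otimes>\<^bsub>Aff\<^esub> (y \<otimes>\<^bsub>Aff\<^esub> x) = y \<otimes>\<^bsub>Aff\<^esub> x" using eq by simp
    moreover have "x \<in> carrier Aff" "y \<in> carrier Aff" using xy c(2) by blast+
    ultimately have "g = \<one>\<^bsub>Aff\<^esub>" using E.r_cancel_one[OF E.m_closed xy(3)] by blast
    then show "g \<in> {\<one>\<^bsub>Aff\<^esub>}" by blast
  qed
  have "(derived Aff ^^ 3) (carrier Aff) \<subseteq> {\<one>\<^bsub>Aff\<^esub>}"
    using d3 E.mono_derived[OF d2] E.mono_derived[OF E.mono_derived[OF d1]] by (simp add: numeral_3_eq_3)
  moreover have "\<one>\<^bsub>Aff\<^esub> \<in> (derived Aff ^^ 3) (carrier Aff)"
    using subgroup.one_closed[OF E.exp_of_derived_is_subgroup[OF E.subgroup_self]] .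
  ultimately have "(derived Aff ^^ 3) (carrier Aff) = {\<one>\<^bsub>Aff\<^esub>}" by blast
  then show ?thesis unfolding solvable_def using E.trivial_derived_seq_imp_solvable[OF E.subgroup_self] by blast
qed

lemma diameter_6_exists:
  "\<exists>H :: (nat \<Rightarrow> nat) monoid. group H \<and> finite (carrier H) \<and> solvable H \<and> ndiam H = 6"
proof -
  obtain f :: "(vec \<Rightarrow> vec) \<Rightarrow> nat" where f: "inj f"
    using finite_imp_inj_to_nat_seg[of "UNIV :: (vec \<Rightarrow> vec) set"] by auto
  \<comment> \<open>There are finitely many maps between vectors; they are numbered and each number
    becomes a constant function.\<close>
  have "inj_on (\<lambda>x (_ :: nat). f x) (carrier Aff)"
    using f by (auto simp: inj_on_def inj_def dest: fun_cong)
  moreover have "E.conj (Tr ones) Rot \<in> nvert Aff"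
    using E.nbr_conj[OF E.nbr_refl[OF Rot_vert] Tr_Aff[of ones]] by (simp add: E.nbr_def)
  ultimately show ?thesis
    using transport_diameter_6[OF Aff_fin_group _ Aff_solvable Aff_connected Rot_vert _ far_apart] by blast
qed

theorem theorem1:
  fixes G :: "'a monoid"
  assumes "group G" and "finite (carrier G)" and "solvable G"
  shows "((\<not> nconnected G \<longleftrightarrow> frob_condition G) \<and>
          (\<not> nconnected G \<longrightarrow> (\<forall>x\<in>nvert G. ndiam_on G (ncomponent G x) \<le> 2))) \<and>
         (nconnected G \<longrightarrow> ndiam G \<le> 6) \<and>
         (\<exists>H :: (nat \<Rightarrow> nat) monoid. group H \<and> finite (carrier H) \<and> solvable H \<and>
            ndiam H = 6)"
proof -
  interpret fin_group G using assms(1,2) by (simp add: fin_group_def fin_group_axioms_def)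
  show ?thesis using connectivity_and_diameter[OF assms(3)] diameter_6_exists by blast
qed

end
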